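(* Let $M$ be a smooth two-dimensional manifold, with tangent bundle $TM$ and bundle of $1$-forms $\Lambda^1$. Let $\nabla_a : TM \to \Lambda^1\otimes TM$ be a torsion-free connection whose Ricci tensor $R_{ab}$ is symmetric, and let $Y_{abc} \equiv \nabla_a R_{bc} - \nabla_b R_{ac}$. Then $Y_{abc}=0$ on $M$ if and only if near every point of $M$ there are local coordinates in which the (unparameterised) geodesics of $\nabla_a$ become straight lines.
   Context: Tensor indices are abstract indices, and everything is smooth. The connection $\nabla_a$ on $TM$ is extended to all tensor bundles in the usual way; $\nabla_a\nabla_b X^c$ denotes the second covariant derivative. Ricci tensor: $R_{ab}$ is characterised by $(\nabla_a\nabla_b-\nabla_b\nabla_a)X^b=-R_{ab}X^b$ for all vector fields $X^b$. Equivalently, with $R(U,V)Z=\nabla_U\nabla_V Z-\nabla_V\nabla_U Z-\nabla_{[U,V]}Z$, $R_{ab}Y^aZ^b$ is the trace of the endomorphism $V\mapsto R(V,Y)Z$. For a general torsion-free connection it need not be symmetric. Geodesics: these are understood as unparameterised curves. A smooth (regular) curve with velocity field $U^a$ is a geodesic of $\nabla_a$ if $U^b\nabla_b U^a = f U^a$ along the curve for some smooth function $f$ (equivalently, the curve can be reparameterised so that its acceleration $U^b\nabla_bU^a$ vanishes). "There are local coordinates near any point in which the geodesics become straight lines" means: every point of $M$ has an open neighbourhood $W$ and a coordinate chart $W\to\mathbb{R}^2$ (a diffeomorphism onto an open subset) under which every geodesic of $\nabla_a$ lying in $W$ is mapped, as an unparameterised curve, into an affine straight line of $\mathbb{R}^2$.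 *)

theory Defs
  imports "HOL-Analysis.Analysis" "HOL-Library.Function_Algebras"
begin

section \<open>Functions with values in a real vector space, with pointwise operations\<close>

instantiation "fun" :: (type, real_vector) real_vector
begin

definition scaleR_fun :: "real \<Rightarrow> ('a \<Rightarrow> 'b) \<Rightarrow> 'a \<Rightarrow> 'b" where
  "scaleR_fun c f = (\<lambda>x. c *\<^sub>R f x)"

instance
  by standard (auto simp: scaleR_fun_def plus_fun_def fun_eq_iff algebra_simps)

end

section \<open>Smooth maps between Euclidean spaces\<close>

text \<open>Only meant for open sets \<open>S\<close>.\<close>

fun C_on :: "nat \<Rightarrow> 'a::euclidean_space set \<Rightarrow> ('a \<Rightarrow> 'b::real_normed_vector) \<Rightarrow> bool" where
  "C_on 0 S f \<longleftrightarrow> continuous_on S f"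
| "C_on (Suc k) S f \<longleftrightarrow>
     (\<forall>x\<in>S. f differentiable (at x)) \<and> (\<forall>v. C_on k S (\<lambda>x. frechet_derivative f (at x) v))"

definition smooth_on :: "'a::euclidean_space set \<Rightarrow> ('a \<Rightarrow> 'b::real_normed_vector) \<Rightarrow> bool" where
  "smooth_on S f \<longleftrightarrow> (\<forall>k. C_on k S f)"

section \<open>Smooth manifolds\<close>

text \<open>
  The underlying space of the manifold is a whole topological type \<open>'m\<close>. A chart is a pair
  \<open>(U, \<phi>)\<close>, where only the values of \<open>\<phi>\<close> on \<open>U\<close> matter.
\<close>

type_synonym ('m, 'n) chart = "'m set \<times> ('m \<Rightarrow> real^'n)"

definition smooth_compatible ::
    "('m, 'n::finite) chart \<Rightarrow> ('m, 'n) chart \<Rightarrow> bool" where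
  "smooth_compatible c d \<longleftrightarrow>
     smooth_on (snd c ` (fst c \<inter> fst d)) (snd d \<circ> inv_into (fst c) (snd c)) \<and>
     smooth_on (snd d ` (fst c \<inter> fst d)) (snd c \<circ> inv_into (fst d) (snd d))"

definition coordinate_chart ::
    "('m::topological_space, 'n::finite) chart set \<Rightarrow> ('m, 'n) chart \<Rightarrow> bool" where
  "coordinate_chart A c \<longleftrightarrow>
     open (fst c) \<and> open (snd c ` fst c) \<and>
     homeomorphism (fst c) (snd c ` fst c) (snd c) (inv_into (fst c) (snd c)) \<and>
     (\<forall>d\<in>A. smooth_compatible c d)"

definition smooth_atlas :: "('m::topological_space, 'n::finite) chart set \<Rightarrow> bool" where
  "smooth_atlas A \<longleftrightarrow> (\<Union>c\<in>A. fst c) = UNIV \<and> (\<forall>c\<in>A. coordinate_chart A c)"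

definition smooth_fun ::
    "('m::topological_space, 'n::finite) chart set \<Rightarrow> 'm set \<Rightarrow> ('m \<Rightarrow> real) \<Rightarrow> bool" where
  "smooth_fun A W f \<longleftrightarrow>
     (\<forall>c\<in>A. smooth_on (snd c ` (fst c \<inter> W)) (f \<circ> inv_into (fst c) (snd c)))"

definition smooth_near ::
    "('m::topological_space, 'n::finite) chart set \<Rightarrow> 'm \<Rightarrow> ('m \<Rightarrow> real) \<Rightarrow> bool" where
  "smooth_near A p f \<longleftrightarrow> (\<exists>W. open W \<and> p \<in> W \<and> smooth_fun A W f)"

section \<open>Tangent vectors and vector fields\<close>

text \<open>
  Tangent vectors at \<open>p\<close> are derivations of the functions that are smooth near \<open>p\<close>. To make them
  unique as HOL functions they vanish on all other functions. No separate locality axiom is needed: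
  a function \<open>f\<close> that vanishes near \<open>p\<close> equals \<open>f * h\<close> with \<open>h\<close> the indicator function of the
  complement of a neighbourhood of \<open>p\<close>, and \<open>h\<close> is smooth near \<open>p\<close>.
\<close>

type_synonym 'm tangent = "('m \<Rightarrow> real) \<Rightarrow> real"

type_synonym 'm vector_field = "'m \<Rightarrow> 'm tangent"

definition tangent_space ::
    "('m::topological_space, 'n::finite) chart set \<Rightarrow> 'm \<Rightarrow> 'm tangent set" where
  "tangent_space A p = {v.
     (\<forall>f. \<not> smooth_near A p f \<longrightarrow> v f = 0) \<and>
     (\<forall>f g a b. smooth_near A p f \<and> smooth_near A p g \<longrightarrow>
        v (\<lambda>q. a * f q + b * g q) = a * v f + b * v g) \<and>
     (\<forall>f g. smooth_near A p f \<and> smooth_near A p g \<longrightarrow>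
        v (\<lambda>q. f q * g q) = f p * v g + g p * v f)}"

definition smooth_vector_field ::
    "('m::topological_space, 'n::finite) chart set \<Rightarrow> 'm set \<Rightarrow> 'm vector_field \<Rightarrow> bool" where
  "smooth_vector_field A W X \<longleftrightarrow>
     (\<forall>p\<in>W. X p \<in> tangent_space A p) \<and>
     (\<forall>V f. open V \<and> V \<subseteq> W \<and> smooth_fun A V f \<longrightarrow> smooth_fun A V (\<lambda>p. X p f))"

definition lie_bracket ::
    "('m::topological_space, 'n::finite) chart set \<Rightarrow> 'm vector_field \<Rightarrow> 'm vector_field \<Rightarrow> 'm vector_field"
  where
  "lie_bracket A X Y p f =
     (if smooth_near A p f then X p (\<lambda>q. Y q f) - Y p (\<lambda>q. X q f) else 0)"

text \<open>A local smooth vector field with prescribed value at a point.\<close>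

definition extend_tangent ::
    "('m::topological_space, 'n::finite) chart set \<Rightarrow> 'm \<Rightarrow> 'm tangent \<Rightarrow> 'm vector_field" where
  "extend_tangent A p v =
     (SOME X. \<exists>W. open W \<and> p \<in> W \<and> smooth_vector_field A W X \<and> X p = v)"

section \<open>Connections\<close>

text \<open>
  A connection \<open>TM \<rightarrow> \<Lambda>\<^sup>1 \<otimes> TM\<close> acts on local sections: \<open>nabla X p u\<close> is the derivative of \<open>X\<close> at \<open>p\<close>
  in the direction \<open>u\<close>, and is meaningful when \<open>X\<close> is smooth on some open set containing \<open>p\<close>.
  The last clause says that \<open>nabla\<close> commutes with restriction to open subsets.
\<close>

type_synonym 'm nabla = "'m vector_field \<Rightarrow> 'm \<Rightarrow> 'm tangent \<Rightarrow> 'm tangent"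

definition connection ::
    "('m::topological_space, 'n::finite) chart set \<Rightarrow> 'm nabla \<Rightarrow> bool" where
  "connection A nabla \<longleftrightarrow>
     (\<forall>W X. open W \<and> smooth_vector_field A W X \<longrightarrow>
        (\<forall>p\<in>W. \<forall>u\<in>tangent_space A p. nabla X p u \<in> tangent_space A p) \<and>
        (\<forall>p\<in>W. \<forall>u\<in>tangent_space A p. \<forall>v\<in>tangent_space A p. \<forall>a b.
           nabla X p (a *\<^sub>R u + b *\<^sub>R v) = a *\<^sub>R nabla X p u + b *\<^sub>R nabla X p v) \<and>
        (\<forall>U. smooth_vector_field A W U \<longrightarrow> smooth_vector_field A W (\<lambda>p. nabla X p (U p))) \<and>
        (\<forall>Y. smooth_vector_field A W Y \<longrightarrow>
           (\<forall>p\<in>W. \<forall>u\<in>tangent_space A p. nabla (X + Y) p u = nabla X p u + nabla Y p u)) \<and>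
        (\<forall>f. smooth_fun A W f \<longrightarrow>
           (\<forall>p\<in>W. \<forall>u\<in>tangent_space A p.
              nabla (\<lambda>q. f q *\<^sub>R X q) p u = u f *\<^sub>R X p + f p *\<^sub>R nabla X p u)) \<and>
        (\<forall>Y. smooth_vector_field A W Y \<and> (\<forall>q\<in>W. X q = Y q) \<longrightarrow>
           (\<forall>p\<in>W. \<forall>u\<in>tangent_space A p. nabla X p u = nabla Y p u)))"

definition torsion_free ::
    "('m::topological_space, 'n::finite) chart set \<Rightarrow> 'm nabla \<Rightarrow> bool" where
  "torsion_free A nabla \<longleftrightarrow>
     (\<forall>W X Y. open W \<and> smooth_vector_field A W X \<and> smooth_vector_field A W Y \<longrightarrow>
        (\<forall>p\<in>W. nabla Y p (X p) - nabla X p (Y p) = lie_bracket A X Y p))"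

section \<open>Curvature\<close>

definition curvature_field ::
    "('m::topological_space, 'n::finite) chart set \<Rightarrow> 'm nabla \<Rightarrow>
       'm vector_field \<Rightarrow> 'm vector_field \<Rightarrow> 'm vector_field \<Rightarrow> 'm vector_field" where
  "curvature_field A nabla U V Z p =
     nabla (\<lambda>q. nabla Z q (V q)) p (U p) - nabla (\<lambda>q. nabla Z q (U q)) p (V p)
     - nabla Z p (lie_bracket A U V p)"

text \<open>
  In the following two definitions on tangent vectors the choice of the extensions to local vector
  fields is immaterial, since the expressions are tensorial in these fields.
\<close>

definition curvature ::
    "('m::topological_space, 'n::finite) chart set \<Rightarrow> 'm nabla \<Rightarrow> 'm \<Rightarrow>
       'm tangent \<Rightarrow> 'm tangent \<Rightarrow> 'm tangent \<Rightarrow> 'm tangent" where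
  "curvature A nabla p u v z =
     curvature_field A nabla (extend_tangent A p u) (extend_tangent A p v) (extend_tangent A p z) p"

definition covariant_derivative_2 ::
    "('m::topological_space, 'n::finite) chart set \<Rightarrow> 'm nabla \<Rightarrow>
       ('m \<Rightarrow> 'm tangent \<Rightarrow> 'm tangent \<Rightarrow> real) \<Rightarrow>
       'm \<Rightarrow> 'm tangent \<Rightarrow> 'm tangent \<Rightarrow> 'm tangent \<Rightarrow> real" where
  "covariant_derivative_2 A nabla T p u v w =
     (let V = extend_tangent A p v; W = extend_tangent A p w in
        u (\<lambda>q. T q (V q) (W q)) - T p (nabla V p u) w - T p v (nabla W p u))"

definition tangent_basis ::
    "('m::topological_space, 'n::finite) chart set \<Rightarrow> 'm \<Rightarrow> ('n \<Rightarrow> 'm tangent) \<Rightarrow> bool" where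
  "tangent_basis A p e \<longleftrightarrow>
     (\<forall>i. e i \<in> tangent_space A p) \<and>
     (\<forall>v\<in>tangent_space A p. \<exists>!c :: real^'n. v = (\<Sum>i\<in>UNIV. c $ i *\<^sub>R e i))"

text \<open>The trace of an endomorphism of a tangent space, computed by its matrix in any basis.\<close>

definition tangent_trace ::
    "('m::topological_space, 'n::finite) chart set \<Rightarrow> 'm \<Rightarrow> ('m tangent \<Rightarrow> 'm tangent) \<Rightarrow> real" where
  "tangent_trace A p L =
     (THE t. \<forall>e. \<forall>a :: real^'n^'n.
        tangent_basis A p e \<and> (\<forall>j. L (e j) = (\<Sum>i\<in>UNIV. a $ i $ j *\<^sub>R e i)) \<longrightarrow> t = trace a)"

definition ricci ::
    "('m::topological_space, 'n::finite) chart set \<Rightarrow> 'm nabla \<Rightarrow> 'm \<Rightarrow> 'm tangent \<Rightarrow> 'm tangent \<Rightarrow> real"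
  where
  "ricci A nabla p y z = tangent_trace A p (\<lambda>v. curvature A nabla p v y z)"

definition ricci_symmetric ::
    "('m::topological_space, 'n::finite) chart set \<Rightarrow> 'm nabla \<Rightarrow> bool" where
  "ricci_symmetric A nabla \<longleftrightarrow>
     (\<forall>p. \<forall>y\<in>tangent_space A p. \<forall>z\<in>tangent_space A p. ricci A nabla p y z = ricci A nabla p z y)"

text \<open>\<open>Y\<^sub>a\<^sub>b\<^sub>c = \<nabla>\<^sub>a R\<^sub>b\<^sub>c - \<nabla>\<^sub>b R\<^sub>a\<^sub>c\<close>, with \<open>a\<close>, \<open>b\<close>, \<open>c\<close> contracted with \<open>u\<close>, \<open>v\<close>, \<open>w\<close>.\<close>

definition cotton_york ::
    "('m::topological_space, 'n::finite) chart set \<Rightarrow> 'm nabla \<Rightarrow> 'm \<Rightarrow>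
       'm tangent \<Rightarrow> 'm tangent \<Rightarrow> 'm tangent \<Rightarrow> real" where
  "cotton_york A nabla p u v w =
     covariant_derivative_2 A nabla (ricci A nabla) p u v w
     - covariant_derivative_2 A nabla (ricci A nabla) p v u w"

section \<open>Geodesics\<close>

definition smooth_curve ::
    "('m::topological_space, 'n::finite) chart set \<Rightarrow> real set \<Rightarrow> (real \<Rightarrow> 'm) \<Rightarrow> bool" where
  "smooth_curve A I \<gamma> \<longleftrightarrow>
     continuous_on I \<gamma> \<and> (\<forall>c\<in>A. smooth_on (I \<inter> \<gamma> -` fst c) (snd c \<circ> \<gamma>))"

definition velocity ::
    "('m::topological_space, 'n::finite) chart set \<Rightarrow> (real \<Rightarrow> 'm) \<Rightarrow> real \<Rightarrow> 'm tangent" where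
  "velocity A \<gamma> t f = (if smooth_near A (\<gamma> t) f then deriv (f \<circ> \<gamma>) t else 0)"

text \<open>
  The acceleration \<open>U\<^sup>b \<nabla>\<^sub>b U\<^sup>a\<close> of a regular curve is computed by extending its velocity \<open>U\<close> locally
  to a vector field \<open>X\<close> on an open set. Such an extension exists because a regular curve is locally
  an embedding, and the result does not depend on it.
\<close>

definition has_acceleration ::
    "('m::topological_space, 'n::finite) chart set \<Rightarrow> 'm nabla \<Rightarrow> (real \<Rightarrow> 'm) \<Rightarrow> real \<Rightarrow> 'm tangent \<Rightarrow> bool"
  where
  "has_acceleration A nabla \<gamma> t a \<longleftrightarrow>
     (\<exists>W X. open W \<and> \<gamma> t \<in> W \<and> smooth_vector_field A W X \<and>
        (\<forall>\<^sub>F s in nhds t. X (\<gamma> s) = velocity A \<gamma> s) \<and>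
        a = nabla X (\<gamma> t) (velocity A \<gamma> t))"

definition geodesic ::
    "('m::topological_space, 'n::finite) chart set \<Rightarrow> 'm nabla \<Rightarrow> real set \<Rightarrow> (real \<Rightarrow> 'm) \<Rightarrow> bool" where
  "geodesic A nabla I \<gamma> \<longleftrightarrow>
     open I \<and> is_interval I \<and> smooth_curve A I \<gamma> \<and> (\<forall>t\<in>I. velocity A \<gamma> t \<noteq> 0) \<and>
     (\<exists>f :: real \<Rightarrow> real. smooth_on I f \<and>
        (\<forall>t\<in>I. has_acceleration A nabla \<gamma> t (f t *\<^sub>R velocity A \<gamma> t)))"

definition straightens_geodesics ::
    "('m::topological_space, 'n::finite) chart set \<Rightarrow> 'm nabla \<Rightarrow> ('m, 'n) chart \<Rightarrow> bool" where
  "straightens_geodesics A nabla c \<longleftrightarrow>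
     (\<forall>I \<gamma>. geodesic A nabla I \<gamma> \<and> \<gamma> ` I \<subseteq> fst c \<longrightarrow>
        (\<exists>L. affine L \<and> aff_dim L = 1 \<and> snd c ` \<gamma> ` I \<subseteq> L))"

end

theory Submission
  imports Defs
begin

text \<open>
  For symmetric \<open>R\<^sub>a\<^sub>b\<close> the equation \<open>\<nabla>\<^sub>a \<nabla>\<^sub>b \<sigma> + R\<^sub>a\<^sub>b \<sigma> = 0\<close> prolongs to a linear connection of rank three
  on the pairs \<open>(\<sigma>, d\<sigma>)\<close>, whose curvature in dimension two is \<open>Y\<^sub>a\<^sub>b\<^sub>c\<close>. If \<open>Y = 0\<close>, there are locally three
  independent solutions. Along a geodesic all of them solve the same linear ODE of second order, hence
  they are linearly dependent there, and the quotients of two of them by the third one are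
  coordinates in which the geodesic is straight.

  Conversely, if all geodesics are straight in some coordinates, then \<open>\<Gamma>(v, v)\<close> is proportional to \<open>v\<close> for
  every \<open>v\<close>, which means \<open>\<Gamma>\<^sup>c\<^sub>a\<^sub>b = \<delta>\<^sup>c\<^sub>a \<omega>\<^sub>b + \<delta>\<^sup>c\<^sub>b \<omega>\<^sub>a\<close>. Symmetry of the Ricci tensor says that the 1-form \<open>\<omega>\<close> is
  closed, and then \<open>Y = 0\<close> follows from a computation.

  Tangent vectors are derivations here, so Hadamard's lemma is needed to express them in coordinates.
\<close>

section \<open>Calculus of smooth maps\<close>

text \<open>In dimension two \<open>R(U,V)Z = Ric(V,Z) U - Ric(U,Z) V\<close>. Commuting derivatives
  in the prolonged system therefore makes the terms in d\<sigma> cancel identically; what remains is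
  the symmetry of Ric, which is equality of the mixed derivatives of \<sigma>, and
  \<open>Y = 0\<close>. For the standard connection of the plane the solutions are the affine
  functions 1, x, y, which is why quotients of solutions are the natural straightening coordinates.
  The analytic obstacle is to solve the flat linear system jointly smoothly. Integrating along an
  axis and then along the transversal lines gives a function that is at first only continuous in the
  first variable, so the first equation cannot be checked by differentiating; its integrated defect
  is shown to vanish instead. Smoothness then follows since the system expresses the derivative of
  the solution by the solution. The geometric objects are operators on fields of derivations, partly
  defined by \<open>SOME\<close> and \<open>THE\<close>. Each is converted once into components in a
  chart (\<open>\<Gamma>\<close>, \<open>\<rho>\<close>, \<open>cotton\<close>); both directions are
  then computations on an open subset of the plane.\<close>

lemma C_on_subset: "C_on k S f \<Longrightarrow> T \<subseteq> S \<Longrightarrow> C_on k T f"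
proof (induction k arbitrary: f)
  case 0
  then show ?case by (auto intro: continuous_on_subset)
next
  case (Suc k)
  then show ?case by auto
qed

lemma C_on_imp_continuous_on: "C_on k S f \<Longrightarrow> continuous_on S f"
  by (cases k)
    (auto intro!: continuous_at_imp_continuous_on differentiable_imp_continuous_within)

lemma C_on_has_derivative:
  "C_on (Suc k) S f \<Longrightarrow> x \<in> S \<Longrightarrow> (f has_derivative frechet_derivative f (at x)) (at x)"
  by (simp add: frechet_derivative_works)

lemma C_on_SucD: "C_on (Suc k) S f \<Longrightarrow> C_on k S f"
proof (induction k arbitrary: f)
  case 0
  then show ?case
    using C_on_imp_continuous_on[OF 0] by simp
next
  case (Suc k)
  have "C_on (Suc k) S (\<lambda>x. frechet_derivative f (at x) v)" for v
    using Suc.prems unfolding C_on.simps(2)[of "Suc k"] by blast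
  then have "C_on k S (\<lambda>x. frechet_derivative f (at x) v)" for v
    using Suc.IH by blast
  then show ?case
    using Suc.prems unfolding C_on.simps(2) by blast
qed

lemma C_on_cong:
  assumes "open S" "\<And>x. x \<in> S \<Longrightarrow> f x = g x"
  shows "C_on k S f \<longleftrightarrow> C_on k S g"
proof -
  have imp: "C_on k S g" if "C_on k S f" "\<And>x. x \<in> S \<Longrightarrow> f x = g x" for f g
    using that
  proof (induction k arbitrary: f g)
    case 0
    then show ?case by (simp cong: continuous_on_cong)
  next
    case (Suc k)
    have d: "(g has_derivative frechet_derivative f (at x)) (at x)" if "x \<in> S" for x
      using C_on_has_derivative[OF Suc.prems(1) that] \<open>open S\<close> that Suc.prems(2)
      by (rule has_derivative_transform_within_open)
    have "C_on k S (\<lambda>x. frechet_derivative g (at x) v)" for v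
    proof (rule Suc.IH)
      show "C_on k S (\<lambda>x. frechet_derivative f (at x) v)"
        using Suc.prems(1) by simp
      show "frechet_derivative f (at x) v = frechet_derivative g (at x) v" if "x \<in> S" for x
        by (metis frechet_derivative_at[OF d[OF that]])
    qed
    then show ?case
      using d by (auto simp: differentiable_def)
  qed
  show ?thesis
    using imp[of f g] imp[of g f] assms(2) by auto
qed

text \<open>Lets later inductions work with an explicit formula for the derivative; by uniqueness of
  derivatives it agrees on \<open>S\<close> with the \<open>frechet_derivative\<close> in the
  definition of \<open>C_on\<close>.\<close>

lemma C_on_SucI:
  assumes "open S" "\<And>x. x \<in> S \<Longrightarrow> (f has_derivative f' x) (at x)"
    and "\<And>v. C_on k S (\<lambda>x. f' x v)"
  shows "C_on (Suc k) S f"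
proof -
  have "C_on k S (\<lambda>x. frechet_derivative f (at x) v)" for v
    using assms(3)[of v] C_on_cong[OF assms(1), of "\<lambda>x. f' x v" "\<lambda>x. frechet_derivative f (at x) v"]
    by (metis frechet_derivative_at[OF assms(2)])
  then show ?thesis
    using assms(2) by (auto simp: differentiable_def)
qed

lemma C_on_Union:
  assumes "\<And>T. T \<in> \<T> \<Longrightarrow> open T" "\<And>T. T \<in> \<T> \<Longrightarrow> C_on k T f"
  shows "C_on k (\<Union>\<T>) f"
  using assms(2)
proof (induction k arbitrary: f)
  case 0
  then show ?case using assms(1) by (auto intro: continuous_on_open_Union)
next
  case (Suc k)
  then have "C_on k (\<Union>\<T>) (\<lambda>x. frechet_derivative f (at x) v)" for v
    by (intro Suc.IH) auto
  then show ?case using Suc.prems by auto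
qed

lemma C_on_const: "open S \<Longrightarrow> C_on k S (\<lambda>x. c)"
  by (induction k arbitrary: c) (auto intro!: C_on_SucI derivative_eq_intros)

lemma C_on_bounded_linear_compose:
  assumes "bounded_linear L" "open S" "C_on k S f"
  shows "C_on k S (\<lambda>x. L (f x))"
  using assms(3)
proof (induction k arbitrary: f)
  case 0
  then show ?case
    using bounded_linear.continuous_on[OF assms(1)] by auto
next
  case (Suc k)
  show ?case
  proof (rule C_on_SucI[OF \<open>open S\<close>])
    show "((\<lambda>x. L (f x)) has_derivative (\<lambda>v. L (frechet_derivative f (at x) v))) (at x)"
      if "x \<in> S" for x
      using C_on_has_derivative[OF Suc.prems that] bounded_linear.has_derivative[OF assms(1)] by blast
    show "C_on k S (\<lambda>x. L (frechet_derivative f (at x) v))" for v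
      using Suc.prems by (intro Suc.IH) auto
  qed
qed

lemma C_on_add:
  assumes "open S" "C_on k S f" "C_on k S g"
  shows "C_on k S (\<lambda>x. f x + g x)"
  using assms(2,3)
proof (induction k arbitrary: f g)
  case 0
  then show ?case by (auto intro: continuous_intros)
next
  case (Suc k)
  show ?case
  proof (rule C_on_SucI[OF \<open>open S\<close>])
    show "((\<lambda>x. f x + g x) has_derivative
        (\<lambda>v. frechet_derivative f (at x) v + frechet_derivative g (at x) v)) (at x)"
      if "x \<in> S" for x
      using C_on_has_derivative[OF Suc.prems(1) that] C_on_has_derivative[OF Suc.prems(2) that]
      by (rule has_derivative_add)
    show "C_on k S (\<lambda>x. frechet_derivative f (at x) v + frechet_derivative g (at x) v)" for v
      using Suc.prems by (intro Suc.IH) auto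
  qed
qed

text \<open>Covers all products at once. The product rule leaves one factor undifferentiated, and
  \<open>C_on_SucD\<close> lowers the order of that factor to the one in the induction
  hypothesis.\<close>

lemma C_on_bilinear:
  assumes "bounded_bilinear B" "open S" "C_on k S f" "C_on k S g"
  shows "C_on k S (\<lambda>x. B (f x) (g x))"
  using assms(3,4)
proof (induction k arbitrary: f g)
  case 0
  then show ?case
    using bounded_bilinear.continuous_on[OF assms(1)] by auto
next
  case (Suc k)
  show ?case
  proof (rule C_on_SucI[OF \<open>open S\<close>])
    show "((\<lambda>x. B (f x) (g x)) has_derivative (\<lambda>v. B (f x) (frechet_derivative g (at x) v)
        + B (frechet_derivative f (at x) v) (g x))) (at x)"
      if "x \<in> S" for x
      using C_on_has_derivative[OF Suc.prems(1) that] C_on_has_derivative[OF Suc.prems(2) that]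
      by (rule bounded_bilinear.FDERIV[OF assms(1)])
    show "C_on k S (\<lambda>x. B (f x) (frechet_derivative g (at x) v)
        + B (frechet_derivative f (at x) v) (g x))" for v
      using Suc.prems C_on_SucD[OF Suc.prems(1)] C_on_SucD[OF Suc.prems(2)]
      by (intro C_on_add Suc.IH \<open>open S\<close>) auto
  qed
qed

lemma C_on_sum:
  assumes "open S" "finite I" "\<And>i. i \<in> I \<Longrightarrow> C_on k S (f i)"
  shows "C_on k S (\<lambda>x. \<Sum>i\<in>I. f i x)"
  using assms(2,3)
  by (induction I rule: finite_induct) (simp_all add: C_on_const C_on_add assms(1))

lemma C_on_compose:
  fixes f :: "'a::euclidean_space \<Rightarrow> 'b::euclidean_space" and g :: "'b \<Rightarrow> 'c::real_normed_vector"
  assumes "open S" "C_on k S f" "C_on k T g" "f ` S \<subseteq> T"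
  shows "C_on k S (\<lambda>x. g (f x))"
  using assms(2,3)
proof (induction k arbitrary: g)
  case 0
  then show ?case
    using assms(4) continuous_on_compose2[of T g S f] by auto
next
  case (Suc k)
  show ?case
  proof (rule C_on_SucI[OF \<open>open S\<close>])
    fix x assume x: "x \<in> S"
    have g: "(g has_derivative frechet_derivative g (at (f x))) (at (f x))"
      using Suc.prems(2) assms(4) x by (intro C_on_has_derivative[of k T]) auto
    have f: "(f has_derivative frechet_derivative f (at x)) (at x)"
      using Suc.prems(1) x by (rule C_on_has_derivative)
    \<comment> \<open>The chain rule evaluates the derivative of \<open>g\<close> in a direction
      that varies with \<open>x\<close>, whereas \<open>C_on\<close> speaks of fixed directions
      only. Expanding in the basis moves the variation into scalar coefficients.\<close>
    have expand: "frechet_derivative g (at (f x)) v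
        = (\<Sum>b\<in>Basis. (v \<bullet> b) *\<^sub>R frechet_derivative g (at (f x)) b)" for v
    proof -
      have "frechet_derivative g (at (f x)) v
          = frechet_derivative g (at (f x)) (\<Sum>b\<in>Basis. (v \<bullet> b) *\<^sub>R b)"
        by (simp add: euclidean_representation)
      then show ?thesis
        by (simp add: linear_sum[OF has_derivative_linear[OF g]] linear_scale[OF has_derivative_linear[OF g]])
    qed
    show "((\<lambda>x. g (f x)) has_derivative (\<lambda>v. \<Sum>b\<in>Basis.
        (frechet_derivative f (at x) v \<bullet> b) *\<^sub>R frechet_derivative g (at (f x)) b)) (at x)"
      by (rule has_derivative_eq_rhs[OF has_derivative_compose[OF f g]]) (rule ext, rule expand)
  next
    fix v
    have 1: "C_on k S (\<lambda>x. frechet_derivative g (at (f x)) b)" for b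
      using Suc.prems(2) by (intro Suc.IH C_on_SucD[OF Suc.prems(1)]) auto
    have 2: "C_on k S (\<lambda>x. frechet_derivative f (at x) v \<bullet> b)" for b
      using Suc.prems(1)
      by (intro C_on_bounded_linear_compose[OF bounded_linear_inner_left] \<open>open S\<close>) auto
    show "C_on k S (\<lambda>x. \<Sum>b\<in>Basis.
        (frechet_derivative f (at x) v \<bullet> b) *\<^sub>R frechet_derivative g (at (f x)) b)"
      by (intro C_on_sum C_on_bilinear[OF bounded_bilinear_scaleR] 1 2 \<open>open S\<close>) auto
  qed
qed

lemma C_on_inverse:
  fixes f :: "'a::euclidean_space \<Rightarrow> real"
  assumes "open S" "C_on k S f" "\<And>x. x \<in> S \<Longrightarrow> f x \<noteq> 0"
  shows "C_on k S (\<lambda>x. inverse (f x))"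
  using assms(2)
proof (induction k)
  case 0
  then show ?case using assms(3) by (auto intro: continuous_intros)
next
  case (Suc k)
  show ?case
  proof (rule C_on_SucI[OF \<open>open S\<close>])
    show "((\<lambda>x. inverse (f x)) has_derivative
        (\<lambda>v. - (inverse (f x) * frechet_derivative f (at x) v * inverse (f x)))) (at x)" if "x \<in> S" for x
      using Deriv.has_derivative_inverse[of f x "frechet_derivative f (at x)" UNIV]
        C_on_has_derivative[OF Suc.prems that] assms(3)[OF that] by simp
    have i: "C_on k S (\<lambda>x. inverse (f x))"
      using Suc.IH C_on_SucD[OF Suc.prems] by blast
    have f: "C_on k S (\<lambda>x. frechet_derivative f (at x) v)" for v
      using Suc.prems by auto
    show "C_on k S (\<lambda>x. - (inverse (f x) * frechet_derivative f (at x) v * inverse (f x)))" for v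
      by (intro C_on_bounded_linear_compose[OF bounded_linear_minus[OF bounded_linear_ident]]
          C_on_bilinear[OF bounded_bilinear_mult] i f \<open>open S\<close>)
  qed
qed

section \<open>Closure properties of smoothness of all orders\<close>

lemma smooth_onD: "smooth_on S f \<Longrightarrow> C_on k S f"
  by (simp add: smooth_on_def)

lemma smooth_on_subset: "smooth_on S f \<Longrightarrow> T \<subseteq> S \<Longrightarrow> smooth_on T f"
  by (auto simp: smooth_on_def intro: C_on_subset)

lemma smooth_on_imp_continuous_on: "smooth_on S f \<Longrightarrow> continuous_on S f"
  using C_on_imp_continuous_on smooth_onD by blast

lemma smooth_on_cong:
  "open S \<Longrightarrow> (\<And>x. x \<in> S \<Longrightarrow> f x = g x) \<Longrightarrow> smooth_on S f \<longleftrightarrow> smooth_on S g"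
  using C_on_cong[of S f g] by (auto simp: smooth_on_def)

lemma smooth_on_has_derivative:
  "smooth_on S f \<Longrightarrow> x \<in> S \<Longrightarrow> (f has_derivative frechet_derivative f (at x)) (at x)"
  using C_on_has_derivative smooth_onD by blast

lemma smooth_on_frechet_derivative:
  "smooth_on S f \<Longrightarrow> smooth_on S (\<lambda>x. frechet_derivative f (at x) v)"
  unfolding smooth_on_def by (metis C_on.simps(2))

lemma smooth_on_Union:
  "(\<And>T. T \<in> \<T> \<Longrightarrow> open T) \<Longrightarrow> (\<And>T. T \<in> \<T> \<Longrightarrow> smooth_on T f) \<Longrightarrow> smooth_on (\<Union>\<T>) f"
  by (auto simp: smooth_on_def intro: C_on_Union)

lemma smooth_on_locally:
  assumes "\<And>x. x \<in> S \<Longrightarrow> \<exists>T. open T \<and> x \<in> T \<and> smooth_on T f"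
  shows "smooth_on S f"
proof -
  have "smooth_on (\<Union>{T. open T \<and> smooth_on T f}) f"
    by (rule smooth_on_Union) auto
  then show ?thesis
    by (rule smooth_on_subset) (use assms in auto)
qed

lemma smooth_on_const: "open S \<Longrightarrow> smooth_on S (\<lambda>x. c)"
  by (auto simp: smooth_on_def C_on_const)

lemma smooth_on_bounded_linear_compose:
  "bounded_linear L \<Longrightarrow> open S \<Longrightarrow> smooth_on S f \<Longrightarrow> smooth_on S (\<lambda>x. L (f x))"
  by (auto simp: smooth_on_def intro: C_on_bounded_linear_compose)

lemma C_on_id: "open S \<Longrightarrow> C_on k S (\<lambda>x. x)"
  by (cases k) (auto intro!: C_on_SucI C_on_const)

lemma smooth_on_id: "open S \<Longrightarrow> smooth_on S (\<lambda>x. x)"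
  by (auto simp: smooth_on_def C_on_id)

lemma smooth_on_bilinear:
  "bounded_bilinear B \<Longrightarrow> open S \<Longrightarrow> smooth_on S f \<Longrightarrow> smooth_on S g \<Longrightarrow> smooth_on S (\<lambda>x. B (f x) (g x))"
  by (auto simp: smooth_on_def intro: C_on_bilinear)

lemma smooth_on_add:
  "open S \<Longrightarrow> smooth_on S f \<Longrightarrow> smooth_on S g \<Longrightarrow> smooth_on S (\<lambda>x. f x + g x)"
  by (auto simp: smooth_on_def intro: C_on_add)

lemma smooth_on_minus: "open S \<Longrightarrow> smooth_on S f \<Longrightarrow> smooth_on S (\<lambda>x. - f x)"
  by (rule smooth_on_bounded_linear_compose[OF bounded_linear_minus[OF bounded_linear_ident]])

lemma smooth_on_diff:
  "open S \<Longrightarrow> smooth_on S f \<Longrightarrow> smooth_on S g \<Longrightarrow> smooth_on S (\<lambda>x. f x - g x)"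
  using smooth_on_add[of S f "\<lambda>x. - g x"] smooth_on_minus[of S g] by simp

lemma smooth_on_scaleR:
  "open S \<Longrightarrow> smooth_on S f \<Longrightarrow> smooth_on S g \<Longrightarrow> smooth_on S (\<lambda>x. f x *\<^sub>R g x)"
  by (rule smooth_on_bilinear[OF bounded_bilinear_scaleR])

lemma smooth_on_mult:
  fixes f g :: "'a::euclidean_space \<Rightarrow> real"
  shows "open S \<Longrightarrow> smooth_on S f \<Longrightarrow> smooth_on S g \<Longrightarrow> smooth_on S (\<lambda>x. f x * g x)"
  by (rule smooth_on_bilinear[OF bounded_bilinear_mult])

lemma smooth_on_inverse:
  fixes f :: "'a::euclidean_space \<Rightarrow> real"
  shows "open S \<Longrightarrow> smooth_on S f \<Longrightarrow> (\<And>x. x \<in> S \<Longrightarrow> f x \<noteq> 0) \<Longrightarrow> smooth_on S (\<lambda>x. inverse (f x))"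
  by (auto simp: smooth_on_def intro: C_on_inverse)

lemma smooth_on_divide:
  fixes f :: "'a::euclidean_space \<Rightarrow> real"
  assumes "open S" "smooth_on S f" "smooth_on S g" "\<And>x. x \<in> S \<Longrightarrow> g x \<noteq> 0"
  shows "smooth_on S (\<lambda>x. f x / g x)"
  unfolding divide_inverse using assms by (intro smooth_on_mult smooth_on_inverse)

lemma smooth_on_sum:
  "open S \<Longrightarrow> finite I \<Longrightarrow> (\<And>i. i \<in> I \<Longrightarrow> smooth_on S (f i)) \<Longrightarrow> smooth_on S (\<lambda>x. \<Sum>i\<in>I. f i x)"
  by (auto simp: smooth_on_def intro: C_on_sum)

lemma smooth_on_compose:
  fixes f :: "'a::euclidean_space \<Rightarrow> 'b::euclidean_space"
  shows "open S \<Longrightarrow> smooth_on S f \<Longrightarrow> smooth_on T g \<Longrightarrow> f ` S \<subseteq> T \<Longrightarrow> smooth_on S (\<lambda>x. g (f x))"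
  by (auto simp: smooth_on_def intro: C_on_compose)

lemma bounded_linear_axis: "bounded_linear (axis i :: 'a::real_normed_vector \<Rightarrow> 'a^'n)"
proof
  show "\<exists>K. \<forall>x :: 'a. norm (axis i x :: 'a^'n) \<le> norm x * K"
  proof (intro exI allI)
    fix x :: 'a
    have "norm (axis i x :: 'a^'n) \<le> (\<Sum>j\<in>UNIV. norm ((axis i x :: 'a^'n) $ j))"
      unfolding norm_vec_def by (rule L2_set_le_sum) simp
    also have "\<dots> = norm x * 1"
      by (simp add: axis_def if_distrib cong: if_cong)
    finally show "norm (axis i x :: 'a^'n) \<le> norm x * 1" .
  qed
qed (simp_all add: axis_def vec_eq_iff)

lemma C_on_vec_iff:
  fixes f :: "'a::euclidean_space \<Rightarrow> 'b::real_normed_vector^'n"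
  assumes "open S"
  shows "C_on k S f \<longleftrightarrow> (\<forall>i. C_on k S (\<lambda>x. f x $ i))"
proof
  show "C_on k S f \<Longrightarrow> \<forall>i. C_on k S (\<lambda>x. f x $ i)"
    using assms by (auto intro: C_on_bounded_linear_compose[OF bounded_linear_vec_nth])
  assume "\<forall>i. C_on k S (\<lambda>x. f x $ i)"
  then have "C_on k S (\<lambda>x. \<Sum>i\<in>UNIV. axis i (f x $ i) :: 'b^'n)"
    using assms by (intro C_on_sum C_on_bounded_linear_compose[OF bounded_linear_axis]) auto
  moreover have "(\<Sum>i\<in>UNIV. axis i (f x $ i) :: 'b^'n) = f x" for x
    by (simp add: vec_eq_iff axis_def)
  ultimately show "C_on k S f" by simp
qed

lemma smooth_on_vec_iff:
  fixes f :: "'a::euclidean_space \<Rightarrow> 'b::real_normed_vector^'n"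
  shows "open S \<Longrightarrow> smooth_on S f \<longleftrightarrow> (\<forall>i. smooth_on S (\<lambda>x. f x $ i))"
  by (auto simp: smooth_on_def C_on_vec_iff)

lemma smooth_on_nth:
  fixes f :: "'a::euclidean_space \<Rightarrow> 'b::real_normed_vector^'n"
  shows "open S \<Longrightarrow> smooth_on S f \<Longrightarrow> smooth_on S (\<lambda>x. f x $ i)"
  by (simp add: smooth_on_vec_iff)

lemmas smooth_intros = smooth_on_const smooth_on_id smooth_on_add smooth_on_diff smooth_on_minus
  smooth_on_mult smooth_on_scaleR smooth_on_sum smooth_on_nth

subsection \<open>Second derivatives and Hadamard's lemma\<close>

lemma has_vector_derivative_along_line:
  assumes "(f has_derivative f') (at (p + s *\<^sub>R u))"
  shows "((\<lambda>s. f (p + s *\<^sub>R u)) has_vector_derivative f' u) (at s)"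
proof -
  have "((\<lambda>s. p + s *\<^sub>R u) has_derivative (\<lambda>h. h *\<^sub>R u)) (at s)"
    by (auto intro!: derivative_eq_intros)
  from has_derivative_compose[OF this assms]
  have "((\<lambda>s. f (p + s *\<^sub>R u)) has_derivative (\<lambda>h. f' (h *\<^sub>R u))) (at s)" .
  then show ?thesis
    by (simp add: has_vector_derivative_def linear_scale[OF has_derivative_linear[OF assms]])
qed

lemma has_real_derivative_along_line:
  fixes f :: "'a::real_normed_vector \<Rightarrow> real"
  assumes "(f has_derivative f') (at (p + s *\<^sub>R u))"
  shows "((\<lambda>s. f (p + s *\<^sub>R u)) has_real_derivative f' u) (at s)"
  using has_vector_derivative_along_line[OF assms]
  by (simp add: has_real_derivative_iff_has_vector_derivative)

text \<open>The mean value theorem is applied twice: in direction \<open>u\<close> to the increment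
  of \<open>f\<close> along \<open>h v\<close>, then in direction \<open>v\<close> to the derivative
  of \<open>f\<close> along \<open>u\<close>. The left-hand side is symmetric in \<open>u\<close>
  and \<open>v\<close>, which is what the symmetry of second derivatives rests on.\<close>

lemma second_difference_mean_value:
  fixes f :: "'a::euclidean_space \<Rightarrow> real"
  assumes C2: "C_on 2 S f" and h: "h > 0"
    and S: "\<And>s t. s \<in> {0..h} \<Longrightarrow> t \<in> {0..h} \<Longrightarrow> x + s *\<^sub>R u + t *\<^sub>R v \<in> S"
  shows "\<exists>s\<in>{0..h}. \<exists>t\<in>{0..h}.
    f (x + h *\<^sub>R u + h *\<^sub>R v) - f (x + h *\<^sub>R u) - f (x + h *\<^sub>R v) + f x
      = h * h * frechet_derivative (\<lambda>y. frechet_derivative f (at y) u) (at (x + s *\<^sub>R u + t *\<^sub>R v)) v"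
proof -
  have C1: "C_on (Suc 0) S (\<lambda>y. frechet_derivative f (at y) u)" and "C_on (Suc 1) S f"
    using C2 by (auto simp: numeral_2_eq_2)
  then have d: "(f has_derivative frechet_derivative f (at y)) (at y)" if "y \<in> S" for y
    using C_on_has_derivative that by blast
  have "\<exists>s>0. s < h \<and>
      (\<lambda>s. f ((x + h *\<^sub>R v) + s *\<^sub>R u) - f (x + s *\<^sub>R u)) h - (\<lambda>s. f ((x + h *\<^sub>R v) + s *\<^sub>R u) - f (x + s *\<^sub>R u)) 0
      = (h - 0) * (frechet_derivative f (at ((x + h *\<^sub>R v) + s *\<^sub>R u)) u - frechet_derivative f (at (x + s *\<^sub>R u)) u)"
  proof (rule MVT2[OF h])
    fix s assume s: "0 \<le> s" "s \<le> h"
    have "(x + h *\<^sub>R v) + s *\<^sub>R u \<in> S" "x + s *\<^sub>R u \<in> S"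
      using S[of s h] S[of s 0] s h by (auto simp: ac_simps)
    then show "((\<lambda>s. f ((x + h *\<^sub>R v) + s *\<^sub>R u) - f (x + s *\<^sub>R u)) has_real_derivative
        (frechet_derivative f (at ((x + h *\<^sub>R v) + s *\<^sub>R u)) u - frechet_derivative f (at (x + s *\<^sub>R u)) u)) (at s)"
      by (intro DERIV_diff has_real_derivative_along_line d)
  qed
  then obtain s where s: "0 < s" "s < h" and eq1:
    "f (x + h *\<^sub>R u + h *\<^sub>R v) - f (x + h *\<^sub>R u) - f (x + h *\<^sub>R v) + f x
      = h * (frechet_derivative f (at ((x + s *\<^sub>R u) + h *\<^sub>R v)) u - frechet_derivative f (at (x + s *\<^sub>R u)) u)"
    by (auto simp: ac_simps)
  have "\<exists>t>0. t < h \<and> (\<lambda>t. frechet_derivative f (at ((x + s *\<^sub>R u) + t *\<^sub>R v)) u) h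
       - (\<lambda>t. frechet_derivative f (at ((x + s *\<^sub>R u) + t *\<^sub>R v)) u) 0
      = (h - 0) * frechet_derivative (\<lambda>y. frechet_derivative f (at y) u) (at (x + s *\<^sub>R u + t *\<^sub>R v)) v"
  proof (rule MVT2[OF h])
    fix t assume t: "0 \<le> t" "t \<le> h"
    show "((\<lambda>t. frechet_derivative f (at ((x + s *\<^sub>R u) + t *\<^sub>R v)) u) has_real_derivative
      frechet_derivative (\<lambda>y. frechet_derivative f (at y) u) (at (x + s *\<^sub>R u + t *\<^sub>R v)) v) (at t)"
      using S[of s t] s t
      by (intro has_real_derivative_along_line[where f = "\<lambda>y. frechet_derivative f (at y) u"]
          C_on_has_derivative[OF C1]) auto
  qed
  then obtain t where "0 < t" "t < h" and
    "frechet_derivative f (at ((x + s *\<^sub>R u) + h *\<^sub>R v)) u - frechet_derivative f (at (x + s *\<^sub>R u)) u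
      = h * frechet_derivative (\<lambda>y. frechet_derivative f (at y) u) (at (x + s *\<^sub>R u + t *\<^sub>R v)) v"
    by auto
  then show ?thesis
    using eq1 s by (intro bexI[of _ s] bexI[of _ t]) auto
qed

text \<open>One and the same second difference equals \<open>h * h\<close> times either mixed
  derivative, each at some point of a small parallelogram at \<open>x\<close>. Continuity of both
  mixed derivatives carries the equality to \<open>x\<close> up to an arbitrary error.\<close>

lemma frechet_derivative_commute_real:
  fixes f :: "'a::euclidean_space \<Rightarrow> real"
  assumes "open S" "C_on 2 S f" "x \<in> S"
  shows "frechet_derivative (\<lambda>y. frechet_derivative f (at y) u) (at x) v
    = frechet_derivative (\<lambda>y. frechet_derivative f (at y) v) (at x) u"
proof -
  define D where "D u v y = frechet_derivative (\<lambda>y. frechet_derivative f (at y) u) (at y) v" for u v y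
  have cont: "continuous (at x) (D u v)" for u v
  proof -
    have "continuous_on S (D u v)"
      using assms(2) unfolding D_def[abs_def] by (simp add: numeral_2_eq_2)
    then show ?thesis
      using assms(1,3) by (simp add: continuous_on_eq_continuous_at)
  qed
  have "\<bar>D u v x - D v u x\<bar> \<le> e" if "e > 0" for e
  proof -
    obtain d1 where d1: "d1 > 0" "\<And>y. dist y x < d1 \<Longrightarrow> dist (D u v y) (D u v x) < e / 2"
      using cont[of u v] \<open>e > 0\<close> unfolding continuous_at by (metis half_gt_zero cont continuous_at_eps_delta)
    obtain d2 where d2: "d2 > 0" "\<And>y. dist y x < d2 \<Longrightarrow> dist (D v u y) (D v u x) < e / 2"
      using cont[of v u] \<open>e > 0\<close> unfolding continuous_at by (metis half_gt_zero cont continuous_at_eps_delta)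
    obtain d3 where d3: "d3 > 0" "ball x d3 \<subseteq> S"
      using assms open_contains_ball by blast
    define d where "d = Min {d1, d2, d3}"
    \<comment> \<open>With \<open>h = d / (2 * N)\<close> the whole parallelogram stays within
      \<open>d / 2\<close> of \<open>x\<close>; the summand 1 keeps \<open>N\<close> positive for
      \<open>u = v = 0\<close>.\<close>
    define N where "N = norm u + norm v + 1"
    have N: "N > 0" by (simp add: N_def add_nonneg_pos)
    define h where "h = d / (2 * N)"
    have pos: "d > 0" using d1 d2 d3 by (simp add: d_def)
    have h: "h > 0" using pos N by (simp add: h_def)
    have near: "dist (x + s *\<^sub>R u + t *\<^sub>R v) x < d" if "s \<in> {0..h}" "t \<in> {0..h}" for s t
    proof -
      have "dist (x + s *\<^sub>R u + t *\<^sub>R v) x \<le> norm (s *\<^sub>R u) + norm (t *\<^sub>R v)"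
        by (simp add: dist_norm add.assoc norm_triangle_ineq del: norm_scaleR)
      also have "\<dots> \<le> h * norm u + h * norm v"
        using that by (auto intro!: add_mono mult_right_mono)
      also have "\<dots> \<le> h * N"
        using h by (simp add: N_def algebra_simps)
      also have "\<dots> = d / 2"
        using N by (simp add: h_def)
      finally show ?thesis using pos by simp
    qed
    have inS: "x + s *\<^sub>R u + t *\<^sub>R v \<in> S" "x + s *\<^sub>R v + t *\<^sub>R u \<in> S" if "s \<in> {0..h}" "t \<in> {0..h}" for s t
      using near[of s t] near[of t s] that d3(2) by (auto simp: d_def dist_commute subset_iff ac_simps)
    let ?\<Delta> = "f (x + h *\<^sub>R u + h *\<^sub>R v) - f (x + h *\<^sub>R u) - f (x + h *\<^sub>R v) + f x"
    obtain s t where st: "s \<in> {0..h}" "t \<in> {0..h}" "?\<Delta> = h * h * D u v (x + s *\<^sub>R u + t *\<^sub>R v)"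
      using second_difference_mean_value[OF assms(2) h inS(1)] unfolding D_def by blast
    obtain s' t' where st': "s' \<in> {0..h}" "t' \<in> {0..h}" "?\<Delta> = h * h * D v u (x + s' *\<^sub>R v + t' *\<^sub>R u)"
      using second_difference_mean_value[OF assms(2) h inS(2)] unfolding D_def
      by (auto simp: ac_simps diff_diff_eq)
    have "D u v (x + s *\<^sub>R u + t *\<^sub>R v) = D v u (x + s' *\<^sub>R v + t' *\<^sub>R u)"
      using st(3) st'(3) h by simp
    moreover have "dist (D u v (x + s *\<^sub>R u + t *\<^sub>R v)) (D u v x) < e / 2"
      using near[OF st(1,2)] by (intro d1) (simp add: d_def)
    moreover have "dist (D v u (x + s' *\<^sub>R v + t' *\<^sub>R u)) (D v u x) < e / 2"
      using near[OF st'(2,1)] by (intro d2) (simp add: d_def ac_simps)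
    ultimately show ?thesis unfolding dist_real_def by linarith
  qed
  then have "\<bar>D u v x - D v u x\<bar> \<le> 0"
    by (rule field_le_epsilon) simp
  then show ?thesis by (simp add: D_def)
qed

lemma frechet_derivative_nth:
  fixes f :: "'a::euclidean_space \<Rightarrow> 'b::real_normed_vector^'n"
  assumes "f differentiable (at x)"
  shows "frechet_derivative f (at x) v $ i = frechet_derivative (\<lambda>y. f y $ i) (at x) v"
proof -
  have "((\<lambda>y. f y $ i) has_derivative (\<lambda>v. frechet_derivative f (at x) v $ i)) (at x)"
    by (rule bounded_linear.has_derivative[OF bounded_linear_vec_nth])
      (use assms frechet_derivative_works in blast)
  then show ?thesis
    by (metis frechet_derivative_at)
qed

lemma frechet_derivative_cong:
  assumes "open S" "x \<in> S" "\<And>y. y \<in> S \<Longrightarrow> f y = g y" "f differentiable (at x)"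
  shows "frechet_derivative f (at x) = frechet_derivative g (at x)"
proof -
  have "(f has_derivative frechet_derivative f (at x)) (at x)"
    using assms(4) frechet_derivative_works by blast
  then have "(g has_derivative frechet_derivative f (at x)) (at x)"
    by (rule has_derivative_transform_within_open[OF _ assms(1,2,3)])
  then show ?thesis by (rule frechet_derivative_at)
qed

lemma frechet_derivative_commute:
  fixes f :: "'a::euclidean_space \<Rightarrow> real^'n"
  assumes "open S" "smooth_on S f" "x \<in> S"
  shows "frechet_derivative (\<lambda>y. frechet_derivative f (at y) u) (at x) v
    = frechet_derivative (\<lambda>y. frechet_derivative f (at y) v) (at x) u"
proof -
  have "frechet_derivative (\<lambda>y. frechet_derivative f (at y) u) (at x) v $ i
    = frechet_derivative (\<lambda>y. frechet_derivative (\<lambda>y. f y $ i) (at y) u) (at x) v" for u v i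
  proof -
    have diff: "f differentiable (at y)" "(\<lambda>y. frechet_derivative f (at y) u) differentiable (at y)"
      "(\<lambda>y. frechet_derivative (\<lambda>y. f y $ i) (at y) u) differentiable (at y)" if "y \<in> S" for y
      using smooth_on_has_derivative[OF smooth_on_frechet_derivative[OF smooth_on_nth[OF assms(1,2)]] that]
        smooth_on_has_derivative[OF smooth_on_frechet_derivative[OF assms(2)] that]
        smooth_on_has_derivative[OF assms(2) that] by (auto simp: differentiable_def)
    have "frechet_derivative (\<lambda>y. frechet_derivative (\<lambda>y. f y $ i) (at y) u) (at x)
       = frechet_derivative (\<lambda>y. frechet_derivative f (at y) u $ i) (at x)"
      using diff assms by (intro frechet_derivative_cong) (auto simp: frechet_derivative_nth)
    then show ?thesis
      using frechet_derivative_nth[OF diff(2)[OF \<open>x \<in> S\<close>]] by simp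
  qed
  moreover have "C_on 2 S (\<lambda>y. f y $ i)" for i
    using smooth_on_nth[OF assms(1,2)] smooth_onD by blast
  ultimately show ?thesis
    using frechet_derivative_commute_real[OF assms(1) _ assms(3)] by (simp add: vec_eq_iff)
qed

text \<open>The weight \<open>t ^ m\<close> is there for the induction: differentiating under the
  integral sign produces a factor \<open>t\<close> by the chain rule, so an average of
  \<open>F\<close> with weight \<open>m\<close> becomes one of a derivative of \<open>F\<close> with
  weight \<open>Suc m\<close>.\<close>

lemma C_on_line_average:
  fixes F :: "'a::euclidean_space \<Rightarrow> real"
  assumes B: "open B" "convex B" "a \<in> B" and "C_on k B F"
  shows "C_on k B (\<lambda>x. integral (cbox 0 1) (\<lambda>t. t ^ m * F (a + t *\<^sub>R (x - a))))"
  using assms(4)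
proof (induction k arbitrary: F m)
  have inB: "a + t *\<^sub>R (x - a) \<in> B" if "x \<in> B" "t \<in> cbox 0 1" for x t
    using convexD_alt[OF B(2,3) that(1), of t] that(2) by (simp add: algebra_simps)
  have cont: "continuous_on (B \<times> cbox 0 1) (\<lambda>z. G (a + snd z *\<^sub>R (fst z - a)))"
    if "continuous_on B G" for G :: "'a \<Rightarrow> 'c::real_normed_vector"
    by (rule continuous_on_compose2[OF that]) (auto intro!: continuous_intros inB)
  have cont1: "continuous_on (cbox 0 1) (\<lambda>t. G (a + t *\<^sub>R (x - a)))"
    if "continuous_on B G" "x \<in> B" for x and G :: "'a \<Rightarrow> 'c::real_normed_vector"
    by (rule continuous_on_compose2[OF that(1)]) (use that in \<open>auto intro!: continuous_intros inB\<close>)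
  {
    case 0
    then have "continuous_on (B \<times> cbox 0 1) (\<lambda>(x, t). t ^ m * F (a + t *\<^sub>R (x - a)))"
      using cont[of F] by (auto simp: split_beta intro!: continuous_intros)
    then show ?case
      unfolding C_on.simps by (rule integral_continuous_on_param)
  next
    case (Suc k)
    \<comment> \<open>The Leibniz rule for integrals takes the derivative as a bounded linear map
      that depends continuously on the point; continuity in each fixed direction suffices for this
      in finite dimension.\<close>
    define L where "L y = Blinfun (frechet_derivative F (at y))" for y
    have L: "blinfun_apply (L y) = frechet_derivative F (at y)" if "y \<in> B" for y
      unfolding L_def using C_on_has_derivative[OF Suc.prems that]
      by (intro bounded_linear_Blinfun_apply has_derivative_bounded_linear)
    have "continuous_on B (\<lambda>y. L y v)" for v
    proof -
      have "continuous_on B (\<lambda>y. frechet_derivative F (at y) v)"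
        using Suc.prems by (intro C_on_imp_continuous_on[of k]) simp
      then show ?thesis by (simp add: L cong: continuous_on_cong)
    qed
    then have contL: "continuous_on B L"
      by (rule continuous_on_blinfun_componentwise)
    have contF: "continuous_on B F"
      using Suc.prems C_on_imp_continuous_on by blast
    have deriv: "((\<lambda>x. integral (cbox 0 1) (\<lambda>t. t ^ m * F (a + t *\<^sub>R (x - a)))) has_derivative
       integral (cbox 0 1) (\<lambda>t. t ^ (Suc m) *\<^sub>R L (a + t *\<^sub>R (x - a)))) (at x within B)" if "x \<in> B" for x
    proof (rule leibniz_rule[where fx = "\<lambda>x t. t ^ (Suc m) *\<^sub>R L (a + t *\<^sub>R (x - a))", OF _ _ _ that B(2)])
      fix y and t :: real assume yt: "y \<in> B" "t \<in> cbox 0 1"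
      note F = C_on_has_derivative[OF Suc.prems inB[OF yt]]
      have "((\<lambda>x. a + t *\<^sub>R (x - a)) has_derivative (\<lambda>v. t *\<^sub>R v)) (at y)"
        by (auto intro!: derivative_eq_intros)
      from has_derivative_compose[OF this F]
      have "((\<lambda>x. t ^ m * F (a + t *\<^sub>R (x - a))) has_derivative
          (\<lambda>v. t ^ m * frechet_derivative F (at (a + t *\<^sub>R (y - a))) (t *\<^sub>R v))) (at y)"
        by (rule has_derivative_mult_right)
      moreover have "t ^ m * frechet_derivative F (at (a + t *\<^sub>R (y - a))) (t *\<^sub>R v)
          = blinfun_apply (t ^ (Suc m) *\<^sub>R L (a + t *\<^sub>R (y - a))) v" for v
        unfolding blinfun.scaleR_left L[OF inB[OF yt]] linear_scale[OF has_derivative_linear[OF F]]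
        by simp
      ultimately show "((\<lambda>x. t ^ m * F (a + t *\<^sub>R (x - a))) has_derivative
          blinfun_apply (t ^ (Suc m) *\<^sub>R L (a + t *\<^sub>R (y - a)))) (at y within B)"
        by (auto intro: has_derivative_at_withinI)
    next
      fix y assume "y \<in> B"
      then show "(\<lambda>t. t ^ m * F (a + t *\<^sub>R (y - a))) integrable_on cbox 0 1"
        by (intro integrable_continuous continuous_intros cont1 contF)
    next
      show "continuous_on (B \<times> cbox 0 1) (\<lambda>(x, t). t ^ (Suc m) *\<^sub>R L (a + t *\<^sub>R (x - a)))"
        unfolding split_beta by (intro continuous_intros cont contL)
    qed
    have "((\<lambda>x. integral (cbox 0 1) (\<lambda>t. t ^ m * F (a + t *\<^sub>R (x - a)))) has_derivative
       integral (cbox 0 1) (\<lambda>t. t ^ (Suc m) *\<^sub>R L (a + t *\<^sub>R (x - a)))) (at x)" if "x \<in> B" for x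
      using deriv[OF that] by (simp only: at_within_open[OF that B(1)])
    then show ?case
    proof (rule C_on_SucI[OF B(1)])
      fix v
      have eq: "blinfun_apply (integral (cbox 0 1) (\<lambda>t. t ^ (Suc m) *\<^sub>R L (a + t *\<^sub>R (x - a)))) v
          = integral (cbox 0 1) (\<lambda>t. t ^ (Suc m) * frechet_derivative F (at (a + t *\<^sub>R (x - a))) v)"
        if "x \<in> B" for x
      proof -
        have "blinfun_apply (integral (cbox 0 1) (\<lambda>t. t ^ (Suc m) *\<^sub>R L (a + t *\<^sub>R (x - a)))) v
          = integral (cbox 0 1) (\<lambda>t. blinfun_apply (t ^ (Suc m) *\<^sub>R L (a + t *\<^sub>R (x - a))) v)"
          by (intro blinfun_apply_integral integrable_continuous continuous_intros cont1 contL that)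
        also have "\<dots> = integral (cbox 0 1) (\<lambda>t. t ^ (Suc m) * frechet_derivative F (at (a + t *\<^sub>R (x - a))) v)"
          by (rule integral_cong) (simp add: blinfun.scaleR_left L inB[OF that])
        finally show ?thesis .
      qed
      have "C_on k B (\<lambda>x. integral (cbox 0 1)
          (\<lambda>t. t ^ (Suc m) * frechet_derivative F (at (a + t *\<^sub>R (x - a))) v))"
        using Suc.prems by (intro Suc.IH) auto
      then show "C_on k B (\<lambda>x. blinfun_apply (integral (cbox 0 1)
          (\<lambda>t. t ^ (Suc m) *\<^sub>R L (a + t *\<^sub>R (x - a)))) v)"
        by (subst C_on_cong[OF B(1) eq])
    qed
  }
qed

text \<open>The coefficient \<open>g i\<close> is the average of the i-th partial derivative over
  the segment from \<open>a\<close> to \<open>x\<close>; the formula is the fundamental theorem of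
  calculus along that segment.\<close>

lemma hadamard:
  fixes F :: "real^'n \<Rightarrow> real"
  assumes B: "open B" "convex B" "a \<in> B" and F: "smooth_on B F"
  obtains g where "\<And>i. smooth_on B (g i)"
    and "\<And>x. x \<in> B \<Longrightarrow> F x = F a + (\<Sum>i\<in>UNIV. (x $ i - a $ i) * g i x)"
    and "\<And>i. g i a = frechet_derivative F (at a) (axis i 1)"
proof
  \<comment> \<open>The trivial factor \<open>t ^ 0\<close> makes this the case \<open>m = 0\<close>
    of \<open>C_on_line_average\<close>.\<close>
  define g where "g i x = integral (cbox 0 1)
    (\<lambda>t. t ^ 0 * frechet_derivative F (at (a + t *\<^sub>R (x - a))) (axis i 1))" for i x
  show "smooth_on B (g i)" for i
    using C_on_line_average[OF B] smooth_onD[OF smooth_on_frechet_derivative[OF F]]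
    unfolding g_def smooth_on_def by blast
  show "g i a = frechet_derivative F (at a) (axis i 1)" for i
    by (simp add: g_def)
  fix x assume x: "x \<in> B"
  have inB: "a + t *\<^sub>R (x - a) \<in> B" if "t \<in> cbox 0 1" for t :: real
    using convexD_alt[OF B(2,3) x, of t] that by (simp add: algebra_simps)
  note dF = smooth_on_has_derivative[OF F inB]
  have "((\<lambda>t. frechet_derivative F (at (a + t *\<^sub>R (x - a))) (x - a)) has_integral
      F (a + 1 *\<^sub>R (x - a)) - F (a + 0 *\<^sub>R (x - a))) {0..1}"
  proof (rule fundamental_theorem_of_calculus)
    fix t :: real assume "t \<in> {0..1}"
    then have "t \<in> cbox 0 1" by simp
    from has_real_derivative_along_line[OF dF[OF this]]
    show "((\<lambda>t. F (a + t *\<^sub>R (x - a))) has_vector_derivative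
        frechet_derivative F (at (a + t *\<^sub>R (x - a))) (x - a)) (at t within {0..1})"
      unfolding has_real_derivative_iff_has_vector_derivative
      by (rule has_vector_derivative_at_within)
  qed simp
  then have "F x - F a = integral (cbox 0 1) (\<lambda>t. frechet_derivative F (at (a + t *\<^sub>R (x - a))) (x - a))"
    by (simp add: integral_unique)
  also have "\<dots> = integral (cbox 0 1) (\<lambda>t. \<Sum>i\<in>UNIV.
      (x $ i - a $ i) * (frechet_derivative F (at (a + t *\<^sub>R (x - a))) (axis i 1)))"
  proof (rule integral_cong)
    fix t :: real assume "t \<in> cbox 0 1"
    from has_derivative_linear[OF dF[OF this]] have lin: "linear (frechet_derivative F (at (a + t *\<^sub>R (x - a))))" .
    have "frechet_derivative F (at (a + t *\<^sub>R (x - a))) (\<Sum>i\<in>UNIV. ((x - a) $ i) *s axis i 1)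
       = (\<Sum>i\<in>UNIV. (x $ i - a $ i) * frechet_derivative F (at (a + t *\<^sub>R (x - a))) (axis i 1))"
      by (simp only: scalar_mult_eq_scaleR linear_sum[OF lin] linear_scale[OF lin]) simp
    then show "frechet_derivative F (at (a + t *\<^sub>R (x - a))) (x - a)
       = (\<Sum>i\<in>UNIV. (x $ i - a $ i) * frechet_derivative F (at (a + t *\<^sub>R (x - a))) (axis i 1))"
      by (simp only: basis_expansion)
  qed
  also have "\<dots> = (\<Sum>i\<in>UNIV. (x $ i - a $ i) * g i x)"
  proof -
    have "continuous_on (cbox 0 1) (\<lambda>t. frechet_derivative F (at (a + t *\<^sub>R (x - a))) (axis i 1))" for i
      by (rule continuous_on_compose2[OF smooth_on_imp_continuous_on[OF
              smooth_on_frechet_derivative[OF F, of "axis i 1"]]])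
        (auto intro!: continuous_intros inB)
    then show ?thesis
      by (subst integral_sum) (auto intro!: integrable_continuous_real continuous_intros simp: g_def)
  qed
  finally show "F x = F a + (\<Sum>i\<in>UNIV. (x $ i - a $ i) * g i x)" by simp
qed

section \<open>Differential equations\<close>

text \<open>The oriented integral of \<open>g\<close> from 0 to \<open>s\<close>, rescaled to the
  fixed interval [0,1]. No case distinction on the sign of \<open>s\<close> arises, and rules for
  integrals with a parameter apply even when the endpoint is the parameter.\<close>

definition integral_from_0 :: "(real \<Rightarrow> 'a::banach) \<Rightarrow> real \<Rightarrow> 'a" where
  "integral_from_0 g s = s *\<^sub>R integral (cbox 0 1) (\<lambda>t. g (t * s))"

lemma mult_cbox_01_bounds:
  fixes r s t :: real
  assumes "s \<in> {-r..r}" "t \<in> cbox 0 1"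
  shows "t * s \<in> {-r..r}"
proof -
  have "\<bar>t * s\<bar> \<le> 1 * \<bar>s\<bar>"
    using assms by (simp add: abs_mult mult_left_le_one_le)
  then show ?thesis using assms by auto
qed

lemma continuous_on_mult_01:
  assumes "continuous_on {-r..r} g" "s \<in> {-r..r}"
  shows "continuous_on (cbox 0 1) (\<lambda>t::real. g (t * s))"
  using mult_cbox_01_bounds[OF assms(2)]
  by (intro continuous_on_compose2[OF assms(1)] continuous_intros) auto

lemma integral_from_0_fundamental:
  fixes F :: "real \<Rightarrow> 'a::banach"
  assumes "\<And>t. t \<in> {-r..r} \<Longrightarrow> (F has_vector_derivative g t) (at t within {-r..r})"
    and s: "s \<in> {-r..r}"
  shows "integral_from_0 g s = F s - F 0"
proof (cases "s = 0")
  case False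
  have "((\<lambda>t. s *\<^sub>R g (t * s)) has_integral F (1 * s) - F (0 * s)) {0..1}"
  proof (rule fundamental_theorem_of_calculus)
    fix t :: real assume "t \<in> {0..1}"
    then have "t * s \<in> {-r..r}"
      using mult_cbox_01_bounds[OF s] by auto
    moreover have "(\<lambda>t. t * s) ` {0..1} \<subseteq> {-r..r}"
      using mult_cbox_01_bounds[OF s] by auto
    ultimately have "(F has_vector_derivative g (t * s)) (at (t * s) within (\<lambda>t. t * s) ` {0..1})"
      using assms(1) has_vector_derivative_within_subset by blast
    moreover have "((\<lambda>t. t * s) has_vector_derivative s) (at t within {0..1})"
      by (auto intro!: derivative_eq_intros simp: has_vector_derivative_def)
    ultimately show "((\<lambda>t. F (t * s)) has_vector_derivative s *\<^sub>R g (t * s)) (at t within {0..1})"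
      using vector_diff_chain_within[of "\<lambda>t. t * s" s t "{0..1}" F] by (simp add: o_def)
  qed simp
  then have "integral {0..1} (\<lambda>t. s *\<^sub>R g (t * s)) = F s - F 0"
    by (simp only: integral_unique mult_1 mult_zero_left)
  then show ?thesis by (simp add: integral_from_0_def)
qed (simp add: integral_from_0_def)

lemma integral_from_0_has_vector_derivative:
  fixes g :: "real \<Rightarrow> 'a::banach"
  assumes "continuous_on {-r..r} g" and s: "s \<in> {-r..r}"
  shows "(integral_from_0 g has_vector_derivative g s) (at s within {-r..r})"
proof -
  define F where "F s = integral {-r..s} g" for s
  have F: "(F has_vector_derivative g t) (at t within {-r..r})" if "t \<in> {-r..r}" for t
    unfolding F_def using assms(1) that by (rule integral_has_vector_derivative)
  have "((\<lambda>s. F s - F 0) has_vector_derivative g s - 0) (at s within {-r..r})"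
    by (intro has_vector_derivative_diff F s has_vector_derivative_const)
  then have D: "((\<lambda>s. F s - F 0) has_vector_derivative g s) (at s within {-r..r})" by simp
  have eq: "integral_from_0 g t = F t - F 0" if "t \<in> {-r..r}" for t
    using F that by (rule integral_from_0_fundamental)
  show ?thesis
    by (rule has_vector_derivative_transform[OF s eq D])
qed

lemma norm_integral_from_0_le:
  fixes g :: "real \<Rightarrow> 'a::banach"
  assumes "continuous_on {-r..r} g" "s \<in> {-r..r}" "\<And>t. t \<in> {-r..r} \<Longrightarrow> norm (g t) \<le> K"
  shows "norm (integral_from_0 g s) \<le> \<bar>s\<bar> * K"
proof -
  have "norm (integral {0..1} (\<lambda>t. g (t * s))) \<le> K * (1 - 0)"
    using continuous_on_mult_01[OF assms(1,2)] mult_cbox_01_bounds[OF assms(2)] assms(3)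
    by (intro integral_bound) auto
  then show ?thesis
    by (simp add: integral_from_0_def mult_left_mono)
qed

lemma integral_from_0_diff:
  fixes g h :: "real \<Rightarrow> 'a::banach"
  assumes "continuous_on {-r..r} g" "continuous_on {-r..r} h" "s \<in> {-r..r}"
  shows "integral_from_0 g s - integral_from_0 h s = integral_from_0 (\<lambda>t. g t - h t) s"
  unfolding integral_from_0_def
  by (subst integral_diff)
    (use assms in \<open>auto intro!: integrable_continuous_real continuous_on_mult_01[unfolded cbox_interval]
      simp: scaleR_diff_right\<close>)

lemma integral_from_0_continuous_param:
  fixes g :: "'a::topological_space \<Rightarrow> real \<Rightarrow> 'b::banach"
  assumes "continuous_on (X \<times> cbox 0 1) (\<lambda>(z, t). g z (t * h z))" "continuous_on X h"
  shows "continuous_on X (\<lambda>z. integral_from_0 (g z) (h z))"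
  unfolding integral_from_0_def
  by (intro continuous_intros assms(2) integral_continuous_on_param assms(1))

text \<open>Banach's fixed point theorem in the complete space of bounded continuous functions,
  restated for operators on plain functions; the contraction factor is fixed to 1/2.\<close>

lemma contraction_fixed_point:
  fixes T :: "('a::metric_space \<Rightarrow> 'b::banach) \<Rightarrow> 'a \<Rightarrow> 'b"
  assumes maps: "\<And>u. continuous_on UNIV u \<Longrightarrow> bounded (range u) \<Longrightarrow>
      continuous_on UNIV (T u) \<and> bounded (range (T u))"
    and contr: "\<And>u v K. continuous_on UNIV u \<Longrightarrow> bounded (range u) \<Longrightarrow>
      continuous_on UNIV v \<Longrightarrow> bounded (range v) \<Longrightarrow> (\<And>x. dist (u x) (v x) \<le> K) \<Longrightarrow>
      (\<And>x. dist (T u x) (T v x) \<le> K / 2)"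
  shows "\<exists>u. continuous_on UNIV u \<and> T u = u"
proof -
  define \<Phi> where "\<Phi> u = Bcontfun (T (apply_bcontfun u))" for u :: "'a \<Rightarrow>\<^sub>C 'b"
  have \<Phi>: "apply_bcontfun (\<Phi> u) = T (apply_bcontfun u)" for u
    using maps[of "apply_bcontfun u"] by (simp add: \<Phi>_def Bcontfun_inverse bcontfun_def)
  have "dist (\<Phi> u) (\<Phi> v) \<le> 1 / 2 * dist u v" for u v
  proof (rule dist_bound)
    fix x
    have "dist (T (apply_bcontfun u) x) (T (apply_bcontfun v) x) \<le> dist u v / 2"
      by (rule contr) (auto intro: dist_bounded)
    then show "dist (apply_bcontfun (\<Phi> u) x) (apply_bcontfun (\<Phi> v) x) \<le> 1 / 2 * dist u v"
      by (simp add: \<Phi>)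
  qed
  then obtain u where "\<Phi> u = u"
    using banach_fix_type[of "1/2" \<Phi>] by auto
  then have "T (apply_bcontfun u) = apply_bcontfun u"
    using \<Phi> by metis
  then show ?thesis
    by (intro exI[of _ "apply_bcontfun u"]) simp
qed

text \<open>The retraction of the line onto [-r,r]. Clipped arguments let Picard operators act on
  functions on the whole line although the equation is considered only on an interval.\<close>

definition clip :: "real \<Rightarrow> real \<Rightarrow> real" where
  "clip r t = max (-r) (min r t)"

lemma clip_bounds: "r \<ge> 0 \<Longrightarrow> clip r t \<in> {-r..r}"
  by (auto simp: clip_def)

lemma clip_eq: "t \<in> {-r..r} \<Longrightarrow> clip r t = t"
  by (auto simp: clip_def)

lemma continuous_on_clip [continuous_intros]:
  "continuous_on S f \<Longrightarrow> continuous_on S (\<lambda>x. clip r (f x))"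
  by (auto simp: clip_def intro!: continuous_intros)

text \<open>Compactness bounds the derivative in each basis direction, hence its operator norm, and
  the mean value inequality applies because the ball is convex.\<close>

lemma C_1_lipschitz_on_cball:
  fixes F :: "'a::euclidean_space \<Rightarrow> 'b::real_normed_vector"
  assumes "cball a R \<subseteq> S" "C_on 1 S F"
  obtains L where "L \<ge> 0" "\<And>x y. x \<in> cball a R \<Longrightarrow> y \<in> cball a R \<Longrightarrow> norm (F x - F y) \<le> L * norm (x - y)"
proof -
  have der: "(F has_derivative frechet_derivative F (at x)) (at x within cball a R)" if "x \<in> cball a R" for x
    using C_on_has_derivative[of 0 S F x] assms(2) subsetD[OF assms(1) that]
    by (metis One_nat_def has_derivative_at_withinI)
  have "\<exists>K. \<forall>x\<in>cball a R. norm (frechet_derivative F (at x) b) \<le> K" for b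
  proof -
    have "continuous_on (cball a R) (\<lambda>x. frechet_derivative F (at x) b)"
      using assms by (auto intro: continuous_on_subset)
    from compact_imp_bounded[OF compact_continuous_image[OF this compact_cball]]
    show ?thesis by (auto simp: bounded_iff)
  qed
  then obtain K where K: "\<And>b x. x \<in> cball a R \<Longrightarrow> norm (frechet_derivative F (at x) b) \<le> K b"
    by metis
  define L where "L = (\<Sum>b\<in>Basis. \<bar>K b\<bar>)"
  have "onorm (frechet_derivative F (at x)) \<le> L" if x: "x \<in> cball a R" for x
  proof (rule onorm_le)
    fix v
    note lin = has_derivative_linear[OF der[OF x]]
    have "frechet_derivative F (at x) v = frechet_derivative F (at x) (\<Sum>b\<in>Basis. (v \<bullet> b) *\<^sub>R b)"
      by (simp add: euclidean_representation)
    also have "\<dots> = (\<Sum>b\<in>Basis. (v \<bullet> b) *\<^sub>R frechet_derivative F (at x) b)"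
      by (simp only: linear_sum[OF lin] linear_scale[OF lin])
    also have "norm \<dots> \<le> (\<Sum>b\<in>Basis. norm v * \<bar>K b\<bar>)"
    proof (rule sum_norm_le)
      fix b :: 'a assume "b \<in> Basis"
      then show "norm ((v \<bullet> b) *\<^sub>R frechet_derivative F (at x) b) \<le> norm v * \<bar>K b\<bar>"
        using K[OF x, of b] Basis_le_norm[of b v] by (auto intro!: mult_mono)
    qed
    also have "\<dots> = L * norm v"
      by (simp add: L_def sum_distrib_left mult.commute)
    finally show "norm (frechet_derivative F (at x) v) \<le> L * norm v" .
  qed
  then have "norm (F x - F y) \<le> L * norm (x - y)" if "x \<in> cball a R" "y \<in> cball a R" for x y
    using differentiable_bound[OF convex_cball der _ that] by blast
  moreover have "L \<ge> 0" by (simp add: L_def sum_nonneg)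
  ultimately show ?thesis using that by blast
qed

text \<open>Composing the field with the nearest-point projection onto a closed ball
  makes it globally bounded and Lipschitz, so that the Picard operator is a
  contraction of the space of all bounded continuous functions.\<close>

theorem ode_local_existence:
  fixes F :: "'a::euclidean_space \<Rightarrow> 'a"
  assumes "open S" "C_on 1 S F" "a \<in> S"
  obtains r u where "r > 0" "u 0 = a" "\<And>t. t \<in> {-r<..<r} \<Longrightarrow> u t \<in> S"
    "\<And>t. t \<in> {-r<..<r} \<Longrightarrow> (u has_vector_derivative F (u t)) (at t)"
proof -
  obtain R where R: "R > 0" "cball a R \<subseteq> S"
    using assms open_contains_cball by blast
  obtain L where L: "L \<ge> 0" "\<And>x y. x \<in> cball a R \<Longrightarrow> y \<in> cball a R \<Longrightarrow> norm (F x - F y) \<le> L * norm (x - y)"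
    using C_1_lipschitz_on_cball[OF R(2) assms(2)] by blast
  have contF: "continuous_on (cball a R) F"
    using C_on_imp_continuous_on[OF assms(2)] R(2) continuous_on_subset by blast
  obtain M where M: "\<And>x. x \<in> cball a R \<Longrightarrow> norm (F x) \<le> M"
    using compact_imp_bounded[OF compact_continuous_image[OF contF compact_cball]]
    unfolding bounded_iff by blast
  have "M \<ge> 0" using M[of a] R norm_ge_zero[of "F a"] by (smt (verit) centre_in_cball)
  define G where "G x = F (closest_point (cball a R) x)" for x
  have proj: "closest_point (cball a R) x \<in> cball a R" for x
    using R by (intro closest_point_in_set) auto
  have GM: "norm (G x) \<le> M" for x
    using M proj by (simp add: G_def)
  have GL: "norm (G x - G y) \<le> L * norm (x - y)" for x y
  proof -
    have "norm (G x - G y) \<le> L * dist (closest_point (cball a R) x) (closest_point (cball a R) y)"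
      unfolding G_def dist_norm by (rule L(2)[OF proj proj])
    also have "\<dots> \<le> L * dist x y"
      using R L(1) by (intro mult_left_mono closest_point_lipschitz) auto
    finally show ?thesis by (simp add: dist_norm)
  qed
  have contG: "continuous_on UNIV G"
    unfolding G_def using proj R(1)
    by (intro continuous_on_compose2[OF contF] continuous_on_closest_point) auto
  \<comment> \<open>The first bound makes the Picard operator contract by 1/2, the second keeps its
    values within \<open>R\<close> of \<open>a\<close>. Adding 1 avoids division by zero when
    \<open>L\<close> or \<open>M\<close> vanishes.\<close>
  define r where "r = min (1 / (2 * (L + 1))) (R / (M + 1))"
  have r: "r > 0" "r * L \<le> 1 / 2" "r * M \<le> R"
  proof -
    show "r > 0" using L(1) \<open>M \<ge> 0\<close> R(1) by (simp add: r_def)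
    have "r * L \<le> (1 / (2 * (L + 1))) * L" using L(1) by (intro mult_right_mono) (auto simp: r_def)
    also have "\<dots> \<le> 1 / 2" using L(1) by (simp add: field_simps)
    finally show "r * L \<le> 1 / 2" .
    have "r * M \<le> (R / (M + 1)) * M" using \<open>M \<ge> 0\<close> by (intro mult_right_mono) (auto simp: r_def)
    also have "\<dots> \<le> R" using \<open>M \<ge> 0\<close> R(1) by (simp add: field_simps)
    finally show "r * M \<le> R" .
  qed
  define T where "T u t = a + integral_from_0 (\<lambda>\<tau>. G (u \<tau>)) (clip r t)" for u :: "real \<Rightarrow> 'a" and t
  have contGu: "continuous_on X (\<lambda>\<tau>. G (u \<tau>))" if "continuous_on UNIV u" for u :: "real \<Rightarrow> 'a" and X
    using that continuous_on_compose2[OF contG that] continuous_on_subset by blast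
  have clip: "clip r t \<in> {-r..r}" for t
    using r(1) by (intro clip_bounds) simp
  have T_near: "dist (T u t) a \<le> R" if "continuous_on UNIV u" for u t
  proof -
    have "norm (integral_from_0 (\<lambda>\<tau>. G (u \<tau>)) (clip r t)) \<le> \<bar>clip r t\<bar> * M"
      using GM contGu[OF that] clip by (intro norm_integral_from_0_le[where r = r]) auto
    also have "\<dots> \<le> r * M"
      using clip[of t] \<open>M \<ge> 0\<close> by (intro mult_right_mono) auto
    finally show ?thesis using r by (simp add: T_def dist_norm)
  qed
  have T_cont: "continuous_on UNIV (T u)" if "continuous_on UNIV u" for u
    unfolding T_def
  proof (intro continuous_on_add continuous_on_const integral_from_0_continuous_param)
    show "continuous_on (UNIV \<times> cbox 0 1) (\<lambda>(z, t). G (u (t * clip r z)))"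
      unfolding split_beta
      by (intro continuous_on_compose2[OF contGu[OF that, of UNIV]]) (auto intro!: continuous_intros)
  qed (auto intro!: continuous_intros)
  have "\<exists>u. continuous_on UNIV u \<and> T u = u"
  proof (rule contraction_fixed_point)
    fix u :: "real \<Rightarrow> 'a" assume u: "continuous_on UNIV u"
    show "continuous_on UNIV (T u) \<and> bounded (range (T u))"
      using T_near[OF u] T_cont[OF u] by (auto simp: bounded_def dist_commute)
  next
    fix u v :: "real \<Rightarrow> 'a" and K t
    assume uv: "continuous_on UNIV u" "continuous_on UNIV v" and K: "\<And>x. dist (u x) (v x) \<le> K"
    have "K \<ge> 0" using K[of 0] by (meson dist_not_less_zero less_le_trans not_le)
    have "dist (T u t) (T v t) = norm (integral_from_0 (\<lambda>\<tau>. G (u \<tau>) - G (v \<tau>)) (clip r t))"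
      by (subst integral_from_0_diff[symmetric, OF contGu[OF uv(1)] contGu[OF uv(2)] clip])
        (simp add: T_def dist_norm)
    also have "\<dots> \<le> \<bar>clip r t\<bar> * (L * K)"
    proof (rule norm_integral_from_0_le[where r = r])
      show "norm (G (u \<tau>) - G (v \<tau>)) \<le> L * K" for \<tau>
        using GL[of "u \<tau>" "v \<tau>"] mult_left_mono[OF K[of \<tau>, unfolded dist_norm] L(1)] by linarith
    qed (auto intro!: continuous_intros contGu uv clip[simplified])
    also have "\<dots> \<le> r * (L * K)"
      using clip[of t] \<open>K \<ge> 0\<close> L(1) by (intro mult_right_mono) auto
    also have "\<dots> \<le> (1 / 2) * K"
      using mult_right_mono[OF r(2) \<open>K \<ge> 0\<close>] by (simp add: mult.assoc)
    finally show "dist (T u t) (T v t) \<le> K / 2" by simp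
  qed
  then obtain u where u: "continuous_on UNIV u" "T u = u" by blast
  \<comment> \<open>The fixed point never leaves the ball on which \<open>G\<close> and
    \<open>F\<close> agree, so it solves the original equation.\<close>
  have near: "u t \<in> cball a R" for t
    using T_near[OF u(1), of t] u(2) by (simp add: dist_commute)
  have G: "G (u t) = F (u t)" for t
    using near by (simp add: G_def closest_point_self)
  have eq: "u t = a + integral_from_0 (\<lambda>\<tau>. F (u \<tau>)) t" if "t \<in> {-r..r}" for t
    using fun_cong[OF u(2), of t] by (simp add: T_def clip_eq[OF that] G)
  have "(u has_vector_derivative F (u t)) (at t)" if t: "t \<in> {-r<..<r}" for t
  proof -
    have "((\<lambda>t. a + integral_from_0 (\<lambda>\<tau>. F (u \<tau>)) t) has_vector_derivative 0 + F (u t)) (at t within {-r..r})"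
      using contGu[OF u(1)] t
      by (intro has_vector_derivative_add has_vector_derivative_const
          integral_from_0_has_vector_derivative) (auto simp: G)
    then have "((\<lambda>t. a + integral_from_0 (\<lambda>\<tau>. F (u \<tau>)) t) has_vector_derivative F (u t)) (at t)"
      using t by (simp add: at_within_Icc_at)
    then show ?thesis
      by (rule has_vector_derivative_transform_within_open[where S = "{-r<..<r}"]) (use t eq in auto)
  qed
  moreover have "u 0 = a"
    using eq[of 0] r(1) by (simp add: integral_from_0_def)
  ultimately show ?thesis
    using that[of r u] r(1) near R(2) by blast
qed

section \<open>Flat linear systems in two variables\<close>

lemma bounded_bilinear_matrix_vector_mult:
  "bounded_bilinear ((*v) :: real^'n^'m \<Rightarrow> real^'n \<Rightarrow> real^'m)"
  unfolding bilinear_conv_bounded_bilinear[symmetric] bilinear_def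
  by (auto intro!: linearI simp: matrix_vector_mult_add_rdistrib matrix_vector_right_distrib
      matrix_vector_mult_scaleR scaleR_matrix_vector_assoc)

lemmas continuous_on_matrix_vector_mult =
  bounded_bilinear.continuous_on[OF bounded_bilinear_matrix_vector_mult]

lemma has_vector_derivative_matrix_vector_mult:
  fixes M :: "real \<Rightarrow> real^'n^'m" and s :: "real \<Rightarrow> real^'n"
  assumes "(M has_vector_derivative M') (at t within T)" "(s has_vector_derivative s') (at t within T)"
  shows "((\<lambda>t. M t *v s t) has_vector_derivative M t *v s' + M' *v s t) (at t within T)"
  using bounded_bilinear.has_vector_derivative[OF bounded_bilinear_matrix_vector_mult assms] .

lemma matrix_family_bound:
  fixes M :: "real \<Rightarrow> real \<Rightarrow> real^'n^'m"
  assumes "continuous_on ({-R..R} \<times> {-R..R}) (\<lambda>(x, y). M x y)"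
  obtains C where "C \<ge> 0" "\<And>x y s. x \<in> {-R..R} \<Longrightarrow> y \<in> {-R..R} \<Longrightarrow> norm (M x y *v s) \<le> C * norm s"
proof -
  obtain K where K: "K > 0" "\<And>(M :: real^'n^'m) s. norm (M *v s) \<le> norm M * norm s * K"
    using bounded_bilinear.pos_bounded[OF bounded_bilinear_matrix_vector_mult] by blast
  have "compact ((\<lambda>(x, y). M x y) ` ({-R..R} \<times> {-R..R}))"
    by (intro compact_continuous_image assms compact_Times compact_Icc)
  then obtain B where B: "\<And>z. z \<in> {-R..R} \<times> {-R..R} \<Longrightarrow> norm ((\<lambda>(x, y). M x y) z) \<le> B"
    using compact_imp_bounded bounded_iff by (metis imageI)
  have "norm (M x y *v s) \<le> \<bar>B\<bar> * K * norm s" if "x \<in> {-R..R}" "y \<in> {-R..R}" for x y s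
  proof -
    have "norm (M x y *v s) \<le> norm (M x y) * norm s * K" by (rule K)
    also have "\<dots> \<le> \<bar>B\<bar> * norm s * K"
      using B[of "(x, y)"] that K(1) by (intro mult_right_mono) auto
    finally show ?thesis by (simp add: ac_simps)
  qed
  then show ?thesis using that[of "\<bar>B\<bar> * K"] K(1) by auto
qed

text \<open>Integrating first along the axis and then in the second variable gives \<open>s\<close>. The defect
  \<open>D x y = s x y - s 0 y - \<integral>\<^sub>0\<^sup>x M1 s\<close> of the first equation satisfies, by flatness and integration by parts,
  \<open>\<partial>\<^sub>y D = M2 D - \<integral>\<^sub>0\<^sup>x (\<partial>\<^sub>x M2) D\<close>. It vanishes on a small square, since this bounds its
  supremum by half of itself. No differentiability of \<open>s\<close> in the first variable is assumed.\<close>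

lemma flat_system_square:
  fixes M1 M2 M1y M2x :: "real \<Rightarrow> real \<Rightarrow> real^'n^'n"
  assumes R: "R > 0"
    and cont: "continuous_on ({-R..R} \<times> {-R..R}) (\<lambda>(x, y). M1 x y)"
      "continuous_on ({-R..R} \<times> {-R..R}) (\<lambda>(x, y). M2 x y)"
      "continuous_on ({-R..R} \<times> {-R..R}) (\<lambda>(x, y). M1y x y)"
      "continuous_on ({-R..R} \<times> {-R..R}) (\<lambda>(x, y). M2x x y)"
    and M1y: "\<And>x y. x \<in> {-R..R} \<Longrightarrow> y \<in> {-R..R} \<Longrightarrow>
      ((\<lambda>y. M1 x y) has_vector_derivative M1y x y) (at y within {-R..R})"
    and M2x: "\<And>x y. x \<in> {-R..R} \<Longrightarrow> y \<in> {-R..R} \<Longrightarrow>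
      ((\<lambda>x. M2 x y) has_vector_derivative M2x x y) (at x within {-R..R})"
    and flat: "\<And>x y. x \<in> {-R..R} \<Longrightarrow> y \<in> {-R..R} \<Longrightarrow>
      M1y x y + M1 x y ** M2 x y = M2x x y + M2 x y ** M1 x y"
  obtains r s where "0 < r" "s 0 0 = s0" "continuous_on UNIV (\<lambda>(x, y). s x y)"
    "\<And>x y. x \<in> {-r<..<r} \<Longrightarrow> y \<in> {-r<..<r} \<Longrightarrow> ((\<lambda>x. s x y) has_vector_derivative M1 x y *v s x y) (at x)"
    "\<And>x y. x \<in> {-r<..<r} \<Longrightarrow> y \<in> {-r<..<r} \<Longrightarrow> ((\<lambda>y. s x y) has_vector_derivative M2 x y *v s x y) (at y)"
proof -
  obtain C1 where C1: "C1 \<ge> 0" "\<And>x y s. x \<in> {-R..R} \<Longrightarrow> y \<in> {-R..R} \<Longrightarrow> norm (M1 x y *v s) \<le> C1 * norm s"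
    using matrix_family_bound[OF cont(1)] by blast
  obtain C2 where C2: "C2 \<ge> 0" "\<And>x y s. x \<in> {-R..R} \<Longrightarrow> y \<in> {-R..R} \<Longrightarrow> norm (M2 x y *v s) \<le> C2 * norm s"
    using matrix_family_bound[OF cont(2)] by blast
  obtain C3 where C3: "C3 \<ge> 0" "\<And>x y s. x \<in> {-R..R} \<Longrightarrow> y \<in> {-R..R} \<Longrightarrow> norm (M2x x y *v s) \<le> C3 * norm s"
    using matrix_family_bound[OF cont(4)] by blast
  \<comment> \<open>\<open>C1 + C2\<close> controls the contraction of the Picard operator,
    \<open>C2 + R * C3\<close> the growth of the defect \<open>D\<close> in \<open>y\<close>. One
    constant serves both, since \<open>r * C\<close> is at most 1/2.\<close>
  define C where "C = C1 + C2 + R * C3 + 1"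
  define r where "r = min R (1 / (2 * C))"
  have "C \<ge> 1" using C1 C2 C3 R by (simp add: C_def)
  then have r: "r > 0" "r \<le> R" "r * C \<le> 1 / 2"
  proof -
    show "r > 0" "r \<le> R" using R \<open>C \<ge> 1\<close> by (auto simp: r_def)
    have "r * C \<le> 1 / (2 * C) * C" using \<open>C \<ge> 1\<close> by (intro mult_right_mono) (auto simp: r_def)
    then show "r * C \<le> 1 / 2" using \<open>C \<ge> 1\<close> by simp
  qed
  have rI: "x \<in> {-R..R}" if "x \<in> {-r..r}" for x using that r by auto
  have cont': "continuous_on X (\<lambda>z. N (f z) (g z))"
    if "continuous_on ({-R..R} \<times> {-R..R}) (\<lambda>(x, y). N x y)" "continuous_on X f" "continuous_on X g"
      "\<And>z. z \<in> X \<Longrightarrow> f z \<in> {-r..r}" "\<And>z. z \<in> X \<Longrightarrow> g z \<in> {-r..r}"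
    for X :: "'x::topological_space set" and N :: "real \<Rightarrow> real \<Rightarrow> real^'n^'n" and f g
    using continuous_on_compose2[OF that(1) continuous_on_Pair[OF that(2,3)]] that(4,5) rI by fastforce
  have clip: "clip r t \<in> {-r..r}" for t
    using r(1) by (intro clip_bounds) simp
  have clip0: "clip r 0 = 0" using r by (simp add: clip_def)
  have contu: "continuous_on X (\<lambda>z. u (f z, g z))"
    if "continuous_on UNIV u" "continuous_on X f" "continuous_on X g"
    for X :: "'x::topological_space set" and u :: "real \<times> real \<Rightarrow> real^'n" and f g
    by (rule continuous_on_compose2[OF that(1)]) (auto intro!: continuous_intros that)
  define T where "T u z = s0 + integral_from_0 (\<lambda>\<xi>. M1 \<xi> 0 *v u (\<xi>, 0)) (clip r (fst z))
     + integral_from_0 (\<lambda>\<eta>. M2 (clip r (fst z)) \<eta> *v u (clip r (fst z), \<eta>)) (clip r (snd z))"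
    for u :: "real \<times> real \<Rightarrow> real^'n" and z
  have c1: "continuous_on {-r..r} (\<lambda>\<xi>. M1 \<xi> y *v u (\<xi>, y))"
    if "continuous_on UNIV u" "y \<in> {-r..r}" for u :: "real \<times> real \<Rightarrow> real^'n" and y
    using that r by (intro continuous_on_matrix_vector_mult cont'[OF cont(1)] contu) (auto intro!: continuous_intros)
  have c2: "continuous_on {-r..r} (\<lambda>\<eta>. M2 x \<eta> *v u (x, \<eta>))"
    if "continuous_on UNIV u" "x \<in> {-r..r}" for u :: "real \<times> real \<Rightarrow> real^'n" and x
    using that r by (intro continuous_on_matrix_vector_mult cont'[OF cont(2)] contu) (auto intro!: continuous_intros)
  have zero: "0 \<in> {-r..r}" using r by auto
  have T_cont: "continuous_on UNIV (T u)" if u: "continuous_on UNIV u" for u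
    unfolding T_def
  proof (intro continuous_on_add continuous_on_const integral_from_0_continuous_param)
    show "continuous_on (UNIV \<times> cbox 0 1) (\<lambda>(z, t). M1 (t * clip r (fst z)) 0 *v u (t * clip r (fst z), 0))"
      unfolding split_beta using mult_cbox_01_bounds[OF clip] zero
      by (intro continuous_on_matrix_vector_mult cont'[OF cont(1)] contu[OF u])
        (auto intro!: continuous_intros)
    show "continuous_on (UNIV \<times> cbox 0 1) (\<lambda>(z, t).
        M2 (clip r (fst z)) (t * clip r (snd z)) *v u (clip r (fst z), t * clip r (snd z)))"
      unfolding split_beta using mult_cbox_01_bounds[OF clip] clip
      by (intro continuous_on_matrix_vector_mult cont'[OF cont(2)] contu[OF u])
        (auto intro!: continuous_intros)
  qed (auto intro!: continuous_intros)
  have T_diff: "dist (T u z) (T v z) \<le> K / 2"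
    if u: "continuous_on UNIV u" and v: "continuous_on UNIV v" and K: "\<And>z. dist (u z) (v z) \<le> K" for u v K z
  proof -
    have "K \<ge> 0" using K[of 0] by (meson dist_not_less_zero less_le_trans not_le)
    define x where "x = clip r (fst z)"
    define y where "y = clip r (snd z)"
    have xy: "x \<in> {-r..r}" "y \<in> {-r..r}" using clip by (auto simp: x_def y_def)
    have "T u z - T v z = (integral_from_0 (\<lambda>\<xi>. M1 \<xi> 0 *v u (\<xi>, 0)) x - integral_from_0 (\<lambda>\<xi>. M1 \<xi> 0 *v v (\<xi>, 0)) x)
       + (integral_from_0 (\<lambda>\<eta>. M2 x \<eta> *v u (x, \<eta>)) y - integral_from_0 (\<lambda>\<eta>. M2 x \<eta> *v v (x, \<eta>)) y)"
      by (simp add: T_def x_def y_def)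
    also have "\<dots> = integral_from_0 (\<lambda>\<xi>. M1 \<xi> 0 *v u (\<xi>, 0) - M1 \<xi> 0 *v v (\<xi>, 0)) x
       + integral_from_0 (\<lambda>\<eta>. M2 x \<eta> *v u (x, \<eta>) - M2 x \<eta> *v v (x, \<eta>)) y"
      by (simp only: integral_from_0_diff[OF c1[OF u zero] c1[OF v zero] xy(1)]
          integral_from_0_diff[OF c2[OF u xy(1)] c2[OF v xy(1)] xy(2)])
    also have "norm \<dots> \<le> \<bar>x\<bar> * (C1 * K) + \<bar>y\<bar> * (C2 * K)"
    proof (intro order_trans[OF norm_triangle_ineq] add_mono norm_integral_from_0_le[where r = r] xy)
      show "norm (M1 \<xi> 0 *v u (\<xi>, 0) - M1 \<xi> 0 *v v (\<xi>, 0)) \<le> C1 * K" if "\<xi> \<in> {-r..r}" for \<xi>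
        using C1(2)[OF rI[OF that] rI[OF zero], of "u (\<xi>, 0) - v (\<xi>, 0)"]
          mult_left_mono[OF K[of "(\<xi>, 0)", unfolded dist_norm] C1(1)]
        by (simp add: matrix_vector_mult_diff_distrib)
      show "norm (M2 x \<eta> *v u (x, \<eta>) - M2 x \<eta> *v v (x, \<eta>)) \<le> C2 * K" if "\<eta> \<in> {-r..r}" for \<eta>
        using C2(2)[OF rI[OF xy(1)] rI[OF that], of "u (x, \<eta>) - v (x, \<eta>)"]
          mult_left_mono[OF K[of "(x, \<eta>)", unfolded dist_norm] C2(1)]
        by (simp add: matrix_vector_mult_diff_distrib)
    qed (intro continuous_on_diff c1 c2 u v xy zero)+
    also have "\<dots> \<le> r * (C1 * K) + r * (C2 * K)"
      using xy C1(1) C2(1) \<open>K \<ge> 0\<close> by (intro add_mono mult_right_mono) auto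
    also have "\<dots> = (r * (C1 + C2)) * K" by (simp add: algebra_simps)
    also have "\<dots> \<le> (r * C) * K"
      using r(1) \<open>K \<ge> 0\<close> R C3(1) by (intro mult_right_mono mult_left_mono) (auto simp: C_def)
    also have "\<dots> \<le> 1 / 2 * K"
      using \<open>K \<ge> 0\<close> r by (intro mult_right_mono) auto
    finally show ?thesis by (simp add: dist_norm)
  qed
  have T_bounded: "bounded (range (T u))" if u: "continuous_on UNIV u" for u
  proof -
    \<comment> \<open>\<open>T u\<close> sees its argument only through \<open>clip\<close>, so its
      range is the image of a compact square and bounded.\<close>
    have "T u z = T u (clip r (fst z), clip r (snd z))" for z
      by (simp add: T_def clip_eq[OF clip])
    then have "range (T u) \<subseteq> T u ` ({-r..r} \<times> {-r..r})"
      using clip by (metis (no_types, lifting) SigmaI image_subsetI rev_image_eqI)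
    moreover have "compact (T u ` ({-r..r} \<times> {-r..r}))"
      using T_cont[OF u] by (intro compact_continuous_image compact_Times compact_Icc)
        (auto intro: continuous_on_subset)
    ultimately show ?thesis
      using compact_imp_bounded bounded_subset by blast
  qed
  have "\<exists>u. continuous_on UNIV u \<and> T u = u"
    by (rule contraction_fixed_point) (use T_cont T_bounded T_diff in auto)
  then obtain u where u: "continuous_on UNIV u" "T u = u" by blast
  define s where "s x y = u (x, y)" for x y
  have s_y: "s x y = s x 0 + integral_from_0 (\<lambda>\<eta>. M2 x \<eta> *v s x \<eta>) y"
    and s_x0: "s x 0 = s0 + integral_from_0 (\<lambda>\<xi>. M1 \<xi> 0 *v s \<xi> 0) x"
    if "x \<in> {-r..r}" "y \<in> {-r..r}" for x y
    using fun_cong[OF u(2), of "(x, y)"] fun_cong[OF u(2), of "(x, 0)"] clip_eq that zero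
    by (auto simp: T_def s_def integral_from_0_def clip0)
  have dsy: "((\<lambda>y. s x y) has_vector_derivative M2 x y *v s x y) (at y within {-r..r})"
    if xy: "x \<in> {-r..r}" "y \<in> {-r..r}" for x y
  proof (rule has_vector_derivative_transform[OF xy(2) s_y[OF xy(1)]])
    have "((\<lambda>y. s x 0 + integral_from_0 (\<lambda>\<eta>. M2 x \<eta> *v s x \<eta>) y) has_vector_derivative
        0 + M2 x y *v s x y) (at y within {-r..r})"
      using c2[OF u(1) xy(1)]
      by (intro has_vector_derivative_add has_vector_derivative_const
          integral_from_0_has_vector_derivative xy) (simp add: s_def)
    then show "((\<lambda>y. s x 0 + integral_from_0 (\<lambda>\<eta>. M2 x \<eta> *v s x \<eta>) y) has_vector_derivative
        M2 x y *v s x y) (at y within {-r..r})" by simp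
  qed
  have conts: "continuous_on X (\<lambda>z. s (f z) (g z))" if "continuous_on X f" "continuous_on X g"
    for X :: "'x::topological_space set" and f g
    unfolding s_def by (rule contu[OF u(1) that])
  define D where "D x y = s x y - s 0 y - integral_from_0 (\<lambda>\<xi>. M1 \<xi> y *v s \<xi> y) x" for x y
  have D0: "D x 0 = 0" if "x \<in> {-r..r}" for x
    using s_x0[OF that zero] s_x0[OF zero zero] by (simp add: D_def integral_from_0_def)
  have c1s: "continuous_on {-r..r} (\<lambda>\<xi>. M1 \<xi> y *v s \<xi> y)" if "y \<in> {-r..r}" for y
    using c1[OF u(1) that] by (simp add: s_def)
  have contD: "continuous_on ({-r..r} \<times> {-r..r}) (\<lambda>(x, y). D x y)"
    unfolding D_def split_beta
  proof (intro continuous_on_diff conts integral_from_0_continuous_param)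
    show "continuous_on (({-r..r} \<times> {-r..r}) \<times> cbox 0 1)
       (\<lambda>(z, t). M1 (t * fst z) (snd z) *v s (t * fst z) (snd z))"
      unfolding split_beta
    proof (intro continuous_on_matrix_vector_mult cont'[OF cont(1)] conts)
      fix z :: "(real \<times> real) \<times> real" assume "z \<in> ({-r..r} \<times> {-r..r}) \<times> cbox 0 1"
      then have z: "fst (fst z) \<in> {-r..r}" "snd (fst z) \<in> {-r..r}" "snd z \<in> cbox 0 1"
        by (simp_all only: mem_Times_iff)
      show "snd z * fst (fst z) \<in> {-r..r}" by (rule mult_cbox_01_bounds[OF z(1,3)])
      show "snd (fst z) \<in> {-r..r}" by (rule z)
    qed (intro continuous_intros)+
  qed (auto intro!: continuous_intros)
  have contDx: "continuous_on {-r..r} (\<lambda>x. D x y)" if "y \<in> {-r..r}" for y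
    using continuous_on_compose2[OF contD continuous_on_Pair[OF continuous_on_id continuous_on_const[of _ y]], of "{-r..r}"] that
    by (simp add: image_subset_iff)
  have dD: "((\<lambda>y. D x y) has_vector_derivative M2 x y *v D x y - integral_from_0 (\<lambda>\<xi>. M2x \<xi> y *v D \<xi> y) x)
      (at y within {-r..r})" if x: "x \<in> {-r..r}" and y: "y \<in> {-r..r}" for x y
  proof -
    \<comment> \<open>\<open>g\<close> is the value that \<open>s\<close> would have if the first
      equation held, so \<open>s\<close> is \<open>g + D\<close>. Unlike \<open>s\<close>, it is
      differentiable in the first variable by construction.\<close>
    define g where "g \<xi> = s 0 y + integral_from_0 (\<lambda>\<xi>. M1 \<xi> y *v s \<xi> y) \<xi>" for \<xi>
    have sg: "s \<xi> y = g \<xi> + D \<xi> y" for \<xi> by (simp add: D_def g_def)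
    \<comment> \<open>The y-derivative of \<open>M1 s\<close>, rewritten by flatness so that
      \<open>M2x\<close> occurs instead of \<open>M1y\<close>; in this form it can be compared with
      the derivative of \<open>M2 g\<close> in the first variable.\<close>
    define I where "I \<xi> y = (M2x \<xi> y + M2 \<xi> y ** M1 \<xi> y) *v s \<xi> y" for \<xi> y
    have dint: "((\<lambda>y. integral (cbox 0 1) (\<lambda>t. M1 (t * x) y *v s (t * x) y)) has_vector_derivative
       integral (cbox 0 1) (\<lambda>t. I (t * x) y)) (at y within {-r..r})"
    proof (rule leibniz_rule_vector_derivative[OF _ _ _ y])
      fix y and t :: real assume y: "y \<in> {-r..r}" and t: "t \<in> cbox 0 1"
      note tx = mult_cbox_01_bounds[OF x t]
      have "((\<lambda>y. M1 (t * x) y) has_vector_derivative M1y (t * x) y) (at y within {-r..r})"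
        by (rule has_vector_derivative_within_subset[OF M1y[OF rI[OF tx] rI[OF y]]]) (use r in auto)
      from has_vector_derivative_matrix_vector_mult[OF this dsy[OF tx y]]
      have "((\<lambda>y. M1 (t * x) y *v s (t * x) y) has_vector_derivative
        M1 (t * x) y *v (M2 (t * x) y *v s (t * x) y) + M1y (t * x) y *v s (t * x) y) (at y within {-r..r})" .
      moreover have "M1 (t * x) y *v (M2 (t * x) y *v s (t * x) y) + M1y (t * x) y *v s (t * x) y = I (t * x) y"
        unfolding I_def flat[OF rI[OF tx] rI[OF y], symmetric]
        by (simp add: matrix_vector_mult_add_rdistrib matrix_vector_mul_assoc)
      ultimately show "((\<lambda>y. M1 (t * x) y *v s (t * x) y) has_vector_derivative I (t * x) y) (at y within {-r..r})"
        by simp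
    next
      fix y assume y: "y \<in> {-r..r}"
      show "(\<lambda>t. M1 (t * x) y *v s (t * x) y) integrable_on cbox 0 1"
        by (intro integrable_continuous continuous_on_mult_01[OF c1s[OF y] x])
    next
      have "continuous_on ({-r..r} \<times> cbox 0 1) (\<lambda>(y, t). M2x (t * x) y *v s (t * x) y +
         M2 (t * x) y *v (M1 (t * x) y *v s (t * x) y))"
        unfolding split_beta
      proof (intro continuous_on_add continuous_on_matrix_vector_mult cont'[OF cont(1)] cont'[OF cont(2)]
            cont'[OF cont(4)] conts)
        fix z :: "real \<times> real" assume "z \<in> {-r..r} \<times> cbox 0 1"
        then have z: "fst z \<in> {-r..r}" "snd z \<in> cbox 0 1"
          by (simp_all only: mem_Times_iff)
        show "snd z * x \<in> {-r..r}" "snd z * x \<in> {-r..r}" "snd z * x \<in> {-r..r}"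
          by (rule mult_cbox_01_bounds[OF x z(2)])+
        show "fst z \<in> {-r..r}" "fst z \<in> {-r..r}" "fst z \<in> {-r..r}"
          by (rule z)+
      qed (intro continuous_intros)+
      then show "continuous_on ({-r..r} \<times> cbox 0 1) (\<lambda>(y, t). I (t * x) y)"
        by (simp add: I_def matrix_vector_mult_add_rdistrib matrix_vector_mul_assoc)
    qed (rule convex_real_interval)
    have "((\<lambda>y. D x y) has_vector_derivative M2 x y *v s x y - M2 0 y *v s 0 y -
        x *\<^sub>R integral (cbox 0 1) (\<lambda>t. I (t * x) y)) (at y within {-r..r})"
      unfolding D_def integral_from_0_def
      by (intro has_vector_derivative_diff dsy x y zero
          bounded_linear.has_vector_derivative[OF bounded_linear_scaleR_right dint])
    then have D': "((\<lambda>y. D x y) has_vector_derivative M2 x y *v s x y - M2 0 y *v s 0 y -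
        integral_from_0 (\<lambda>\<xi>. I \<xi> y) x) (at y within {-r..r})"
      by (simp add: integral_from_0_def)
    \<comment> \<open>The integration by parts: the integrand is the derivative of
      \<open>M2 g\<close>. Subtracting it from \<open>I\<close> leaves only \<open>M2x\<close>
      applied to \<open>D\<close>.\<close>
    have "integral_from_0 (\<lambda>\<xi>. M2 \<xi> y *v (M1 \<xi> y *v s \<xi> y) + M2x \<xi> y *v g \<xi>) x
       = M2 x y *v g x - M2 0 y *v g 0"
    proof (rule integral_from_0_fundamental[OF _ x])
      fix \<xi> assume \<xi>: "\<xi> \<in> {-r..r}"
      have "(g has_vector_derivative 0 + M1 \<xi> y *v s \<xi> y) (at \<xi> within {-r..r})"
        unfolding g_def
        by (intro has_vector_derivative_add has_vector_derivative_const
          integral_from_0_has_vector_derivative c1s y \<xi>)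
      then have "(g has_vector_derivative M1 \<xi> y *v s \<xi> y) (at \<xi> within {-r..r})" by simp
      moreover have "((\<lambda>x. M2 x y) has_vector_derivative M2x \<xi> y) (at \<xi> within {-r..r})"
        by (rule has_vector_derivative_within_subset[OF M2x[OF rI[OF \<xi>] rI[OF y]]]) (use r in auto)
      ultimately show "((\<lambda>x. M2 x y *v g x) has_vector_derivative
          M2 \<xi> y *v (M1 \<xi> y *v s \<xi> y) + M2x \<xi> y *v g \<xi>) (at \<xi> within {-r..r})"
        by (intro has_vector_derivative_matrix_vector_mult)
    qed
    moreover have "integral_from_0 (\<lambda>\<xi>. I \<xi> y) x
        - integral_from_0 (\<lambda>\<xi>. M2 \<xi> y *v (M1 \<xi> y *v s \<xi> y) + M2x \<xi> y *v g \<xi>) x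
       = integral_from_0 (\<lambda>\<xi>. I \<xi> y - (M2 \<xi> y *v (M1 \<xi> y *v s \<xi> y) + M2x \<xi> y *v g \<xi>)) x"
    proof (rule integral_from_0_diff[OF _ _ x])
      have cg: "continuous_on {-r..r} g"
        unfolding g_def using c1s[OF y] y
        by (intro continuous_on_add continuous_on_const)
          (auto intro!: continuous_on_vector_derivative integral_from_0_has_vector_derivative)
      show "continuous_on {-r..r} (\<lambda>\<xi>. M2 \<xi> y *v (M1 \<xi> y *v s \<xi> y) + M2x \<xi> y *v g \<xi>)"
        using y by (intro continuous_on_add continuous_on_matrix_vector_mult cont'[OF cont(1)] cont'[OF cont(2)]
            cont'[OF cont(4)] conts cg continuous_on_id continuous_on_const)
      have "continuous_on {-r..r} (\<lambda>\<xi>. M2x \<xi> y *v s \<xi> y + M2 \<xi> y *v (M1 \<xi> y *v s \<xi> y))"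
        using y by (intro continuous_on_add continuous_on_matrix_vector_mult cont'[OF cont(1)] cont'[OF cont(2)]
            cont'[OF cont(4)] conts continuous_on_id continuous_on_const)
      then show "continuous_on {-r..r} (\<lambda>\<xi>. I \<xi> y)"
        by (simp add: I_def matrix_vector_mult_add_rdistrib matrix_vector_mul_assoc)
    qed
    moreover have "I \<xi> y - (M2 \<xi> y *v (M1 \<xi> y *v s \<xi> y) + M2x \<xi> y *v g \<xi>) = M2x \<xi> y *v D \<xi> y" for \<xi>
    proof -
      have "D \<xi> y = s \<xi> y - g \<xi>" by (simp add: sg)
      then show ?thesis
        by (simp add: I_def matrix_vector_mult_add_rdistrib matrix_vector_mul_assoc
            matrix_vector_mult_diff_distrib)
    qed
    moreover have "g 0 = s 0 y" by (simp add: g_def integral_from_0_def)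
    ultimately have "integral_from_0 (\<lambda>\<xi>. I \<xi> y) x
       = integral_from_0 (\<lambda>\<xi>. M2x \<xi> y *v D \<xi> y) x + (M2 x y *v g x - M2 0 y *v s 0 y)"
      by (simp add: algebra_simps)
    then have "M2 x y *v s x y - M2 0 y *v s 0 y - integral_from_0 (\<lambda>\<xi>. I \<xi> y) x
      = M2 x y *v D x y - integral_from_0 (\<lambda>\<xi>. M2x \<xi> y *v D \<xi> y) x"
      by (simp add: sg[of x] matrix_vector_right_distrib algebra_simps)
    then show ?thesis using D' by simp
  qed
  have D_zero: "D x y = 0" if "x \<in> {-r..r}" "y \<in> {-r..r}" for x y
  proof -
    have "\<exists>z\<in>{-r..r} \<times> {-r..r}. \<forall>w\<in>{-r..r} \<times> {-r..r}.
        norm ((\<lambda>(x, y). D x y) w) \<le> norm ((\<lambda>(x, y). D x y) z)"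
      using zero by (intro continuous_attains_sup compact_Times compact_Icc continuous_on_norm contD) auto
    then obtain x0 y0 where xy0: "x0 \<in> {-r..r}" "y0 \<in> {-r..r}"
      and max: "\<And>x y. x \<in> {-r..r} \<Longrightarrow> y \<in> {-r..r} \<Longrightarrow> norm (D x y) \<le> norm (D x0 y0)"
      by auto
    define N where "N = norm (D x0 y0)"
    have N: "N \<ge> 0" by (simp add: N_def)
    \<comment> \<open>The mean value inequality on the vertical segment from \<open>y = 0\<close>,
      where \<open>D\<close> vanishes, to a point where the norm of \<open>D\<close> is maximal. The
      length of the segment is at most \<open>r\<close>, which supplies the small factor.\<close>
    have "norm (D x0 y0 - D x0 0) \<le> C * N * norm (y0 - 0)"
    proof (rule differentiable_bound[OF convex_real_interval(5) _ _ xy0(2) zero])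
      fix y assume y: "y \<in> {-r..r}"
      let ?d = "M2 x0 y *v D x0 y - integral_from_0 (\<lambda>\<xi>. M2x \<xi> y *v D \<xi> y) x0"
      show "((\<lambda>y. D x0 y) has_derivative (\<lambda>h. h *\<^sub>R ?d)) (at y within {-r..r})"
        using dD[OF xy0(1) y] by (simp add: has_vector_derivative_def)
      have "norm (M2 x0 y *v D x0 y) \<le> C2 * N"
        using C2(2)[OF rI[OF xy0(1)] rI[OF y], of "D x0 y"] mult_left_mono[OF max[OF xy0(1) y] C2(1)]
        by (simp add: N_def)
      moreover have "norm (integral_from_0 (\<lambda>\<xi>. M2x \<xi> y *v D \<xi> y) x0) \<le> \<bar>x0\<bar> * (C3 * N)"
      proof (rule norm_integral_from_0_le[OF _ xy0(1)])
        show "continuous_on {-r..r} (\<lambda>\<xi>. M2x \<xi> y *v D \<xi> y)"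
          using y by (intro continuous_on_matrix_vector_mult cont'[OF cont(4)] contDx continuous_on_id continuous_on_const)
        show "norm (M2x \<xi> y *v D \<xi> y) \<le> C3 * N" if "\<xi> \<in> {-r..r}" for \<xi>
          using C3(2)[OF rI[OF that] rI[OF y], of "D \<xi> y"] mult_left_mono[OF max[OF that y] C3(1)]
          by (simp add: N_def)
      qed
      moreover have "\<bar>x0\<bar> * (C3 * N) \<le> R * C3 * N"
        using xy0(1) r(2) C3(1) N mult_right_mono[of "\<bar>x0\<bar>" R "C3 * N"] by (simp add: mult.assoc abs_le_iff)
      ultimately have "norm ?d \<le> C2 * N + R * C3 * N"
        using norm_triangle_ineq4[of "M2 x0 y *v D x0 y" "integral_from_0 (\<lambda>\<xi>. M2x \<xi> y *v D \<xi> y) x0"]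
        by linarith
      also have "\<dots> = (C2 + R * C3) * N" by (simp add: algebra_simps)
      also have "\<dots> \<le> C * N"
        using N C1(1) by (intro mult_right_mono) (auto simp: C_def)
      finally show "onorm (\<lambda>h. h *\<^sub>R ?d) \<le> C * N"
        by (intro onorm_le) (simp add: mult.commute mult_left_mono)
    qed
    also have "\<dots> \<le> C * N * r"
      using xy0 N \<open>C \<ge> 1\<close> by (intro mult_left_mono) auto
    also have "\<dots> = r * C * N" by simp
    also have "\<dots> \<le> 1 / 2 * N" using r(3) N by (intro mult_right_mono) auto
    finally have "N \<le> 1 / 2 * N" by (simp add: D0[OF xy0(1)] N_def)
    then have "N = 0" using N by simp
    then show ?thesis using max[OF that] by (simp add: N_def)
  qed
  have dsx: "((\<lambda>x. s x y) has_vector_derivative M1 x y *v s x y) (at x within {-r..r})"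
    if xy: "x \<in> {-r..r}" "y \<in> {-r..r}" for x y
  proof (rule has_vector_derivative_transform[OF xy(1)])
    show "s x y = s 0 y + integral_from_0 (\<lambda>\<xi>. M1 \<xi> y *v s \<xi> y) x" if "x \<in> {-r..r}" for x
      using D_zero[OF that xy(2)] by (simp add: D_def algebra_simps)
    have "((\<lambda>x. s 0 y + integral_from_0 (\<lambda>\<xi>. M1 \<xi> y *v s \<xi> y) x) has_vector_derivative
        0 + M1 x y *v s x y) (at x within {-r..r})"
      by (intro has_vector_derivative_add has_vector_derivative_const
          integral_from_0_has_vector_derivative xy c1s)
    then show "((\<lambda>x. s 0 y + integral_from_0 (\<lambda>\<xi>. M1 \<xi> y *v s \<xi> y) x) has_vector_derivative
        M1 x y *v s x y) (at x within {-r..r})" by simp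
  qed
  show ?thesis
  proof (rule that[of r s])
    show "s 0 0 = s0" using s_x0[OF zero zero] by (simp add: integral_from_0_def)
    show "continuous_on UNIV (\<lambda>(x, y). s x y)" using u(1) by (simp add: s_def)
    fix x y assume xy: "x \<in> {-r<..<r}" "y \<in> {-r<..<r}"
    then show "((\<lambda>x. s x y) has_vector_derivative M1 x y *v s x y) (at x)"
      "((\<lambda>y. s x y) has_vector_derivative M2 x y *v s x y) (at y)"
      using dsx[of x y] dsy[of x y] by (auto simp: at_within_Icc_at)
  qed (rule r)
qed

lemma vec2_eq_axis_sum: "(v :: real^2) = (v $ 1) *\<^sub>R axis 1 1 + (v $ 2) *\<^sub>R axis 2 1"
  by (simp add: vec_eq_iff forall_2 axis_def)

lemma linear_vec2_expand:
  fixes L :: "real^2 \<Rightarrow> 'a::real_vector"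
  assumes "linear L"
  shows "L v = (v $ 1) *\<^sub>R L (axis 1 1) + (v $ 2) *\<^sub>R L (axis 2 1)"
  by (subst vec2_eq_axis_sum) (simp only: linear_add[OF assms] linear_scale[OF assms])

text \<open>The solution on a square, in coordinates centred at \<open>p\<close>, has continuous
  partial derivatives and is therefore totally differentiable; smoothness of every order follows
  since its derivative is linear in the solution with smooth coefficients.\<close>

theorem flat_system_solution:
  fixes M1 M2 :: "real^2 \<Rightarrow> real^'n^'n"
  assumes S: "open S" "p \<in> S" and smooth: "smooth_on S M1" "smooth_on S M2"
    and flat: "\<And>x. x \<in> S \<Longrightarrow> frechet_derivative M1 (at x) (axis 2 1) + M1 x ** M2 x
      = frechet_derivative M2 (at x) (axis 1 1) + M2 x ** M1 x"
  obtains T s where "open T" "p \<in> T" "T \<subseteq> S" "s p = s0" "smooth_on T s"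
    "\<And>x. x \<in> T \<Longrightarrow> (s has_derivative (\<lambda>v. (v $ 1) *\<^sub>R (M1 x *v s x) + (v $ 2) *\<^sub>R (M2 x *v s x))) (at x)"
proof -
  define e where "e x y = p + x *\<^sub>R (axis 1 1 :: real^2) + y *\<^sub>R axis 2 1" for x y :: real
  have e_alt: "e x y = (p + y *\<^sub>R axis 2 1) + x *\<^sub>R axis 1 1" for x y by (simp add: e_def)
  obtain d where d: "d > 0" "ball p d \<subseteq> S" using S open_contains_ball by blast
  \<comment> \<open>On the square the distance to \<open>p\<close> is at most \<open>2 * R\<close>,
    which is less than \<open>d\<close>.\<close>
  define R where "R = d / 3"
  have R: "R > 0" using d by (simp add: R_def)
  have eS: "e x y \<in> S" if "x \<in> {-R..R}" "y \<in> {-R..R}" for x y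
  proof -
    have "dist p (e x y) = norm (x *\<^sub>R (axis 1 1 :: real^2) + y *\<^sub>R axis 2 1)"
      by (subst dist_commute) (simp add: e_def dist_norm add.assoc)
    also have "\<dots> \<le> \<bar>x\<bar> + \<bar>y\<bar>"
      by (rule order_trans[OF norm_triangle_ineq]) (simp add: norm_axis_1)
    also have "\<dots> < d" using that d(1) by (auto simp: R_def)
    finally show ?thesis using d(2) by auto
  qed
  have cont: "continuous_on ({-R..R} \<times> {-R..R}) (\<lambda>(x, y). N (e x y))"
    if "continuous_on S N" for N :: "real^2 \<Rightarrow> real^'n^'n"
    unfolding split_beta
    by (rule continuous_on_compose2[OF that]) (auto simp: e_def intro!: continuous_intros eS[unfolded e_def])
  obtain r s where r: "0 < r" and s0: "s 0 0 = s0" and cs: "continuous_on UNIV (\<lambda>(x, y). s x y)"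
    and dsx: "\<And>x y. x \<in> {-r<..<r} \<Longrightarrow> y \<in> {-r<..<r} \<Longrightarrow>
      ((\<lambda>x. s x y) has_vector_derivative M1 (e x y) *v s x y) (at x)"
    and dsy: "\<And>x y. x \<in> {-r<..<r} \<Longrightarrow> y \<in> {-r<..<r} \<Longrightarrow>
      ((\<lambda>y. s x y) has_vector_derivative M2 (e x y) *v s x y) (at y)"
  proof (rule flat_system_square[OF R, of "\<lambda>x y. M1 (e x y)" "\<lambda>x y. M2 (e x y)"
        "\<lambda>x y. frechet_derivative M1 (at (e x y)) (axis 2 1)"
        "\<lambda>x y. frechet_derivative M2 (at (e x y)) (axis 1 1)" s0])
    fix x y assume xy: "x \<in> {-R..R}" "y \<in> {-R..R}"
    show "((\<lambda>y. M1 (e x y)) has_vector_derivative frechet_derivative M1 (at (e x y)) (axis 2 1))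
        (at y within {-R..R})"
      using has_vector_derivative_along_line[of M1 "frechet_derivative M1 (at (e x y))"
          "p + x *\<^sub>R axis 1 1" y "axis 2 1"] smooth_on_has_derivative[OF smooth(1) eS[OF xy]]
      by (simp add: e_def has_vector_derivative_at_within)
    show "((\<lambda>x. M2 (e x y)) has_vector_derivative frechet_derivative M2 (at (e x y)) (axis 1 1))
        (at x within {-R..R})"
      using has_vector_derivative_along_line[of M2 "frechet_derivative M2 (at (e x y))"
          "p + y *\<^sub>R axis 2 1" x "axis 1 1"] smooth_on_has_derivative[OF smooth(2) eS[OF xy]]
      by (simp add: e_alt has_vector_derivative_at_within)
    show "frechet_derivative M1 (at (e x y)) (axis 2 1) + M1 (e x y) ** M2 (e x y) =
        frechet_derivative M2 (at (e x y)) (axis 1 1) + M2 (e x y) ** M1 (e x y)"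
      by (rule flat[OF eS[OF xy]])
  qed ((intro cont smooth_on_imp_continuous_on smooth smooth_on_frechet_derivative)+, rule that, assumption+)
  define q where "q = min r R"
  define X where "X = {-q<..<q}"
  have q: "q > 0" "\<And>x. x \<in> X \<Longrightarrow> x \<in> {-r<..<r}" "\<And>x. x \<in> X \<Longrightarrow> x \<in> {-R..R}"
    using r R by (auto simp: q_def X_def)
  have ds: "((\<lambda>(x, y). s x y) has_derivative
      (\<lambda>(h, k). h *\<^sub>R (M1 (e x y) *v s x y) + k *\<^sub>R (M2 (e x y) *v s x y))) (at (x, y))"
    if xy: "x \<in> X" "y \<in> X" for x y
  proof -
    \<comment> \<open>Total differentiability from one partial derivative at the point and a second
      one that is continuous near it; only the latter has to be packed as a bounded linear
      map.\<close>
    have "((\<lambda>(x, y). s x y) has_derivative (\<lambda>(h, k). h *\<^sub>R (M1 (e x y) *v s x y)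
        + blinfun_scaleR_left (M2 (e x y) *v s x y) k)) (at (x, y) within X \<times> X)"
    proof (rule has_derivative_partialsI[where fy = "\<lambda>x y. blinfun_scaleR_left (M2 (e x y) *v s x y)"])
      show "((\<lambda>x. s x y) has_derivative (\<lambda>h. h *\<^sub>R (M1 (e x y) *v s x y))) (at x within X)"
        using dsx[OF q(2)[OF xy(1)] q(2)[OF xy(2)]]
        by (simp add: has_vector_derivative_def has_derivative_at_withinI)
      show "((\<lambda>y. s x y) has_derivative blinfun_apply (blinfun_scaleR_left (M2 (e x y) *v s x y))) (at y within X)"
        if "x \<in> X" "y \<in> X" for x y
        using dsy[OF q(2)[OF that(1)] q(2)[OF that(2)]]
        by (simp add: has_vector_derivative_def has_derivative_at_withinI)
      have "continuous_on (X \<times> X) (\<lambda>(x, y). M2 (e x y))"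
        by (rule continuous_on_subset[OF cont[OF smooth_on_imp_continuous_on[OF smooth(2)]]])
          (use q(3) in blast)
      moreover have "continuous_on (X \<times> X) (\<lambda>(x, y). s x y)"
        using cs continuous_on_subset by blast
      ultimately have "continuous_on (X \<times> X) (\<lambda>z. blinfun_scaleR_left (M2 (e (fst z) (snd z)) *v s (fst z) (snd z)))"
        unfolding split_beta
        by (intro bounded_linear.continuous_on[OF bounded_linear_blinfun_scaleR_left] continuous_on_matrix_vector_mult)
      then show "continuous (at (x, y) within X \<times> X) (\<lambda>(x, y). blinfun_scaleR_left (M2 (e x y) *v s x y))"
        unfolding split_beta using xy by (simp add: continuous_on_eq_continuous_within)
    qed (use xy in \<open>auto simp: X_def\<close>)
    moreover have "open (X \<times> X)" by (simp add: X_def open_Times)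
    moreover have "(x, y) \<in> X \<times> X" using xy by simp
    ultimately show ?thesis
      by (simp only: at_within_open blinfun_scaleR_left.rep_eq)
  qed
  define T where "T = {v :: real^2. v $ 1 - p $ 1 \<in> X \<and> v $ 2 - p $ 2 \<in> X}"
  define \<sigma> where "\<sigma> v = s (v $ 1 - p $ 1) (v $ 2 - p $ 2)" for v :: "real^2"
  have ev: "e (v $ 1 - p $ 1) (v $ 2 - p $ 2) = v" for v
    by (simp add: e_def vec_eq_iff forall_2 axis_def)
  have T: "open T" "p \<in> T" "T \<subseteq> S"
  proof -
    have "T = (\<lambda>v. v $ 1 - p $ 1) -` X \<inter> (\<lambda>v. v $ 2 - p $ 2) -` X" by (auto simp: T_def)
    then show "open T"
      by (auto simp: X_def intro!: open_Int open_vimage continuous_intros)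
    show "p \<in> T" using q(1) by (simp add: T_def X_def)
    show "T \<subseteq> S" using eS q(3) ev unfolding T_def by (metis (no_types, lifting) mem_Collect_eq subsetI)
  qed
  have d\<sigma>: "(\<sigma> has_derivative (\<lambda>v. (v $ 1) *\<^sub>R (M1 x *v \<sigma> x) + (v $ 2) *\<^sub>R (M2 x *v \<sigma> x))) (at x)"
    if "x \<in> T" for x
  proof -
    have D1: "((\<lambda>v. (v $ 1 - p $ 1, v $ 2 - p $ 2)) has_derivative (\<lambda>v. (v $ 1, v $ 2))) (at x)"
      by (auto intro!: derivative_eq_intros bounded_linear.has_derivative[OF bounded_linear_vec_nth]
          simp: split_beta)
    have D2: "((\<lambda>(x, y). s x y) has_derivative
      (\<lambda>(h, k). h *\<^sub>R (M1 x *v \<sigma> x) + k *\<^sub>R (M2 x *v \<sigma> x))) (at (x $ 1 - p $ 1, x $ 2 - p $ 2))"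
      using ds[of "x $ 1 - p $ 1" "x $ 2 - p $ 2"] that by (simp add: T_def \<sigma>_def ev)
    show ?thesis
      using has_derivative_compose[OF D1 D2]
      by (simp add: \<sigma>_def[abs_def])
  qed
  \<comment> \<open>Bootstrapping: if \<open>\<sigma>\<close> is of class k, so is the right-hand
    side of the system, that is, the derivative of \<open>\<sigma>\<close>.\<close>
  have "C_on k T \<sigma>" for k
  proof (induction k)
    case 0
    then show ?case
      using d\<sigma> by (auto intro!: continuous_at_imp_continuous_on has_derivative_continuous)
  next
    case (Suc k)
    show ?case
    proof (rule C_on_SucI[OF T(1) d\<sigma>])
      have "C_on k T M1" "C_on k T M2"
        using smooth T(3) smooth_onD smooth_on_subset by blast+
      then show "C_on k T (\<lambda>x. (v $ 1) *\<^sub>R (M1 x *v \<sigma> x) + (v $ 2) *\<^sub>R (M2 x *v \<sigma> x))" for v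
        by (intro C_on_add C_on_bilinear[OF bounded_bilinear_scaleR] C_on_const
            C_on_bilinear[OF bounded_bilinear_matrix_vector_mult] Suc T(1))
    qed
  qed
  moreover have "\<sigma> p = s0" by (simp add: \<sigma>_def s0)
  ultimately show ?thesis
    using that[OF T, of \<sigma>] d\<sigma> by (simp add: smooth_on_def)
qed

text \<open>The inverse function theorem yields a differentiable inverse \<open>g\<close>. Its
  derivative is the inverse matrix of the derivative of \<open>f\<close> at \<open>g y\<close>,
  whose entries are smooth by Cramer's rule, so every order of differentiability of \<open>g\<close>
  gives the next.\<close>

lemma smooth_inverse_function_2:
  fixes f :: "real^2 \<Rightarrow> real^2"
  assumes S: "open S" "x0 \<in> S" and f: "smooth_on S f" and inj: "inj (frechet_derivative f (at x0))"
  obtains U g where "open U" "x0 \<in> U" "U \<subseteq> S" "open (f ` U)" "homeomorphism U (f ` U) f g"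
    "smooth_on (f ` U) g"
proof -
  let ?D = "\<lambda>x. frechet_derivative f (at x)"
  have der: "(f has_derivative ?D x) (at x)" if "x \<in> S" for x
    using smooth_on_has_derivative[OF f that] .
  define L where "L x = Blinfun (?D x)" for x
  have L: "blinfun_apply (L x) = ?D x" if "x \<in> S" for x
    unfolding L_def using der[OF that]
    by (intro bounded_linear_Blinfun_apply has_derivative_bounded_linear)
  have contL: "continuous_on S L"
  proof (rule continuous_on_blinfun_componentwise)
    fix b :: "real^2"
    show "continuous_on S (\<lambda>x. blinfun_apply (L x) b)"
      using smooth_on_imp_continuous_on[OF smooth_on_frechet_derivative[OF f]] L
      by (subst continuous_on_cong[OF refl, of S _ "\<lambda>x. ?D x b"]) auto
  qed
  obtain h where h: "linear h" "h \<circ> ?D x0 = id"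
    using linear_injective_left_inverse[OF has_derivative_linear[OF der[OF S(2)]] inj] by blast
  have inv: "Blinfun h o\<^sub>L L x0 = id_blinfun"
    using h L[OF S(2)] linear_conv_bounded_linear[of h]
    by (intro blinfun_eqI) (simp add: bounded_linear_Blinfun_apply fun_eq_iff)
  obtain U V g g' where UV: "open U" "U \<subseteq> S" "x0 \<in> U" "open V" "f x0 \<in> V" "homeomorphism U V f g"
    and g': "\<And>y. y \<in> V \<Longrightarrow> (g has_derivative (g' y)) (at y)"
      "\<And>y. y \<in> V \<Longrightarrow> g' y = Hilbert_Choice.inv (blinfun_apply (L (g y)))"
      "\<And>y. y \<in> V \<Longrightarrow> bij (blinfun_apply (L (g y)))"
    using inverse_function_theorem[OF S(1) _ contL S(2) inv] der L by metis
  have V: "V = f ` U" and gU: "g ` V = U" using UV(6) by (auto simp: homeomorphism_def)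
  have gS: "g y \<in> S" "g y \<in> U" if "y \<in> V" for y using that gU UV(2) by auto
  define J where "J i j x = ?D x (axis j 1) $ i" for i j :: 2 and x
  define det where "det x = J 1 1 x * J 2 2 x - J 1 2 x * J 2 1 x" for x
  \<comment> \<open>Cramer's rule: \<open>W v x\<close> is the solution \<open>w\<close> of
    \<open>?D x w = v\<close>.\<close>
  define W where "W v x = (vector [(J 2 2 x * v $ 1 - J 1 2 x * v $ 2) / det x,
      (J 1 1 x * v $ 2 - J 2 1 x * v $ 1) / det x] :: real^2)" for v :: "real^2" and x
  have DJ: "?D x v $ i = J i 1 x * v $ 1 + J i 2 x * v $ 2" if "x \<in> S" for x v i
    by (subst linear_vec2_expand[OF has_derivative_linear[OF der[OF that]]]) (simp add: J_def)
  have bij: "bij (?D x)" if "x \<in> U" for x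
    using g'(3) L gS that gU by (metis imageE)
  have det: "det x \<noteq> 0" if x: "x \<in> U" for x
  proof
    assume 0: "det x = 0"
    have xS: "x \<in> S" using x UV(2) by auto
    have zero: "v = 0" if "?D x v = 0" for v
      using that bij[OF x] linear_0[OF has_derivative_linear[OF der[OF xS]]] by (metis bij_pointE)
    \<comment> \<open>These are the columns of the adjugate matrix; if the determinant vanishes,
      they lie in the kernel, which forces the first column of the Jacobian to be zero.\<close>
    have "?D x (vector [J 2 2 x, - J 2 1 x]) = 0" "?D x (vector [- J 1 2 x, J 1 1 x]) = 0"
      using 0 by (auto simp: vec_eq_iff forall_2 DJ[OF xS] det_def algebra_simps)
    from this[THEN zero] have "J 1 1 x = 0" "J 2 1 x = 0"
      by (auto simp: vec_eq_iff forall_2)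
    then have "?D x (axis 1 1) = 0" by (simp add: vec_eq_iff forall_2 J_def)
    from zero[OF this] show False by (simp add: axis_eq_0_iff)
  qed
  have g'W: "g' y v = W v (g y)" if y: "y \<in> V" for y v
  proof -
    have "?D (g y) (W v (g y)) = v"
      using det[OF gS(2)[OF y]]
      by (simp add: vec_eq_iff forall_2 DJ[OF gS(1)[OF y]] W_def divide_simps)
        (simp add: det_def algebra_simps)
    then show ?thesis
      using g'(2)[OF y] bij[OF gS(2)[OF y]] L[OF gS(1)[OF y]] by (metis bij_inv_eq_iff)
  qed
  have J: "smooth_on U (J i j)" for i j
    unfolding J_def[abs_def] using f UV(1,2)
    by (intro smooth_on_nth smooth_on_frechet_derivative) (auto intro: smooth_on_subset)
  have "smooth_on U det" unfolding det_def[abs_def] using UV(1) J by (intro smooth_intros)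
  then have W: "smooth_on U (W v)" for v
    using UV(1) J det
    by (auto simp: smooth_on_vec_iff forall_2 W_def intro!: smooth_on_divide smooth_intros)
  have "C_on k V g" for k
  proof (induction k)
    case 0
    then show ?case using UV(6) by (simp add: homeomorphism_def)
  next
    case (Suc k)
    show ?case
    proof (rule C_on_SucI[OF UV(4) g'(1)])
      fix v
      have "C_on k V (\<lambda>y. W v (g y))"
        by (rule C_on_compose[OF UV(4) Suc smooth_onD[OF W]]) (simp add: gU)
      then show "C_on k V (\<lambda>y. g' y v)"
        by (subst C_on_cong[OF UV(4) g'W])
    qed
  qed
  then show ?thesis
    using that[of U g] UV V by (simp add: smooth_on_def)
qed

text \<open>A Gronwall argument: the energy \<open>E\<close>, the sum of the squares of
  \<open>w\<close> and \<open>w'\<close>, has derivative at most \<open>K * E\<close>. Hence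
  \<open>E t * exp (- K * t)\<close> does not increase, and it starts at zero.\<close>

lemma linear_ode_zero_forward:
  fixes w w' :: "real \<Rightarrow> real"
  assumes cont: "continuous_on {a..b} f" "continuous_on {a..b} g"
    and w: "\<And>t. t \<in> {a..b} \<Longrightarrow> (w has_real_derivative w' t) (at t)"
    and w': "\<And>t. t \<in> {a..b} \<Longrightarrow> (w' has_real_derivative f t * w' t - g t * w t) (at t)"
    and init: "w a = 0" "w' a = 0" and "a \<le> b"
  shows "w b = 0"
proof -
  have "\<exists>B. \<forall>t\<in>{a..b}. \<bar>h t\<bar> \<le> B" if "continuous_on {a..b} h" for h :: "real \<Rightarrow> real"
    using compact_imp_bounded[OF compact_continuous_image[OF that compact_Icc]]
    by (auto simp: bounded_iff)
  then obtain F G where F: "\<And>t. t \<in> {a..b} \<Longrightarrow> \<bar>f t\<bar> \<le> F" and G: "\<And>t. t \<in> {a..b} \<Longrightarrow> \<bar>g t\<bar> \<le> G"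
    using cont by meson
  \<comment> \<open>\<open>1 + G\<close> bounds the mixed term
    \<open>2 * (1 - g t) * (w t * w' t)\<close>, since twice the product of \<open>w\<close> and
    \<open>w'\<close> is at most \<open>E\<close>; \<open>2 * F\<close> bounds the term with the
    square of \<open>w'\<close>.\<close>
  define K where "K = 1 + G + 2 * F"
  define E where "E t = (w t)\<^sup>2 + (w' t)\<^sup>2" for t
  have "E b * exp (- K * b) \<le> E a * exp (- K * a)"
  proof (rule DERIV_nonpos_imp_nonincreasing[OF \<open>a \<le> b\<close>], intro exI conjI)
    fix t assume "a \<le> t" "t \<le> b"
    then have t: "t \<in> {a..b}" by simp
    let ?E' = "2 * w t * w' t + 2 * w' t * (f t * w' t - g t * w t)"
    show "((\<lambda>t. E t * exp (- K * t)) has_real_derivative (?E' - K * E t) * exp (- K * t)) (at t)"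
      unfolding E_def
      by (rule derivative_eq_intros w[OF t] w'[OF t] refl)+ (simp add: algebra_simps power2_eq_square)
    have "?E' = 2 * (1 - g t) * (w t * w' t) + 2 * f t * (w' t)\<^sup>2"
      by (simp add: algebra_simps power2_eq_square)
    also have "2 * (1 - g t) * (w t * w' t) = (1 - g t) * (2 * (w t * w' t))" by simp
    also have "\<dots> \<le> \<bar>1 - g t\<bar> * (2 * \<bar>w t * w' t\<bar>)"
      using abs_ge_self[of "(1 - g t) * (2 * (w t * w' t))"] by (simp only: abs_mult abs_numeral)
    also have "\<dots> \<le> (1 + G) * E t"
    proof (intro mult_mono)
      show "2 * \<bar>w t * w' t\<bar> \<le> E t"
        using sum_squares_bound[of "\<bar>w t\<bar>" "\<bar>w' t\<bar>"] by (simp add: E_def abs_mult)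
    qed (use G[OF t] in auto)
    also have "2 * f t * (w' t)\<^sup>2 \<le> 2 * F * E t"
      using F[OF t] by (intro mult_mono[of "2 * f t"]) (auto simp: E_def)
    finally have "?E' \<le> K * E t" by (simp add: K_def algebra_simps)
    then show "(?E' - K * E t) * exp (- K * t) \<le> 0"
      by (simp add: mult_nonpos_nonneg)
  qed
  then have "E b \<le> 0" by (simp add: E_def init mult_le_0_iff)
  then show ?thesis
    by (simp add: E_def) (smt (verit) zero_le_power2 power2_eq_iff_nonneg zero_eq_power2)
qed

text \<open>Points before \<open>t0\<close> are reached by the reflection of time, which preserves
  the shape of the equation and changes the sign of \<open>f\<close>.\<close>

lemma linear_ode_zero:
  fixes w w' :: "real \<Rightarrow> real"
  assumes I: "is_interval I" and cont: "continuous_on I f" "continuous_on I g"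
    and w: "\<And>t. t \<in> I \<Longrightarrow> (w has_real_derivative w' t) (at t)"
    and w': "\<And>t. t \<in> I \<Longrightarrow> (w' has_real_derivative f t * w' t - g t * w t) (at t)"
    and init: "t0 \<in> I" "w t0 = 0" "w' t0 = 0" and t: "t \<in> I"
  shows "w t = 0"
proof (cases "t0 \<le> t")
  case True
  have sub: "{t0..t} \<subseteq> I"
    using I init(1) t unfolding is_interval_1 by (meson atLeastAtMost_iff subsetI)
  show ?thesis
    by (rule linear_ode_zero_forward[of t0 t f g w w'])
      (use True w w' init sub continuous_on_subset[OF cont(1) sub] continuous_on_subset[OF cont(2) sub]
        in \<open>simp_all add: subset_iff\<close>)
next
  case False
  have sub: "{t..t0} \<subseteq> I"
    using I init(1) t unfolding is_interval_1 by (meson atLeastAtMost_iff subsetI)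
  have minus: "- \<tau> \<in> {t..t0}" if "\<tau> \<in> {-t0..-t}" for \<tau> using that by auto
  have "(\<lambda>\<tau>. w (- \<tau>)) (- t) = 0"
  proof (rule linear_ode_zero_forward[of "-t0" "-t" "\<lambda>\<tau>. - f (- \<tau>)" "\<lambda>\<tau>. g (- \<tau>)" _ "\<lambda>\<tau>. - w' (- \<tau>)"])
    show "continuous_on {-t0..-t} (\<lambda>\<tau>. - f (- \<tau>))" "continuous_on {-t0..-t} (\<lambda>\<tau>. g (- \<tau>))"
      using minus by (auto intro!: continuous_intros continuous_on_compose2[OF cont(1)]
          continuous_on_compose2[OF cont(2)] subsetD[OF sub])
  next
    fix \<tau> assume "\<tau> \<in> {-t0..-t}"
    then have m: "- \<tau> \<in> I" using minus sub by blast
    show "((\<lambda>\<tau>. w (- \<tau>)) has_real_derivative - w' (- \<tau>)) (at \<tau>)"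
      using w[OF m] by (simp add: DERIV_mirror)
    show "((\<lambda>\<tau>. - w' (- \<tau>)) has_real_derivative - f (- \<tau>) * - w' (- \<tau>) - g (- \<tau>) * w (- \<tau>)) (at \<tau>)"
      using DERIV_minus[OF w'[OF m, unfolded DERIV_mirror]] by simp
  qed (use False init in auto)
  then show ?thesis by simp
qed

section \<open>Surfaces in a chart\<close>

lemma coordinate_chart_open_image:
  assumes "coordinate_chart A c" "open V" "V \<subseteq> fst c"
  shows "open (snd c ` V)"
proof -
  have hom: "homeomorphism (fst c) (snd c ` fst c) (snd c) (inv_into (fst c) (snd c))"
    and op: "open (snd c ` fst c)"
    using assms(1) by (auto simp: coordinate_chart_def)
  have "openin (top_of_set (snd c ` fst c)) (snd c ` V)"
    using assms(2,3) by (intro homeomorphism_imp_open_map[OF hom]) (auto simp: openin_open_eq openin_open)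
  then show ?thesis using op openin_open_trans by blast
qed

lemma coordinate_chart_inv:
  assumes "coordinate_chart A c"
  shows "q \<in> fst c \<Longrightarrow> inv_into (fst c) (snd c) (snd c q) = q"
  using assms by (auto simp: coordinate_chart_def homeomorphism_def)

text \<open>Read in \<open>d\<close>, the function is its expression in \<open>c\<close> preceded by
  the transition map from \<open>d\<close> to \<open>c\<close>; smooth maps are closed under
  composition.\<close>

lemma smooth_on_change_chart:
  fixes c d :: "('m::topological_space, 'n::finite) chart"
  assumes c: "coordinate_chart A c" and d: "coordinate_chart B d"
    and V: "open V" "V \<subseteq> fst c \<inter> fst d"
    and trans: "smooth_on (snd d ` (fst c \<inter> fst d)) (snd c \<circ> inv_into (fst d) (snd d))"
    and f: "smooth_on (snd c ` V) (f \<circ> inv_into (fst c) (snd c))"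
  shows "smooth_on (snd d ` V) (f \<circ> inv_into (fst d) (snd d))"
proof -
  have op: "open (snd d ` V)" using coordinate_chart_open_image[OF d V(1)] V(2) by auto
  have "smooth_on (snd d ` V) (\<lambda>x. (f \<circ> inv_into (fst c) (snd c)) ((snd c \<circ> inv_into (fst d) (snd d)) x))"
  proof (rule smooth_on_compose[OF op _ f])
    show "smooth_on (snd d ` V) (snd c \<circ> inv_into (fst d) (snd d))"
      by (rule smooth_on_subset[OF trans]) (use V in auto)
    show "(snd c \<circ> inv_into (fst d) (snd d)) ` snd d ` V \<subseteq> snd c ` V"
      using V coordinate_chart_inv[OF d] by auto
  qed
  then show ?thesis
    by (rule smooth_on_cong[THEN iffD1, OF op, rotated])
      (use V coordinate_chart_inv[OF d] coordinate_chart_inv[OF c] in \<open>auto simp: subset_iff\<close>)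
qed

lemma smooth_fun_subset: "smooth_fun A W f \<Longrightarrow> V \<subseteq> W \<Longrightarrow> smooth_fun A V f"
  unfolding smooth_fun_def by (meson Int_mono image_mono order_refl smooth_on_subset)

lemma smooth_vector_field_subset:
  "smooth_vector_field A W X \<Longrightarrow> V \<subseteq> W \<Longrightarrow> smooth_vector_field A V X"
  unfolding smooth_vector_field_def by (meson order_trans subsetD)

text \<open>The chart is any chart compatible with the atlas, not necessarily a member of it: the
  converse direction works inside the given straightening chart.\<close>

locale surface_chart =
  fixes A :: "('m::topological_space, 2) chart set" and U :: "'m set" and \<phi> :: "'m \<Rightarrow> real^2"
  assumes atlas: "smooth_atlas A" and chart: "coordinate_chart A (U, \<phi>)"
begin

definition \<psi> :: "real^2 \<Rightarrow> 'm" where "\<psi> = inv_into U \<phi>"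

lemma open_U: "open U" and open_\<phi>U: "open (\<phi> ` U)"
  using chart by (auto simp: coordinate_chart_def)

lemma \<psi>_\<phi>: "q \<in> U \<Longrightarrow> \<psi> (\<phi> q) = q"
  using coordinate_chart_inv[OF chart] by (simp add: \<psi>_def)

lemma \<phi>_\<psi>: "x \<in> \<phi> ` U \<Longrightarrow> \<phi> (\<psi> x) = x"
  using \<psi>_\<phi> by auto

lemma \<psi>_in: "x \<in> \<phi> ` U \<Longrightarrow> \<psi> x \<in> U"
  using \<psi>_\<phi> by auto

lemma continuous_\<phi>: "continuous_on U \<phi>" and continuous_\<psi>: "continuous_on (\<phi> ` U) \<psi>"
  using chart by (auto simp: coordinate_chart_def homeomorphism_def \<psi>_def)

lemma open_image: "open V \<Longrightarrow> V \<subseteq> U \<Longrightarrow> open (\<phi> ` V)"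
  using coordinate_chart_open_image[OF chart] by simp

lemma open_preimage: "open S \<Longrightarrow> open (U \<inter> \<phi> -` S)"
  using continuous_\<phi> open_U by (rule continuous_open_preimage)

text \<open>\<open>smooth_fun\<close> tests in every chart of the atlas. Covering \<open>V\<close>
  by domains of atlas charts and changing coordinates reduces the test to the single chart at
  hand.\<close>

lemma smooth_fun_iff:
  assumes V: "open V" "V \<subseteq> U"
  shows "smooth_fun A V f \<longleftrightarrow> smooth_on (\<phi> ` V) (\<lambda>x. f (\<psi> x))"
proof
  assume f: "smooth_fun A V f"
  have "smooth_on (\<phi> ` V) (f \<circ> \<psi>)"
  proof (rule smooth_on_locally)
    fix x assume "x \<in> \<phi> ` V"
    then obtain q where q: "q \<in> V" "x = \<phi> q" by auto
    obtain c where c: "c \<in> A" "q \<in> fst c"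
      using atlas unfolding smooth_atlas_def by blast
    have op: "open (V \<inter> fst c)"
      using V atlas c by (auto simp: smooth_atlas_def coordinate_chart_def)
    have "smooth_on (snd (U, \<phi>) ` (V \<inter> fst c)) (f \<circ> inv_into (fst (U, \<phi>)) (snd (U, \<phi>)))"
    proof (rule smooth_on_change_chart[OF _ chart op])
      show "coordinate_chart A c" using atlas c by (auto simp: smooth_atlas_def)
      show "smooth_on (snd (U, \<phi>) ` (fst c \<inter> fst (U, \<phi>))) (snd c \<circ> inv_into (fst (U, \<phi>)) (snd (U, \<phi>)))"
        using chart c by (auto simp: coordinate_chart_def smooth_compatible_def Int_commute)
      show "smooth_on (snd c ` (V \<inter> fst c)) (f \<circ> inv_into (fst c) (snd c))"
        using f c by (auto simp: smooth_fun_def Int_commute)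
    qed (use V in auto)
    then show "\<exists>T. open T \<and> x \<in> T \<and> smooth_on T (f \<circ> \<psi>)"
      using open_image[OF op] V(2) q c by (intro exI[of _ "\<phi> ` (V \<inter> fst c)"]) (auto simp: \<psi>_def)
  qed
  then show "smooth_on (\<phi> ` V) (\<lambda>x. f (\<psi> x))" by (simp add: o_def)
next
  assume f: "smooth_on (\<phi> ` V) (\<lambda>x. f (\<psi> x))"
  show "smooth_fun A V f"
    unfolding smooth_fun_def
  proof
    fix c assume c: "c \<in> A"
    have op: "open (fst c \<inter> V)"
      using V atlas c by (auto simp: smooth_atlas_def coordinate_chart_def)
    show "smooth_on (snd c ` (fst c \<inter> V)) (f \<circ> inv_into (fst c) (snd c))"
    proof (rule smooth_on_change_chart[OF chart _ op])
      show "coordinate_chart A c" using atlas c by (auto simp: smooth_atlas_def)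
      show "smooth_on (snd c ` (fst (U, \<phi>) \<inter> fst c)) (snd (U, \<phi>) \<circ> inv_into (fst c) (snd c))"
        using chart c by (auto simp: coordinate_chart_def smooth_compatible_def)
      show "smooth_on (snd (U, \<phi>) ` (fst c \<inter> V)) (f \<circ> inv_into (fst (U, \<phi>)) (snd (U, \<phi>)))"
        using f by (auto simp: \<psi>_def o_def intro: smooth_on_subset)
    qed (use V in auto)
  qed
qed

lemma smooth_nearE:
  assumes "smooth_near A p f" "p \<in> U"
  obtains V where "open V" "p \<in> V" "V \<subseteq> U" "smooth_on (\<phi> ` V) (\<lambda>x. f (\<psi> x))"
proof -
  obtain W where W: "open W" "p \<in> W" "smooth_fun A W f"
    using assms(1) by (auto simp: smooth_near_def)
  have "smooth_fun A (W \<inter> U) f" using W(3) by (rule smooth_fun_subset) simp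
  moreover have "open (W \<inter> U)" using W open_U by auto
  ultimately show ?thesis
    using that[of "W \<inter> U"] W(2) assms(2) smooth_fun_iff[of "W \<inter> U" f] by auto
qed

lemma smooth_nearI:
  "open V \<Longrightarrow> p \<in> V \<Longrightarrow> V \<subseteq> U \<Longrightarrow> smooth_on (\<phi> ` V) (\<lambda>x. f (\<psi> x)) \<Longrightarrow> smooth_near A p f"
  unfolding smooth_near_def using smooth_fun_iff by blast

lemma smooth_near_binop:
  assumes p: "p \<in> U" and fg: "smooth_near A p f" "smooth_near A p g"
    and op: "\<And>(S :: (real^2) set) F G. open S \<Longrightarrow> smooth_on S F \<Longrightarrow> smooth_on S G \<Longrightarrow> smooth_on S (\<lambda>x. h (F x) (G x))"
  shows "smooth_near A p (\<lambda>q. h (f q) (g q))"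
proof -
  obtain V where V: "open V" "p \<in> V" "V \<subseteq> U" "smooth_on (\<phi> ` V) (\<lambda>x. f (\<psi> x))"
    using smooth_nearE[OF fg(1) p] by blast
  obtain W where W: "open W" "p \<in> W" "W \<subseteq> U" "smooth_on (\<phi> ` W) (\<lambda>x. g (\<psi> x))"
    using smooth_nearE[OF fg(2) p] by blast
  have VW: "open (V \<inter> W)" "V \<inter> W \<subseteq> U" using V W by auto
  have "smooth_on (\<phi> ` (V \<inter> W)) (\<lambda>x. f (\<psi> x))" "smooth_on (\<phi> ` (V \<inter> W)) (\<lambda>x. g (\<psi> x))"
    using smooth_on_subset[OF V(4), of "\<phi> ` (V \<inter> W)"] smooth_on_subset[OF W(4), of "\<phi> ` (V \<inter> W)"] by auto
  from op[OF open_image[OF VW] this] show ?thesis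
    using V(2) W(2) by (intro smooth_nearI[OF VW(1) _ VW(2)]) auto
qed

lemma smooth_near_const: "p \<in> U \<Longrightarrow> smooth_near A p (\<lambda>q. c)"
  by (rule smooth_nearI[OF open_U]) (auto intro: smooth_intros open_\<phi>U)

lemma smooth_near_mult:
  "p \<in> U \<Longrightarrow> smooth_near A p f \<Longrightarrow> smooth_near A p g \<Longrightarrow> smooth_near A p (\<lambda>q. f q * g q)"
  by (rule smooth_near_binop) (auto intro: smooth_intros)

lemma smooth_near_lincomb:
  "p \<in> U \<Longrightarrow> smooth_near A p f \<Longrightarrow> smooth_near A p g \<Longrightarrow> smooth_near A p (\<lambda>q. a * f q + b * g q)"
  by (rule smooth_near_binop) (auto intro!: smooth_intros)

lemma smooth_fun_coordinate: "smooth_fun A U (\<lambda>q. \<phi> q $ i)"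
proof -
  have "smooth_on (\<phi> ` U) (\<lambda>x. \<phi> (\<psi> x) $ i)"
    using open_\<phi>U
    by (subst smooth_on_cong[OF open_\<phi>U, of _ "\<lambda>x. x $ i"]) (auto simp: \<phi>_\<psi> intro: smooth_intros)
  then show ?thesis by (simp add: smooth_fun_iff open_U)
qed

lemma smooth_near_coordinate: "p \<in> U \<Longrightarrow> smooth_near A p (\<lambda>q. \<phi> q $ i)"
  using smooth_fun_coordinate open_U by (auto simp: smooth_near_def)

lemma smooth_near_cong:
  assumes "p \<in> U" "open W" "p \<in> W" "\<And>q. q \<in> W \<Longrightarrow> f q = g q" "smooth_near A p f"
  shows "smooth_near A p g"
proof -
  obtain V where V: "open V" "p \<in> V" "V \<subseteq> U" "smooth_on (\<phi> ` V) (\<lambda>x. f (\<psi> x))"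
    using smooth_nearE[OF assms(5,1)] by blast
  have VW: "open (V \<inter> W)" "V \<inter> W \<subseteq> U" using V assms by auto
  have f: "smooth_on (\<phi> ` (V \<inter> W)) (\<lambda>x. f (\<psi> x))"
    using V(4) by (rule smooth_on_subset) auto
  have eq: "f (\<psi> x) = g (\<psi> x)" if "x \<in> \<phi> ` (V \<inter> W)" for x
    using that VW(2) assms(4) \<psi>_\<phi> by auto
  have "smooth_on (\<phi> ` (V \<inter> W)) (\<lambda>x. g (\<psi> x))"
    by (rule iffD1[OF smooth_on_cong[OF open_image[OF VW] eq] f])
  then show ?thesis
    using VW V assms(3) by (intro smooth_nearI[of "V \<inter> W"]) auto
qed

subsection \<open>Tangent vectors\<close>

context
  fixes p v assumes p: "p \<in> U" and v: "v \<in> tangent_space A p"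
begin

lemma tangent_lincomb:
  "smooth_near A p f \<Longrightarrow> smooth_near A p g \<Longrightarrow> v (\<lambda>q. a * f q + b * g q) = a * v f + b * v g"
  using v by (simp add: tangent_space_def)

lemma tangent_mult:
  "smooth_near A p f \<Longrightarrow> smooth_near A p g \<Longrightarrow> v (\<lambda>q. f q * g q) = f p * v g + g p * v f"
  using v by (simp add: tangent_space_def)

lemma tangent_nonsmooth: "\<not> smooth_near A p f \<Longrightarrow> v f = 0"
  using v by (simp add: tangent_space_def)

lemma tangent_const: "v (\<lambda>q. c) = 0"
proof -
  have "v (\<lambda>q. 1) = 0"
    using tangent_mult[OF smooth_near_const[OF p, of 1] smooth_near_const[OF p, of 1]] by simp
  then show ?thesis
    using tangent_lincomb[OF smooth_near_const[OF p, of 1] smooth_near_const[OF p, of 1], of c 0] by simp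
qed

lemma tangent_cong:
  assumes W: "open W" "p \<in> W" "\<And>q. q \<in> W \<Longrightarrow> f q = g q"
  shows "v f = v g"
proof (cases "smooth_near A p f")
  case f: True
  then have g: "smooth_near A p g" using smooth_near_cong[where f = f and g = g, OF p W] by blast
  define h where "h q = (if q \<in> W then 0 else 1 :: real)" for q
  have h: "smooth_near A p h"
    by (rule smooth_near_cong[OF p W(1,2) _ smooth_near_const[OF p, of 0]]) (simp add: h_def)
  have d: "smooth_near A p (\<lambda>q. 1 * f q + (-1) * g q)"
    by (rule smooth_near_lincomb[OF p f g])
  have "(\<lambda>q. 1 * f q + (-1) * g q) = (\<lambda>q. (1 * f q + (-1) * g q) * h q)"
    using W(3) by (auto simp: h_def)
  then have "v (\<lambda>q. 1 * f q + (-1) * g q) = v (\<lambda>q. (1 * f q + (-1) * g q) * h q)" by simp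
  also have "\<dots> = 0"
    using W(2,3) by (subst tangent_mult[OF d h]) (simp add: h_def)
  finally show ?thesis
    using tangent_lincomb[OF f g, of 1 "-1"] by simp
next
  case False
  then have "\<not> smooth_near A p g" using smooth_near_cong[OF p W(1,2), of g f] W(3) by auto
  then show ?thesis using False tangent_nonsmooth by simp
qed

end

text \<open>The value zero on functions that are not smooth near \<open>p\<close> is the
  normalisation demanded by \<open>tangent_space\<close>, so that equality of tangent vectors is
  equality of HOL functions.\<close>

definition tvec :: "'m \<Rightarrow> real^2 \<Rightarrow> 'm tangent" where
  "tvec p v f = (if smooth_near A p f then frechet_derivative (\<lambda>x. f (\<psi> x)) (at (\<phi> p)) v else 0)"

definition coords :: "'m tangent \<Rightarrow> real^2" where
  "coords v = (\<chi> i. v (\<lambda>q. \<phi> q $ i))"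

lemma smooth_near_has_derivative:
  assumes "smooth_near A p f" "p \<in> U"
  shows "((\<lambda>x. f (\<psi> x)) has_derivative frechet_derivative (\<lambda>x. f (\<psi> x)) (at (\<phi> p))) (at (\<phi> p))"
proof -
  obtain V where V: "open V" "p \<in> V" "V \<subseteq> U" "smooth_on (\<phi> ` V) (\<lambda>x. f (\<psi> x))"
    using smooth_nearE[OF assms] by blast
  then show ?thesis by (intro smooth_on_has_derivative[OF V(4)]) auto
qed

lemma tvec_in: "p \<in> U \<Longrightarrow> tvec p v \<in> tangent_space A p"
  unfolding tangent_space_def mem_Collect_eq
proof (intro conjI allI impI)
  assume p: "p \<in> U"
  fix f g a b assume "smooth_near A p f \<and> smooth_near A p g"
  then have f: "smooth_near A p f" and g: "smooth_near A p g" by auto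
  note df = smooth_near_has_derivative[OF f p] and dg = smooth_near_has_derivative[OF g p]
  have "((\<lambda>x. a * f (\<psi> x) + b * g (\<psi> x)) has_derivative
     (\<lambda>v. a * frechet_derivative (\<lambda>x. f (\<psi> x)) (at (\<phi> p)) v
        + b * frechet_derivative (\<lambda>x. g (\<psi> x)) (at (\<phi> p)) v)) (at (\<phi> p))"
    by (intro has_derivative_add has_derivative_mult_right df dg)
  from frechet_derivative_at[OF this, symmetric]
  show "tvec p v (\<lambda>q. a * f q + b * g q) = a * tvec p v f + b * tvec p v g"
    using f g smooth_near_lincomb[OF p f g] by (simp add: tvec_def)
  have "((\<lambda>x. f (\<psi> x) * g (\<psi> x)) has_derivative
     (\<lambda>v. f (\<psi> (\<phi> p)) * frechet_derivative (\<lambda>x. g (\<psi> x)) (at (\<phi> p)) v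
        + frechet_derivative (\<lambda>x. f (\<psi> x)) (at (\<phi> p)) v * g (\<psi> (\<phi> p)))) (at (\<phi> p))"
    by (intro has_derivative_mult df dg)
  from frechet_derivative_at[OF this, symmetric]
  show "tvec p v (\<lambda>q. f q * g q) = f p * tvec p v g + g p * tvec p v f"
    using f g smooth_near_mult[OF p f g] by (simp add: tvec_def \<psi>_\<phi>[OF p])
qed (simp add: tvec_def)

lemma coords_tvec [simp]: "p \<in> U \<Longrightarrow> coords (tvec p v) = v"
proof -
  assume p: "p \<in> U"
  have "((\<lambda>x. \<phi> (\<psi> x) $ i) has_derivative (\<lambda>v. v $ i)) (at (\<phi> p))" for i
  proof (rule has_derivative_transform_within_open[OF _ open_\<phi>U])
    show "((\<lambda>x. x $ i) has_derivative (\<lambda>v. v $ i)) (at (\<phi> p))"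
      by (rule bounded_linear_imp_has_derivative) (rule bounded_linear_vec_nth)
  qed (use p \<phi>_\<psi> in auto)
  from frechet_derivative_at[OF this, symmetric] show ?thesis
    using p by (simp add: coords_def tvec_def smooth_near_coordinate vec_eq_iff)
qed

text \<open>Hadamard's lemma writes \<open>f\<close> near \<open>p\<close> as its value at
  \<open>p\<close> plus the sum of \<open>(x i) * (h i)\<close>, where \<open>x i\<close> vanishes
  at \<open>p\<close>. A derivation kills the constant, and the product rule leaves
  \<open>h i p\<close>, a partial derivative of \<open>f\<close>, times the value of
  \<open>v\<close> on the i-th coordinate.\<close>

lemma tangent_eq_tvec:
  assumes p: "p \<in> U" and v: "v \<in> tangent_space A p"
  shows "v = tvec p (coords v)"
proof
  fix f show "v f = tvec p (coords v) f"
  proof (cases "smooth_near A p f")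
    case f: True
    obtain V where V: "open V" "p \<in> V" "V \<subseteq> U" "smooth_on (\<phi> ` V) (\<lambda>x. f (\<psi> x))"
      using smooth_nearE[OF f p] by blast
    obtain d where d: "d > 0" "ball (\<phi> p) d \<subseteq> \<phi> ` V"
      using open_image[OF V(1,3)] V(2) open_contains_ball by blast
    let ?B = "ball (\<phi> p) d" and ?F = "\<lambda>x. f (\<psi> x)"
    obtain g where g: "\<And>i. smooth_on ?B (g i)"
      and eq: "\<And>x. x \<in> ?B \<Longrightarrow> ?F x = ?F (\<phi> p) + (\<Sum>i\<in>UNIV. (x $ i - \<phi> p $ i) * g i x)"
      and g0: "\<And>i. g i (\<phi> p) = frechet_derivative ?F (at (\<phi> p)) (axis i 1)"
      using hadamard[of ?B "\<phi> p" ?F] d smooth_on_subset[OF V(4) d(2)] by auto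
    define W where "W = U \<inter> \<phi> -` ?B"
    have W: "open W" "p \<in> W" using open_preimage p d by (auto simp: W_def)
    have \<phi>W: "\<phi> ` W \<subseteq> ?B" by (auto simp: W_def)
    define h where "h i q = g i (\<phi> q)" for i q
    have h: "smooth_near A p (h i)" for i
    proof (rule smooth_nearI[OF W])
      show "W \<subseteq> U" by (auto simp: W_def)
      have "smooth_on (\<phi> ` W) (g i)" using g smooth_on_subset \<phi>W by blast
      then show "smooth_on (\<phi> ` W) (\<lambda>x. h i (\<psi> x))"
        by (rule smooth_on_cong[THEN iffD1, rotated 2])
          (auto simp: h_def \<psi>_\<phi> W_def intro!: open_image open_preimage)
    qed
    note c = smooth_near_coordinate[OF p] smooth_near_const[OF p]
    \<comment> \<open>The explicit coefficients 1 and -1 give the function the literal shape of the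
      linear combinations in the definition of \<open>tangent_space\<close>.\<close>
    define x where "x i q = 1 * \<phi> q $ i + (-1) * \<phi> p $ i" for i and q
    have x: "smooth_near A p (x i)" for i
      unfolding x_def by (rule smooth_near_lincomb[OF p c])
    have vx: "v (x i) = coords v $ i" for i
      unfolding x_def using tangent_lincomb[OF p v c, of 1 i "-1" "\<phi> p $ i"] tangent_const[OF p v, of "\<phi> p $ i"]
      by (simp add: coords_def)
    have vxh: "v (\<lambda>q. x i q * h i q) = frechet_derivative ?F (at (\<phi> p)) (axis i 1) * coords v $ i" for i
      using tangent_mult[OF p v x[of i] h[of i]] g0 by (simp add: vx x_def h_def)
    have "v f = v (\<lambda>q. 1 * (1 * (x 1 q * h 1 q) + 1 * (x 2 q * h 2 q)) + 1 * f p)"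
    proof (rule tangent_cong[OF p v W])
      fix q assume "q \<in> W"
      then have q: "q \<in> U" "\<phi> q \<in> ?B" by (auto simp: W_def)
      show "f q = 1 * (1 * (x 1 q * h 1 q) + 1 * (x 2 q * h 2 q)) + 1 * f p"
        using eq[OF q(2)] by (simp add: \<psi>_\<phi> q p sum_2 x_def h_def)
    qed
    also have "\<dots> = v (\<lambda>q. x 1 q * h 1 q) + v (\<lambda>q. x 2 q * h 2 q)"
    proof -
      have xh: "smooth_near A p (\<lambda>q. x i q * h i q)" for i
        by (rule smooth_near_mult[OF p x h])
      show ?thesis
        by (subst tangent_lincomb[OF p v smooth_near_lincomb[OF p xh xh] c(2)], subst tangent_lincomb[OF p v xh xh])
          (simp add: tangent_const[OF p v])
    qed
    also have "\<dots> = tvec p (coords v) f"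
      using f linear_vec2_expand[OF has_derivative_linear[OF smooth_near_has_derivative[OF f p]], of "coords v"]
      by (simp add: vxh tvec_def)
    finally show ?thesis .
  qed (use v in \<open>simp add: tangent_space_def tvec_def\<close>)
qed

lemma tangent_eqI:
  "p \<in> U \<Longrightarrow> v \<in> tangent_space A p \<Longrightarrow> w \<in> tangent_space A p \<Longrightarrow> coords v = coords w \<Longrightarrow> v = w"
  using tangent_eq_tvec by metis

lemma tangent_apply:
  assumes "p \<in> U" "v \<in> tangent_space A p" "smooth_near A p f"
  shows "v f = frechet_derivative (\<lambda>x. f (\<psi> x)) (at (\<phi> p)) (coords v)"
  using fun_cong[OF tangent_eq_tvec[OF assms(1,2)], of f] assms(3) by (simp add: tvec_def)

lemma tvec_lincomb:
  assumes "p \<in> U"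
  shows "tvec p (a *\<^sub>R v + b *\<^sub>R w) = a *\<^sub>R tvec p v + b *\<^sub>R tvec p w"
proof
  fix f
  have "linear (frechet_derivative (\<lambda>x. f (\<psi> x)) (at (\<phi> p)))" if "smooth_near A p f"
    using smooth_near_has_derivative[OF that assms] has_derivative_linear by blast
  then show "tvec p (a *\<^sub>R v + b *\<^sub>R w) f = (a *\<^sub>R tvec p v + b *\<^sub>R tvec p w) f"
    by (auto simp: tvec_def scaleR_fun_def linear_add linear_scale)
qed

lemma coords_lincomb: "coords (a *\<^sub>R v + b *\<^sub>R w) = a *\<^sub>R coords v + b *\<^sub>R coords w"
  by (simp add: coords_def vec_eq_iff scaleR_fun_def)

lemma coords_add: "coords (v + w) = coords v + coords w"
  and coords_diff: "coords (v - w) = coords v - coords w"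
  and coords_scaleR: "coords (a *\<^sub>R v) = a *\<^sub>R coords v"
  by (simp_all add: coords_def vec_eq_iff scaleR_fun_def)

lemma tangent_space_lincomb:
  assumes "p \<in> U" "v \<in> tangent_space A p" "w \<in> tangent_space A p"
  shows "a *\<^sub>R v + b *\<^sub>R w \<in> tangent_space A p"
  using tvec_in[OF assms(1), of "a *\<^sub>R coords v + b *\<^sub>R coords w"] tvec_lincomb[OF assms(1)]
    tangent_eq_tvec[OF assms(1,2)] tangent_eq_tvec[OF assms(1,3)] by metis

lemma tangent_space_add: "p \<in> U \<Longrightarrow> v \<in> tangent_space A p \<Longrightarrow> w \<in> tangent_space A p \<Longrightarrow> v + w \<in> tangent_space A p"
  and tangent_space_diff: "p \<in> U \<Longrightarrow> v \<in> tangent_space A p \<Longrightarrow> w \<in> tangent_space A p \<Longrightarrow> v - w \<in> tangent_space A p"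
  and tangent_space_scaleR: "p \<in> U \<Longrightarrow> v \<in> tangent_space A p \<Longrightarrow> a *\<^sub>R v \<in> tangent_space A p"
  using tangent_space_lincomb[of p v w 1 1] tangent_space_lincomb[of p v w 1 "-1"]
    tangent_space_lincomb[of p v v a 0] by simp_all

subsection \<open>Vector fields\<close>

definition rep :: "'m vector_field \<Rightarrow> real^2 \<Rightarrow> real^2" where
  "rep X x = coords (X (\<psi> x))"

lemma rep_\<phi>: "p \<in> U \<Longrightarrow> rep X (\<phi> p) = coords (X p)"
  by (simp add: rep_def \<psi>_\<phi>)

text \<open>One direction applies the field to the coordinate functions. The other uses that
  \<open>X\<close> applied to \<open>f\<close> is the sum of the components of \<open>X\<close>
  times the partial derivatives of \<open>f\<close>.\<close>

lemma smooth_vector_field_iff: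
  assumes W: "open W" "W \<subseteq> U"
  shows "smooth_vector_field A W X \<longleftrightarrow> (\<forall>p\<in>W. X p \<in> tangent_space A p) \<and> smooth_on (\<phi> ` W) (rep X)"
proof (intro iffI conjI)
  assume X: "smooth_vector_field A W X"
  then show "\<forall>p\<in>W. X p \<in> tangent_space A p" by (simp add: smooth_vector_field_def)
  have "smooth_fun A W (\<lambda>p. X p (\<lambda>q. \<phi> q $ i))" for i
    using X smooth_fun_subset[OF smooth_fun_coordinate W(2)] W(1) by (auto simp: smooth_vector_field_def)
  then show "smooth_on (\<phi> ` W) (rep X)"
    using W by (subst smooth_on_vec_iff[OF open_image[OF W]]) (auto simp: rep_def coords_def smooth_fun_iff)
next
  assume X: "(\<forall>p\<in>W. X p \<in> tangent_space A p) \<and> smooth_on (\<phi> ` W) (rep X)"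
  show "smooth_vector_field A W X"
    unfolding smooth_vector_field_def
  proof (intro conjI allI impI)
    fix V f assume "open V \<and> V \<subseteq> W \<and> smooth_fun A V f"
    then have V: "open V" "V \<subseteq> W" "V \<subseteq> U" and f: "smooth_fun A V f" using W by auto
    let ?F = "\<lambda>x. f (\<psi> x)"
    have F: "smooth_on (\<phi> ` V) ?F" using f V by (simp add: smooth_fun_iff)
    have XV: "smooth_on (\<phi> ` V) (rep X)" using X V smooth_on_subset by blast
    have op: "open (\<phi> ` V)" by (rule open_image[OF V(1,3)])
    have rhs: "smooth_on (\<phi> ` V) (\<lambda>x. rep X x $ 1 *\<^sub>R frechet_derivative ?F (at x) (axis 1 1)
       + rep X x $ 2 *\<^sub>R frechet_derivative ?F (at x) (axis 2 1))"
      by (intro smooth_intros smooth_on_frechet_derivative F XV op)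
    have eq: "X (\<psi> x) f = rep X x $ 1 *\<^sub>R frechet_derivative ?F (at x) (axis 1 1)
       + rep X x $ 2 *\<^sub>R frechet_derivative ?F (at x) (axis 2 1)" if x: "x \<in> \<phi> ` V" for x
    proof -
      obtain p where p: "p \<in> V" "x = \<phi> p" using x by auto
      then have pU: "p \<in> U" and near: "smooth_near A p f"
        using V f by (auto simp: smooth_near_def)
      have "X p f = frechet_derivative ?F (at (\<phi> p)) (coords (X p))"
        using X p V pU near by (intro tangent_apply) auto
      then show ?thesis
        using linear_vec2_expand[OF has_derivative_linear[OF smooth_near_has_derivative[OF near pU]], of "coords (X p)"]
        by (simp add: p rep_def \<psi>_\<phi>[OF pU])
    qed
    have "smooth_on (\<phi> ` V) (\<lambda>x. X (\<psi> x) f)"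
      by (rule iffD2[OF smooth_on_cong[OF op eq] rhs])
    then show "smooth_fun A V (\<lambda>p. X p f)"
      using V by (simp add: smooth_fun_iff)
  qed (use X in auto)
qed

lemma smooth_vector_fieldD:
  assumes "open W" "W \<subseteq> U" "smooth_vector_field A W X"
  shows "p \<in> W \<Longrightarrow> X p \<in> tangent_space A p" "smooth_on (\<phi> ` W) (rep X)"
  using assms smooth_vector_field_iff by auto

lemma rep_has_derivative:
  assumes "open W" "W \<subseteq> U" "smooth_vector_field A W X" "p \<in> W"
  shows "(rep X has_derivative frechet_derivative (rep X) (at (\<phi> p))) (at (\<phi> p))"
  using smooth_on_has_derivative[OF smooth_vector_fieldD(2)[OF assms(1-3)]] assms(4) by blast

lemma tvec_field:
  assumes "open W" "W \<subseteq> U" "smooth_on (\<phi> ` W) \<xi>"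
  shows "smooth_vector_field A W (\<lambda>q. tvec q (\<xi> (\<phi> q)))"
    "x \<in> \<phi> ` W \<Longrightarrow> rep (\<lambda>q. tvec q (\<xi> (\<phi> q))) x = \<xi> x"
proof -
  show rep: "rep (\<lambda>q. tvec q (\<xi> (\<phi> q))) x = \<xi> x" if "x \<in> \<phi> ` W" for x
    using that assms(2) by (auto simp: rep_def \<psi>_\<phi> subset_iff)
  have "smooth_on (\<phi> ` W) (rep (\<lambda>q. tvec q (\<xi> (\<phi> q))))"
    by (rule iffD2[OF smooth_on_cong[OF open_image[OF assms(1,2)] rep] assms(3)])
  then show "smooth_vector_field A W (\<lambda>q. tvec q (\<xi> (\<phi> q)))"
    using assms tvec_in by (auto simp: smooth_vector_field_iff)
qed

text \<open>The field with constant components \<open>coords v\<close> is a witness, so the choice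
  in \<open>extend_tangent\<close> has the properties asked for.\<close>

lemma extend_tangentE:
  assumes "p \<in> U" "v \<in> tangent_space A p"
  obtains W where "open W" "p \<in> W" "W \<subseteq> U" "smooth_vector_field A W (extend_tangent A p v)"
    "extend_tangent A p v p = v"
proof -
  have "smooth_on (\<phi> ` U) (\<lambda>_. coords v)"
    by (rule smooth_on_const[OF open_\<phi>U])
  from tvec_field(1)[OF open_U order_refl this]
  have "\<exists>X W. open W \<and> p \<in> W \<and> smooth_vector_field A W X \<and> X p = v"
    using assms tangent_eq_tvec[OF assms] open_U by (intro exI[of _ "\<lambda>q. tvec q (coords v)"] exI[of _ U]) auto
  from someI_ex[OF this] obtain W where W: "open W" "p \<in> W"
    "smooth_vector_field A W (extend_tangent A p v)" "extend_tangent A p v p = v"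
    unfolding extend_tangent_def by blast
  then show ?thesis
    using that[of "W \<inter> U"] assms(1) open_U smooth_vector_field_subset[OF W(3), of "W \<inter> U"] by blast
qed

end

section \<open>Connections in a chart\<close>

locale surface_connection = surface_chart +
  fixes nabla :: "'a nabla"
  assumes connection: "connection A nabla" and torsion: "torsion_free A nabla"
begin

definition frame :: "2 \<Rightarrow> 'a vector_field" where
  "frame i q = tvec q (axis i 1)"

lemma frame_in: "p \<in> U \<Longrightarrow> frame i p \<in> tangent_space A p"
  by (simp add: frame_def tvec_in)

lemma coords_frame: "p \<in> U \<Longrightarrow> coords (frame i p) = axis i 1"
  by (simp add: frame_def)

lemma smooth_frame: "smooth_vector_field A U (frame i)"
  using tvec_field(1)[OF open_U order_refl smooth_on_const[OF open_\<phi>U]] by (simp add: frame_def[abs_def])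

lemma tangent_eq_frame:
  assumes "p \<in> U" "v \<in> tangent_space A p"
  shows "v = (coords v $ 1) *\<^sub>R frame 1 p + (coords v $ 2) *\<^sub>R frame 2 p"
  using tangent_eq_tvec[OF assms] tvec_lincomb[OF assms(1)] vec2_eq_axis_sum[of "coords v"]
  by (metis frame_def)

text \<open>The Christoffel symbols with the upper index as vector component:
  \<open>\<Gamma> i j x $ c\<close> is \<open>\<Gamma>\<^sup>c\<^sub>i\<^sub>j\<close>. The first
  index is the direction of differentiation.\<close>

definition \<Gamma> :: "2 \<Rightarrow> 2 \<Rightarrow> real^2 \<Rightarrow> real^2" where
  "\<Gamma> i j x = coords (nabla (frame j) (\<psi> x) (frame i (\<psi> x)))"

text \<open>The bilinear map with matrix \<open>\<Gamma>\<close>, spelled out in components so that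
  identities in dimension two become polynomial identities for the simplifier.\<close>

definition G :: "real^2 \<Rightarrow> real^2 \<Rightarrow> real^2 \<Rightarrow> real^2" where
  "G x u v = (u $ 1 * v $ 1) *\<^sub>R \<Gamma> 1 1 x + (u $ 1 * v $ 2) *\<^sub>R \<Gamma> 1 2 x
           + (u $ 2 * v $ 1) *\<^sub>R \<Gamma> 2 1 x + (u $ 2 * v $ 2) *\<^sub>R \<Gamma> 2 2 x"

context
  fixes W X assumes W: "open W" "W \<subseteq> U" and X: "smooth_vector_field A W X"
begin

lemma nabla_in: "p \<in> W \<Longrightarrow> u \<in> tangent_space A p \<Longrightarrow> nabla X p u \<in> tangent_space A p"
  using connection W X unfolding connection_def by meson

lemma nabla_lincomb:
  "p \<in> W \<Longrightarrow> u \<in> tangent_space A p \<Longrightarrow> v \<in> tangent_space A p \<Longrightarrow>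
    nabla X p (a *\<^sub>R u + b *\<^sub>R v) = a *\<^sub>R nabla X p u + b *\<^sub>R nabla X p v"
  using connection W X unfolding connection_def by meson

lemma nabla_smooth: "smooth_vector_field A W Y \<Longrightarrow> smooth_vector_field A W (\<lambda>p. nabla X p (Y p))"
  using connection W X unfolding connection_def by meson

lemma nabla_add:
  "smooth_vector_field A W Y \<Longrightarrow> p \<in> W \<Longrightarrow> u \<in> tangent_space A p \<Longrightarrow> nabla (X + Y) p u = nabla X p u + nabla Y p u"
  using connection W X unfolding connection_def by meson

lemma nabla_scale:
  "smooth_fun A W f \<Longrightarrow> p \<in> W \<Longrightarrow> u \<in> tangent_space A p \<Longrightarrow>
    nabla (\<lambda>q. f q *\<^sub>R X q) p u = u f *\<^sub>R X p + f p *\<^sub>R nabla X p u"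
  using connection W X unfolding connection_def by meson

lemma nabla_cong:
  "smooth_vector_field A W Y \<Longrightarrow> (\<And>q. q \<in> W \<Longrightarrow> X q = Y q) \<Longrightarrow> p \<in> W \<Longrightarrow> u \<in> tangent_space A p \<Longrightarrow>
    nabla X p u = nabla Y p u"
  using connection W X unfolding connection_def by meson

end

lemma smooth_\<Gamma>: "smooth_on (\<phi> ` U) (\<Gamma> i j)"
  using smooth_vector_fieldD(2)[OF open_U order_refl nabla_smooth[OF open_U order_refl smooth_frame smooth_frame]]
  by (simp add: rep_def[abs_def] \<Gamma>_def[abs_def])

lemma nabla_frame:
  assumes p: "p \<in> U" and u: "u \<in> tangent_space A p"
  shows "coords (nabla (frame j) p u) = (coords u $ 1) *\<^sub>R \<Gamma> 1 j (\<phi> p) + (coords u $ 2) *\<^sub>R \<Gamma> 2 j (\<phi> p)"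
proof -
  have "nabla (frame j) p u = (coords u $ 1) *\<^sub>R nabla (frame j) p (frame 1 p)
      + (coords u $ 2) *\<^sub>R nabla (frame j) p (frame 2 p)"
    by (subst (1) tangent_eq_frame[OF p u])
      (rule nabla_lincomb[OF open_U order_refl smooth_frame p frame_in[OF p] frame_in[OF p]])
  then show ?thesis by (simp add: coords_lincomb \<Gamma>_def \<psi>_\<phi>[OF p])
qed

text \<open>On \<open>W\<close> the field is the sum of its components times the coordinate frame.
  The Leibniz rule differentiates the components, and the frame contributes the Christoffel symbols;
  locality of \<open>nabla\<close> permits the decomposition on \<open>W\<close> only.\<close>

lemma coords_nabla:
  assumes W: "open W" "W \<subseteq> U" and X: "smooth_vector_field A W X"
    and p: "p \<in> W" and u: "u \<in> tangent_space A p"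
  shows "coords (nabla X p u) = frechet_derivative (rep X) (at (\<phi> p)) (coords u) + G (\<phi> p) (coords u) (coords (X p))"
proof -
  have pU: "p \<in> U" using p W by auto
  define f where "f i q = coords (X q) $ i" for i q
  have f: "smooth_fun A W (f i)" for i
    using smooth_on_nth[OF open_image[OF W] smooth_vector_fieldD(2)[OF W X], of i]
    by (simp add: smooth_fun_iff[OF W] f_def rep_def)
  have frame: "smooth_vector_field A W (frame i)" for i
    by (rule smooth_vector_field_subset[OF smooth_frame W(2)])
  define Y where "Y i q = f i q *\<^sub>R frame i q" for i q
  have Y: "smooth_vector_field A W (Y i)" for i
    unfolding smooth_vector_field_iff[OF W]
  proof
    show "\<forall>p\<in>W. Y i p \<in> tangent_space A p"
      using W(2) by (auto simp: Y_def intro!: tangent_space_scaleR frame_in)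
    have eq: "rep (Y i) x = (rep X x $ i) *\<^sub>R axis i 1" if "x \<in> \<phi> ` W" for x
      using that W(2) by (auto simp: rep_def Y_def coords_scaleR f_def \<psi>_\<phi> subset_iff coords_frame)
    have rhs: "smooth_on (\<phi> ` W) (\<lambda>x. (rep X x $ i) *\<^sub>R axis i (1 :: real))"
      using smooth_vector_fieldD(2)[OF W X] open_image[OF W] by (intro smooth_intros)
    show "smooth_on (\<phi> ` W) (rep (Y i))"
      by (rule iffD2[OF smooth_on_cong[OF open_image[OF W] eq] rhs])
  qed
  have X_eq: "X q = (Y 1 + Y 2) q" if "q \<in> W" for q
    using tangent_eq_frame[of q "X q"] smooth_vector_fieldD(1)[OF W X that] that W(2)
    by (auto simp: Y_def f_def)
  have Y12: "smooth_vector_field A W (Y 1 + Y 2)"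
  proof -
    have "rep (Y 1 + Y 2) = (\<lambda>x. rep (Y 1) x + rep (Y 2) x)"
      by (simp add: rep_def fun_eq_iff coords_add)
    then show ?thesis
      using Y[of 1] Y[of 2] W open_image[OF W]
      by (auto simp: smooth_vector_field_iff intro!: smooth_on_add tangent_space_add)
  qed
  have "nabla X p u = nabla (Y 1 + Y 2) p u"
    by (rule nabla_cong[OF W X Y12 X_eq p u])
  also have "\<dots> = nabla (Y 1) p u + nabla (Y 2) p u"
    by (rule nabla_add[OF W Y Y p u])
  finally have nabla_eq: "nabla X p u = nabla (Y 1) p u + nabla (Y 2) p u" .
  have D: "u (f i) = frechet_derivative (rep X) (at (\<phi> p)) (coords u) $ i" for i
  proof -
    have "smooth_near A p (f i)" using f p W by (auto simp: smooth_near_def)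
    then have "u (f i) = frechet_derivative (\<lambda>x. f i (\<psi> x)) (at (\<phi> p)) (coords u)"
      by (rule tangent_apply[OF pU u])
    also have "(\<lambda>x. f i (\<psi> x)) = (\<lambda>x. rep X x $ i)" by (simp add: f_def rep_def)
    also have "frechet_derivative (\<lambda>x. rep X x $ i) (at (\<phi> p)) (coords u)
       = frechet_derivative (rep X) (at (\<phi> p)) (coords u) $ i"
      using rep_has_derivative[OF W X p]
      by (intro frechet_derivative_nth[symmetric]) (auto simp: differentiable_def)
    finally show ?thesis .
  qed
  have "coords (nabla (Y i) p u) = (frechet_derivative (rep X) (at (\<phi> p)) (coords u) $ i) *\<^sub>R axis i 1
     + (coords (X p) $ i) *\<^sub>R ((coords u $ 1) *\<^sub>R \<Gamma> 1 i (\<phi> p) + (coords u $ 2) *\<^sub>R \<Gamma> 2 i (\<phi> p))" for i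
  proof -
    have "nabla (Y i) p u = u (f i) *\<^sub>R frame i p + f i p *\<^sub>R nabla (frame i) p u"
      unfolding Y_def[abs_def] by (rule nabla_scale[OF W frame f p u])
    then show ?thesis
      by (simp add: coords_lincomb D coords_frame[OF pU] nabla_frame[OF pU u] f_def)
  qed
  then show ?thesis
    unfolding nabla_eq coords_add G_def
    by (subst (2) vec2_eq_axis_sum) (simp add: algebra_simps)
qed

text \<open>The bracket of coordinate fields vanishes because each of them has constant components,
  so absence of torsion is the symmetry in the lower indices.\<close>

lemma \<Gamma>_symmetric:
  assumes "x \<in> \<phi> ` U"
  shows "\<Gamma> i j x = \<Gamma> j i x"
proof -
  obtain p where p: "p \<in> U" "x = \<phi> p" using assms by auto
  have frame_const: "frame i q (\<lambda>q. \<phi> q $ k) = axis i 1 $ k" if "q \<in> U" for i q k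
    using arg_cong[OF coords_frame[OF that, of i], of "\<lambda>v. v $ k"] by (simp add: coords_def)
  have "frame i p (\<lambda>q. frame j q (\<lambda>q. \<phi> q $ k)) = 0" for i j k
    using tangent_cong[OF p(1) frame_in[OF p(1)] open_U p(1), of "\<lambda>q. frame j q (\<lambda>q. \<phi> q $ k)" "\<lambda>_. axis j 1 $ k" i]
    by (simp add: frame_const tangent_const[OF p(1) frame_in[OF p(1)]])
  then have "coords (lie_bracket A (frame i) (frame j) p) = 0"
    by (simp add: vec_eq_iff coords_def lie_bracket_def)
  moreover have "nabla (frame j) p (frame i p) - nabla (frame i) p (frame j p) = lie_bracket A (frame i) (frame j) p"
    using torsion open_U smooth_frame p(1) by (auto simp: torsion_free_def)
  ultimately have "coords (nabla (frame j) p (frame i p)) - coords (nabla (frame i) p (frame j p)) = 0"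
    by (metis coords_diff)
  then show ?thesis by (simp add: \<Gamma>_def p \<psi>_\<phi>)
qed

lemma G_symmetric: "x \<in> \<phi> ` U \<Longrightarrow> G x u v = G x v u"
  by (simp add: G_def \<Gamma>_symmetric[of x 2 1] algebra_simps)

lemma G_add_left: "G x (u + u') v = G x u v + G x u' v"
  and G_add_right: "G x u (v + v') = G x u v + G x u v'"
  and G_diff_left: "G x (u - u') v = G x u v - G x u' v"
  and G_diff_right: "G x u (v - v') = G x u v - G x u v'"
  by (simp_all add: G_def algebra_simps)

section \<open>Curvature in coordinates\<close>

definition d\<Gamma> :: "2 \<Rightarrow> 2 \<Rightarrow> 2 \<Rightarrow> real^2 \<Rightarrow> real^2" where
  "d\<Gamma> k i j x = frechet_derivative (\<Gamma> i j) (at x) (axis k 1)"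

definition dG :: "real^2 \<Rightarrow> real^2 \<Rightarrow> real^2 \<Rightarrow> real^2 \<Rightarrow> real^2" where
  "dG x w u v =
     w $ 1 *\<^sub>R ((u $ 1 * v $ 1) *\<^sub>R d\<Gamma> 1 1 1 x + (u $ 1 * v $ 2) *\<^sub>R d\<Gamma> 1 1 2 x
        + (u $ 2 * v $ 1) *\<^sub>R d\<Gamma> 1 2 1 x + (u $ 2 * v $ 2) *\<^sub>R d\<Gamma> 1 2 2 x)
   + w $ 2 *\<^sub>R ((u $ 1 * v $ 1) *\<^sub>R d\<Gamma> 2 1 1 x + (u $ 1 * v $ 2) *\<^sub>R d\<Gamma> 2 1 2 x
        + (u $ 2 * v $ 1) *\<^sub>R d\<Gamma> 2 2 1 x + (u $ 2 * v $ 2) *\<^sub>R d\<Gamma> 2 2 2 x)"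

lemma \<Gamma>_has_derivative:
  assumes "x \<in> \<phi> ` U"
  shows "(\<Gamma> i j has_derivative (\<lambda>w. w $ 1 *\<^sub>R d\<Gamma> 1 i j x + w $ 2 *\<^sub>R d\<Gamma> 2 i j x)) (at x)"
proof -
  have d: "(\<Gamma> i j has_derivative frechet_derivative (\<Gamma> i j) (at x)) (at x)"
    by (rule smooth_on_has_derivative[OF smooth_\<Gamma> assms])
  have "frechet_derivative (\<Gamma> i j) (at x) = (\<lambda>w. w $ 1 *\<^sub>R d\<Gamma> 1 i j x + w $ 2 *\<^sub>R d\<Gamma> 2 i j x)"
    unfolding d\<Gamma>_def by (rule ext, rule linear_vec2_expand[OF has_derivative_linear[OF d]])
  then show ?thesis using d by simp
qed

lemma G_has_derivative:
  assumes x: "x \<in> \<phi> ` U" and f: "(f has_derivative f') (at x)" and g: "(g has_derivative g') (at x)"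
  shows "((\<lambda>x. G x (f x) (g x)) has_derivative (\<lambda>w. dG x w (f x) (g x) + G x (f' w) (g x) + G x (f x) (g' w))) (at x)"
proof -
  note nth = bounded_linear.has_derivative[OF bounded_linear_vec_nth]
  have summand: "((\<lambda>x. (f x $ i * g x $ j) *\<^sub>R \<Gamma> i j x) has_derivative
     (\<lambda>w. (f x $ i * g x $ j) *\<^sub>R (w $ 1 *\<^sub>R d\<Gamma> 1 i j x + w $ 2 *\<^sub>R d\<Gamma> 2 i j x)
        + (f x $ i * g' w $ j + f' w $ i * g x $ j) *\<^sub>R \<Gamma> i j x)) (at x)" for i j
    by (intro has_derivative_scaleR has_derivative_mult nth f g \<Gamma>_has_derivative x)
  show ?thesis
    unfolding G_def
    by (rule has_derivative_eq_rhs, (rule has_derivative_add summand)+)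
      (simp add: fun_eq_iff dG_def algebra_simps)
qed

text \<open>The curvature of fields with constant components; these commute, so there is no bracket
  term.\<close>

definition Rm :: "real^2 \<Rightarrow> real^2 \<Rightarrow> real^2 \<Rightarrow> real^2 \<Rightarrow> real^2" where
  "Rm x u v z = dG x u v z - dG x v u z + G x u (G x v z) - G x v (G x u z)"

text \<open>Needed to differentiate a covariant derivative once more: the derivative of
  \<open>f\<close> is taken in a direction that itself varies. Second derivatives appear only on the
  axes, where the directions are fixed.\<close>

lemma directional_derivative_has_derivative:
  fixes f :: "real^2 \<Rightarrow> real^2" and V :: "real^2 \<Rightarrow> real^2"
  assumes S: "open S" and f: "smooth_on S f" and V: "(V has_derivative V') (at x)" and x: "x \<in> S"
  defines "H \<equiv> \<lambda>w v. frechet_derivative (\<lambda>y. frechet_derivative f (at y) v) (at x) w"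
  shows "((\<lambda>x. frechet_derivative f (at x) (V x)) has_derivative
    (\<lambda>w. frechet_derivative f (at x) (V' w) + (V x $ 1 *\<^sub>R H w (axis 1 1) + V x $ 2 *\<^sub>R H w (axis 2 1)))) (at x)"
proof -
  note nth = bounded_linear.has_derivative[OF bounded_linear_vec_nth]
  have lin: "linear (frechet_derivative f (at y))" if "y \<in> S" for y
    using smooth_on_has_derivative[OF f that] has_derivative_linear by blast
  have d: "((\<lambda>y. frechet_derivative f (at y) v) has_derivative (\<lambda>w. H w v)) (at x)" for v
    unfolding H_def by (rule smooth_on_has_derivative[OF smooth_on_frechet_derivative[OF f] x])
  have "((\<lambda>x. V x $ 1 *\<^sub>R frechet_derivative f (at x) (axis 1 1) + V x $ 2 *\<^sub>R frechet_derivative f (at x) (axis 2 1))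
     has_derivative (\<lambda>w. (V x $ 1 *\<^sub>R H w (axis 1 1) + V' w $ 1 *\<^sub>R frechet_derivative f (at x) (axis 1 1))
        + (V x $ 2 *\<^sub>R H w (axis 2 1) + V' w $ 2 *\<^sub>R frechet_derivative f (at x) (axis 2 1)))) (at x)"
    by (intro has_derivative_add has_derivative_scaleR nth V d)
  then have "((\<lambda>x. frechet_derivative f (at x) (V x)) has_derivative
     (\<lambda>w. (V x $ 1 *\<^sub>R H w (axis 1 1) + V' w $ 1 *\<^sub>R frechet_derivative f (at x) (axis 1 1))
        + (V x $ 2 *\<^sub>R H w (axis 2 1) + V' w $ 2 *\<^sub>R frechet_derivative f (at x) (axis 2 1)))) (at x)"
    by (rule has_derivative_transform_within_open[OF _ S x]) (rule linear_vec2_expand[OF lin, symmetric])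
  then show ?thesis
    by (rule has_derivative_eq_rhs) (simp add: fun_eq_iff linear_vec2_expand[OF lin[OF x], of "V' _"])
qed

text \<open>All derivatives of the three fields drop out: second derivatives of \<open>Z\<close> by
  their symmetry, those of \<open>X\<close> and \<open>Y\<close> against the bracket term, and the
  products of \<open>G\<close> with first derivatives of \<open>Z\<close> because they are symmetric
  in \<open>X\<close> and \<open>Y\<close>.\<close>

lemma coords_curvature_field:
  assumes W: "open W" "W \<subseteq> U" and p: "p \<in> W"
    and X: "smooth_vector_field A W X" and Y: "smooth_vector_field A W Y" and Z: "smooth_vector_field A W Z"
  shows "coords (curvature_field A nabla X Y Z p) = Rm (\<phi> p) (coords (X p)) (coords (Y p)) (coords (Z p))"
    and "curvature_field A nabla X Y Z p \<in> tangent_space A p"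
proof -
  have pU: "p \<in> U" using p W by auto
  have x: "\<phi> p \<in> \<phi> ` W" "\<phi> p \<in> \<phi> ` U" using p pU by auto
  note op = open_image[OF W]
  let ?D = "\<lambda>F. frechet_derivative F (at (\<phi> p))"
  let ?H = "\<lambda>w v. frechet_derivative (\<lambda>y. frechet_derivative (rep Z) (at y) v) (at (\<phi> p)) w"
  have tan: "X p \<in> tangent_space A p" if "smooth_vector_field A W X" for X
    using smooth_vector_fieldD(1)[OF W that p] .
  have lin: "linear (?D (rep X))" if "smooth_vector_field A W X" for X
    using rep_has_derivative[OF W that p] has_derivative_linear by blast
  \<comment> \<open>Stated for arbitrary \<open>X\<close> and \<open>Y\<close>, because the
    curvature uses it once in each order.\<close>
  have second: "coords (nabla (\<lambda>q. nabla Z q (Y q)) p (X p)) =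
      ?D (rep Z) (?D (rep Y) (coords (X p)))
      + (coords (Y p) $ 1 *\<^sub>R ?H (coords (X p)) (axis 1 1) + coords (Y p) $ 2 *\<^sub>R ?H (coords (X p)) (axis 2 1))
      + (dG (\<phi> p) (coords (X p)) (coords (Y p)) (coords (Z p)) + G (\<phi> p) (?D (rep Y) (coords (X p))) (coords (Z p))
      + G (\<phi> p) (coords (Y p)) (?D (rep Z) (coords (X p))))
      + G (\<phi> p) (coords (X p)) (?D (rep Z) (coords (Y p)) + G (\<phi> p) (coords (Y p)) (coords (Z p)))"
    if X: "smooth_vector_field A W X" and Y: "smooth_vector_field A W Y" for X Y
  proof -
    let ?P = "\<lambda>q. nabla Z q (Y q)"
    have P: "smooth_vector_field A W ?P" by (rule nabla_smooth[OF W Z Y])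
    have repP: "rep ?P y = frechet_derivative (rep Z) (at y) (rep Y y) + G y (rep Y y) (rep Z y)"
      if y: "y \<in> \<phi> ` W" for y
    proof -
      obtain q where q: "q \<in> W" "y = \<phi> q" using y by auto
      then have "q \<in> U" using W by auto
      then show ?thesis
        using coords_nabla[OF W Z q(1) smooth_vector_fieldD(1)[OF W Y q(1)]] by (simp add: q rep_\<phi>)
    qed
    have "((\<lambda>y. frechet_derivative (rep Z) (at y) (rep Y y) + G y (rep Y y) (rep Z y)) has_derivative
      (\<lambda>w. (?D (rep Z) (?D (rep Y) w) + (rep Y (\<phi> p) $ 1 *\<^sub>R ?H w (axis 1 1) + rep Y (\<phi> p) $ 2 *\<^sub>R ?H w (axis 2 1)))
        + (dG (\<phi> p) w (rep Y (\<phi> p)) (rep Z (\<phi> p)) + G (\<phi> p) (?D (rep Y) w) (rep Z (\<phi> p))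
          + G (\<phi> p) (rep Y (\<phi> p)) (?D (rep Z) w)))) (at (\<phi> p))"
      by (intro has_derivative_add directional_derivative_has_derivative[OF op] G_has_derivative x
          smooth_vector_fieldD(2)[OF W Z] rep_has_derivative[OF W Y p] rep_has_derivative[OF W Z p])
    then have "(rep ?P has_derivative
      (\<lambda>w. (?D (rep Z) (?D (rep Y) w) + (rep Y (\<phi> p) $ 1 *\<^sub>R ?H w (axis 1 1) + rep Y (\<phi> p) $ 2 *\<^sub>R ?H w (axis 2 1)))
        + (dG (\<phi> p) w (rep Y (\<phi> p)) (rep Z (\<phi> p)) + G (\<phi> p) (?D (rep Y) w) (rep Z (\<phi> p))
          + G (\<phi> p) (rep Y (\<phi> p)) (?D (rep Z) w)))) (at (\<phi> p))"
      by (rule has_derivative_transform_within_open[OF _ op x(1)]) (rule repP[symmetric])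
    note DP = frechet_derivative_at[OF this, symmetric]
    show ?thesis
      unfolding coords_nabla[OF W P p tan[OF X]] DP coords_nabla[OF W Z p tan[OF Y]] rep_\<phi>[OF pU]
      by (simp add: add.assoc)
  qed
  have bracket: "lie_bracket A X Y p = nabla Y p (X p) - nabla X p (Y p)"
    using torsion W X Y p by (auto simp: torsion_free_def)
  have bracket_in: "lie_bracket A X Y p \<in> tangent_space A p"
    unfolding bracket by (intro tangent_space_diff pU nabla_in[OF W] X Y p tan)
  have coords_bracket: "coords (lie_bracket A X Y p) = ?D (rep Y) (coords (X p)) - ?D (rep X) (coords (Y p))"
    unfolding bracket coords_diff coords_nabla[OF W Y p tan[OF X]] coords_nabla[OF W X p tan[OF Y]]
    by (simp add: G_symmetric[OF x(2), of "coords (X p)"])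
  \<comment> \<open>Symmetry of the Hessian of \<open>rep Z\<close> on two arbitrary vectors,
    reduced to the one mixed pair of axes.\<close>
  have H: "coords Y' $ 1 *\<^sub>R ?H (coords X') (axis 1 1) + coords Y' $ 2 *\<^sub>R ?H (coords X') (axis 2 1)
      = coords X' $ 1 *\<^sub>R ?H (coords Y') (axis 1 1) + coords X' $ 2 *\<^sub>R ?H (coords Y') (axis 2 1)" for X' Y'
  proof -
    note lin = has_derivative_linear[OF smooth_on_has_derivative[OF
        smooth_on_frechet_derivative[OF smooth_vector_fieldD(2)[OF W Z]] x(1)]]
    have "?H (axis 1 1) (axis 2 1) = ?H (axis 2 1) (axis 1 1)"
      by (rule frechet_derivative_commute[OF op smooth_vector_fieldD(2)[OF W Z] x(1)])
    then show ?thesis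
      using linear_vec2_expand[OF lin, of "axis 1 1" "coords X'"] linear_vec2_expand[OF lin, of "axis 2 1" "coords X'"]
        linear_vec2_expand[OF lin, of "axis 1 1" "coords Y'"] linear_vec2_expand[OF lin, of "axis 2 1" "coords Y'"]
      by (simp add: algebra_simps)
  qed
  show "curvature_field A nabla X Y Z p \<in> tangent_space A p"
    unfolding curvature_field_def
    by (intro tangent_space_diff pU nabla_in[OF W] nabla_smooth[OF W] X Y Z p tan bracket_in)
  show "coords (curvature_field A nabla X Y Z p) = Rm (\<phi> p) (coords (X p)) (coords (Y p)) (coords (Z p))"
    unfolding curvature_field_def coords_diff second[OF X Y] second[OF Y X]
      coords_nabla[OF W Z p bracket_in] coords_bracket H[of "Y p" "X p"]
    by (simp add: Rm_def linear_diff[OF lin[OF Z]] G_add_left G_add_right G_diff_left G_diff_right)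
qed

end

context surface_chart
begin

text \<open>The matrices of \<open>L\<close> in two bases are similar and have equal traces, so
  \<open>trace M\<close> fits every basis; the coordinate basis shows that no other number
  does.\<close>

lemma tangent_trace_eq:
  assumes p: "p \<in> U"
    and L: "\<And>v. v \<in> tangent_space A p \<Longrightarrow> L v \<in> tangent_space A p"
      "\<And>v. v \<in> tangent_space A p \<Longrightarrow> coords (L v) = M *v coords v"
  shows "tangent_trace A p L = trace M"
  unfolding tangent_trace_def
proof (rule the_equality)
  show "\<forall>e a. tangent_basis A p e \<and> (\<forall>j. L (e j) = (\<Sum>i\<in>UNIV. a $ i $ j *\<^sub>R e i)) \<longrightarrow> trace M = trace a"
  proof (intro allI impI)
    fix e and a :: "real^2^2"
    assume ea: "tangent_basis A p e \<and> (\<forall>j. L (e j) = (\<Sum>i\<in>UNIV. a $ i $ j *\<^sub>R e i))"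
    then have e: "e i \<in> tangent_space A p" for i by (simp add: tangent_basis_def)
    \<comment> \<open>The change of basis: its columns are the coordinates of the vectors of
      \<open>e\<close>. Uniqueness of the expansion in \<open>tangent_basis\<close> makes it
      injective, hence invertible.\<close>
    define P where "P = (\<chi> i j. coords (e j) $ i)"
    have P: "P *v c = c $ 1 *\<^sub>R coords (e 1) + c $ 2 *\<^sub>R coords (e 2)" for c
      by (simp add: P_def matrix_vector_mult_def sum_2 vec_eq_iff mult.commute)
    have "inj ((*v) P)"
    proof (rule injI)
      fix c d assume eq: "P *v c = P *v d"
      let ?v = "c $ 1 *\<^sub>R e 1 + c $ 2 *\<^sub>R e 2" and ?w = "d $ 1 *\<^sub>R e 1 + d $ 2 *\<^sub>R e 2"
      have vw: "?v \<in> tangent_space A p" "?w \<in> tangent_space A p"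
        by (intro tangent_space_lincomb p e)+
      have "?v = ?w"
        by (rule tangent_eqI[OF p vw]) (use eq in \<open>simp add: P coords_lincomb\<close>)
      then have "?v = (\<Sum>i\<in>UNIV. c $ i *\<^sub>R e i)" "?v = (\<Sum>i\<in>UNIV. d $ i *\<^sub>R e i)"
        by (simp_all add: sum_2)
      then show "c = d"
        using ea vw(1) unfolding tangent_basis_def by blast
    qed
    then obtain Q where QP: "Q ** P = mat 1"
      using matrix_left_invertible_injective by metis
    then have PQ: "P ** Q = mat 1" by (simp add: matrix_left_right_inverse)
    have MP: "M ** P = P ** a"
    proof -
      have "(M ** P) $ i $ j = (P ** a) $ i $ j" for i j
      proof -
        have "(M ** P) $ i $ j = coords (L (e j)) $ i"
          using L(2)[OF e[of j]] by (simp add: matrix_matrix_mult_def matrix_vector_mult_def P_def)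
        moreover have "L (e j) = a $ 1 $ j *\<^sub>R e 1 + a $ 2 $ j *\<^sub>R e 2"
          using ea by (simp add: sum_2)
        then have "coords (L (e j)) = a $ 1 $ j *\<^sub>R coords (e 1) + a $ 2 $ j *\<^sub>R coords (e 2)"
          by (simp only: coords_lincomb)
        ultimately show ?thesis
          by (simp add: matrix_matrix_mult_def P_def sum_2 mult.commute)
      qed
      then show ?thesis by (simp add: vec_eq_iff)
    qed
    have "a = Q ** (P ** a)" by (simp add: matrix_mul_assoc QP)
    then have "trace a = trace (Q ** (M ** P))" by (simp add: MP)
    also have "\<dots> = trace ((M ** P) ** Q)" by (rule trace_mul_sym)
    also have "\<dots> = trace M" by (simp add: matrix_mul_assoc[symmetric] PQ)
    finally show "trace M = trace a" by simp
  qed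
next
  fix t assume t: "\<forall>e a. tangent_basis A p e \<and> (\<forall>j. L (e j) = (\<Sum>i\<in>UNIV. a $ i $ j *\<^sub>R e i)) \<longrightarrow> t = trace a"
  define e where "e i = tvec p (axis i 1)" for i
  have e: "e i \<in> tangent_space A p" "coords (e i) = axis i 1" for i
    using p by (auto simp: e_def tvec_in)
  have v_eq: "v = (\<Sum>i\<in>UNIV. c $ i *\<^sub>R e i) \<longleftrightarrow> c = coords v" if v: "v \<in> tangent_space A p" for v c
  proof -
    have "coords (\<Sum>i\<in>UNIV. c $ i *\<^sub>R e i) = c"
      using vec2_eq_axis_sum[of c] by (simp add: sum_2 coords_lincomb e)
    moreover have "(\<Sum>i\<in>UNIV. c $ i *\<^sub>R e i) \<in> tangent_space A p"
      by (simp add: sum_2 tangent_space_lincomb p e)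
    ultimately show ?thesis using tangent_eqI[OF p v] by metis
  qed
  have "tangent_basis A p e"
    unfolding tangent_basis_def using e(1) v_eq by auto
  moreover have "L (e j) = (\<Sum>i\<in>UNIV. M $ i $ j *\<^sub>R e i)" for j
  proof -
    have "coords (L (e j)) = (\<chi> i. M $ i $ j)"
      by (simp add: L(2)[OF e(1)] e matrix_vector_mult_def vec_eq_iff axis_def if_distrib cong: if_cong)
    then show ?thesis
      using v_eq[OF L(1)[OF e(1)], of j "\<chi> i. M $ i $ j"] by simp
  qed
  ultimately show "t = trace M" using t by blast
qed

end

context surface_connection
begin

section \<open>The Ricci tensor in coordinates\<close>

lemma coords_curvature:
  assumes p: "p \<in> U" and uvz: "u \<in> tangent_space A p" "v \<in> tangent_space A p" "z \<in> tangent_space A p"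
  shows "coords (curvature A nabla p u v z) = Rm (\<phi> p) (coords u) (coords v) (coords z)"
    and "curvature A nabla p u v z \<in> tangent_space A p"
proof -
  obtain W1 where W1: "open W1" "p \<in> W1" "W1 \<subseteq> U" "smooth_vector_field A W1 (extend_tangent A p u)"
    "extend_tangent A p u p = u" using extend_tangentE[OF p uvz(1)] by blast
  obtain W2 where W2: "open W2" "p \<in> W2" "W2 \<subseteq> U" "smooth_vector_field A W2 (extend_tangent A p v)"
    "extend_tangent A p v p = v" using extend_tangentE[OF p uvz(2)] by blast
  obtain W3 where W3: "open W3" "p \<in> W3" "W3 \<subseteq> U" "smooth_vector_field A W3 (extend_tangent A p z)"
    "extend_tangent A p z p = z" using extend_tangentE[OF p uvz(3)] by blast
  define W where "W = W1 \<inter> W2 \<inter> W3"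
  have W: "open W" "W \<subseteq> U" "p \<in> W" using W1 W2 W3 by (auto simp: W_def)
  have "smooth_vector_field A W (extend_tangent A p u)" "smooth_vector_field A W (extend_tangent A p v)"
    "smooth_vector_field A W (extend_tangent A p z)"
    using smooth_vector_field_subset[OF W1(4), of W] smooth_vector_field_subset[OF W2(4), of W]
      smooth_vector_field_subset[OF W3(4), of W] by (auto simp: W_def)
  from coords_curvature_field[OF W this]
  show "coords (curvature A nabla p u v z) = Rm (\<phi> p) (coords u) (coords v) (coords z)"
    and "curvature A nabla p u v z \<in> tangent_space A p"
    by (auto simp: curvature_def W1(5) W2(5) W3(5))
qed

definition Rc :: "real^2 \<Rightarrow> real^2 \<Rightarrow> real^2 \<Rightarrow> real" where
  "Rc x y z = Rm x (axis 1 1) y z $ 1 + Rm x (axis 2 1) y z $ 2"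

definition \<rho> :: "2 \<Rightarrow> 2 \<Rightarrow> real^2 \<Rightarrow> real" where
  "\<rho> i j x = Rc x (axis i 1) (axis j 1)"

lemma Rm_expand: "Rm x u y z = u $ 1 *\<^sub>R Rm x (axis 1 1) y z + u $ 2 *\<^sub>R Rm x (axis 2 1) y z"
  by (simp add: Rm_def dG_def G_def axis_def vec_eq_iff algebra_simps)

lemma ricci_eq:
  assumes p: "p \<in> U" and yz: "y \<in> tangent_space A p" "z \<in> tangent_space A p"
  shows "ricci A nabla p y z = Rc (\<phi> p) (coords y) (coords z)"
proof -
  define M where "M = (\<chi> i j. Rm (\<phi> p) (axis j 1) (coords y) (coords z) $ i)"
  have "ricci A nabla p y z = trace M"
    unfolding ricci_def
  proof (rule tangent_trace_eq[OF p])
    fix v assume v: "v \<in> tangent_space A p"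
    show "curvature A nabla p v y z \<in> tangent_space A p" by (rule coords_curvature[OF p v yz])
    show "coords (curvature A nabla p v y z) = M *v coords v"
      unfolding coords_curvature(1)[OF p v yz]
      by (subst Rm_expand) (simp add: M_def matrix_vector_mult_def sum_2 vec_eq_iff mult.commute)
  qed
  then show ?thesis by (simp add: trace_def sum_2 M_def Rc_def)
qed

lemma Rc_expand: "Rc x y z = (y $ 1 * z $ 1) * \<rho> 1 1 x + (y $ 1 * z $ 2) * \<rho> 1 2 x
    + (y $ 2 * z $ 1) * \<rho> 2 1 x + (y $ 2 * z $ 2) * \<rho> 2 2 x"
  by (simp add: \<rho>_def Rc_def Rm_def dG_def G_def axis_def algebra_simps)

text \<open>Skew symmetry of the curvature removes one of the two terms of the trace, so that in
  dimension two every Ricci component is a single component of the curvature. Both formulas together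
  recover the curvature from the Ricci tensor.\<close>

lemma \<rho>_1: "\<rho> 1 j x = (d\<Gamma> 2 1 j x - d\<Gamma> 1 2 j x + G x (axis 2 1) (\<Gamma> 1 j x) - G x (axis 1 1) (\<Gamma> 2 j x)) $ 2"
  and \<rho>_2: "\<rho> 2 j x = (d\<Gamma> 1 2 j x - d\<Gamma> 2 1 j x + G x (axis 1 1) (\<Gamma> 2 j x) - G x (axis 2 1) (\<Gamma> 1 j x)) $ 1"
  using exhaust_2[of j] by (auto simp: \<rho>_def Rc_def Rm_def dG_def G_def axis_def)

lemma smooth_d\<Gamma>: "smooth_on (\<phi> ` U) (d\<Gamma> k i j)"
  unfolding d\<Gamma>_def[abs_def] by (rule smooth_on_frechet_derivative[OF smooth_\<Gamma>])

lemma smooth_G: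
  assumes "open S" "S \<subseteq> \<phi> ` U" "smooth_on S f" "smooth_on S g"
  shows "smooth_on S (\<lambda>x. G x (f x) (g x))"
  unfolding G_def using assms(1,3,4) smooth_on_subset[OF smooth_\<Gamma> assms(2)]
  by (intro smooth_intros)

lemma smooth_\<rho>: "smooth_on (\<phi> ` U) (\<rho> i j)"
proof -
  have "smooth_on (\<phi> ` U) (\<lambda>x. (d\<Gamma> 2 1 j x - d\<Gamma> 1 2 j x + G x (axis 2 1) (\<Gamma> 1 j x) - G x (axis 1 1) (\<Gamma> 2 j x)) $ 2)"
    "smooth_on (\<phi> ` U) (\<lambda>x. (d\<Gamma> 1 2 j x - d\<Gamma> 2 1 j x + G x (axis 1 1) (\<Gamma> 2 j x) - G x (axis 2 1) (\<Gamma> 1 j x)) $ 1)"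
    by (intro smooth_intros smooth_G smooth_\<Gamma> smooth_d\<Gamma> order_refl open_\<phi>U)+
  then show ?thesis
    using exhaust_2[of i] by (auto simp: \<rho>_1[abs_def] \<rho>_2[abs_def])
qed

section \<open>The covariant derivative of the Ricci tensor and the Cotton-York tensor\<close>

definition d\<rho> :: "2 \<Rightarrow> 2 \<Rightarrow> 2 \<Rightarrow> real^2 \<Rightarrow> real" where
  "d\<rho> k i j x = frechet_derivative (\<rho> i j) (at x) (axis k 1)"

definition dRc :: "real^2 \<Rightarrow> real^2 \<Rightarrow> real^2 \<Rightarrow> real^2 \<Rightarrow> real" where
  "dRc x u v w =
     (v $ 1 * w $ 1) * (u $ 1 * d\<rho> 1 1 1 x + u $ 2 * d\<rho> 2 1 1 x)
   + (v $ 1 * w $ 2) * (u $ 1 * d\<rho> 1 1 2 x + u $ 2 * d\<rho> 2 1 2 x)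
   + (v $ 2 * w $ 1) * (u $ 1 * d\<rho> 1 2 1 x + u $ 2 * d\<rho> 2 2 1 x)
   + (v $ 2 * w $ 2) * (u $ 1 * d\<rho> 1 2 2 x + u $ 2 * d\<rho> 2 2 2 x)"

lemma \<rho>_has_derivative:
  assumes "x \<in> \<phi> ` U"
  shows "(\<rho> i j has_derivative (\<lambda>u. u $ 1 * d\<rho> 1 i j x + u $ 2 * d\<rho> 2 i j x)) (at x)"
proof -
  have d: "(\<rho> i j has_derivative frechet_derivative (\<rho> i j) (at x)) (at x)"
    by (rule smooth_on_has_derivative[OF smooth_\<rho> assms])
  have "frechet_derivative (\<rho> i j) (at x) = (\<lambda>u. u $ 1 *\<^sub>R d\<rho> 1 i j x + u $ 2 *\<^sub>R d\<rho> 2 i j x)"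
    unfolding d\<rho>_def by (rule ext, rule linear_vec2_expand[OF has_derivative_linear[OF d]])
  then show ?thesis using d by simp
qed

lemma Rc_has_derivative:
  assumes x: "x \<in> \<phi> ` U" and f: "(f has_derivative f') (at x)" and g: "(g has_derivative g') (at x)"
  shows "((\<lambda>x. Rc x (f x) (g x)) has_derivative
    (\<lambda>u. dRc x u (f x) (g x) + Rc x (f' u) (g x) + Rc x (f x) (g' u))) (at x)"
proof -
  note nth = bounded_linear.has_derivative[OF bounded_linear_vec_nth]
  have summand: "((\<lambda>x. (f x $ i * g x $ j) * \<rho> i j x) has_derivative
     (\<lambda>u. (f x $ i * g x $ j) * (u $ 1 * d\<rho> 1 i j x + u $ 2 * d\<rho> 2 i j x)
        + (f x $ i * g' u $ j + f' u $ i * g x $ j) * \<rho> i j x)) (at x)" for i j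
    by (intro has_derivative_mult nth f g \<rho>_has_derivative x)
  show ?thesis
    unfolding Rc_expand
    by (rule has_derivative_eq_rhs, (rule has_derivative_add summand)+)
      (simp add: fun_eq_iff dRc_def algebra_simps)
qed

lemma Rc_add_left: "Rc x (u + u') v = Rc x u v + Rc x u' v"
  and Rc_add_right: "Rc x u (v + v') = Rc x u v + Rc x u v'"
  by (simp_all add: Rc_expand algebra_simps)

text \<open>The product rule brings in the derivatives of the two extended fields, and the same
  derivatives occur in their covariant derivatives with opposite sign. What remains depends only on
  the values at \<open>p\<close>.\<close>

lemma covariant_derivative_ricci:
  assumes p: "p \<in> U" and uvw: "u \<in> tangent_space A p" "v \<in> tangent_space A p" "w \<in> tangent_space A p"
  shows "covariant_derivative_2 A nabla (ricci A nabla) p u v w =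
    dRc (\<phi> p) (coords u) (coords v) (coords w) - Rc (\<phi> p) (G (\<phi> p) (coords u) (coords v)) (coords w)
     - Rc (\<phi> p) (coords v) (G (\<phi> p) (coords u) (coords w))"
proof -
  let ?V = "extend_tangent A p v" and ?W = "extend_tangent A p w"
  obtain W1 where W1: "open W1" "p \<in> W1" "W1 \<subseteq> U" "smooth_vector_field A W1 ?V" "?V p = v"
    using extend_tangentE[OF p uvw(2)] by blast
  obtain W2 where W2: "open W2" "p \<in> W2" "W2 \<subseteq> U" "smooth_vector_field A W2 ?W" "?W p = w"
    using extend_tangentE[OF p uvw(3)] by blast
  define N where "N = W1 \<inter> W2"
  have N: "open N" "N \<subseteq> U" "p \<in> N" using W1 W2 by (auto simp: N_def)
  have V: "smooth_vector_field A N ?V" and W: "smooth_vector_field A N ?W"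
    using smooth_vector_field_subset[OF W1(4), of N] smooth_vector_field_subset[OF W2(4), of N]
    by (auto simp: N_def)
  have x: "\<phi> p \<in> \<phi> ` N" "\<phi> p \<in> \<phi> ` U" using N p by auto
  note op = open_image[OF N(1,2)]
  let ?f = "\<lambda>q. ricci A nabla q (?V q) (?W q)"
  have f_eq: "?f (\<psi> y) = Rc y (rep ?V y) (rep ?W y)" if y: "y \<in> \<phi> ` N" for y
  proof -
    obtain q where q: "q \<in> N" "y = \<phi> q" using y by auto
    then have "q \<in> U" using N by auto
    then show ?thesis
      using ricci_eq[of q] smooth_vector_fieldD(1)[OF N(1,2) V q(1)] smooth_vector_fieldD(1)[OF N(1,2) W q(1)]
      by (simp add: q \<psi>_\<phi> rep_\<phi>)
  qed
  have rhs: "smooth_on (\<phi> ` N) (\<lambda>y. Rc y (rep ?V y) (rep ?W y))"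
    unfolding Rc_expand
    using smooth_on_subset[OF smooth_\<rho>, of "\<phi> ` N"] N(2)
    by (intro smooth_intros smooth_vector_fieldD(2)[OF N(1,2)] V W op) auto
  have near: "smooth_near A p ?f"
    by (rule smooth_nearI[OF N(1,3,2)]) (rule iffD2[OF smooth_on_cong[OF op f_eq] rhs])
  have "((\<lambda>y. ?f (\<psi> y)) has_derivative (\<lambda>u. dRc (\<phi> p) u (rep ?V (\<phi> p)) (rep ?W (\<phi> p))
      + Rc (\<phi> p) (frechet_derivative (rep ?V) (at (\<phi> p)) u) (rep ?W (\<phi> p))
      + Rc (\<phi> p) (rep ?V (\<phi> p)) (frechet_derivative (rep ?W) (at (\<phi> p)) u))) (at (\<phi> p))"
    by (rule has_derivative_transform_within_open[OF Rc_has_derivative[OF x(2)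
            rep_has_derivative[OF N(1,2) V N(3)] rep_has_derivative[OF N(1,2) W N(3)]] op x(1)])
      (rule f_eq[symmetric])
  note D = frechet_derivative_at[OF this, symmetric]
  have uf: "u ?f = dRc (\<phi> p) (coords u) (coords v) (coords w)
      + Rc (\<phi> p) (frechet_derivative (rep ?V) (at (\<phi> p)) (coords u)) (coords w)
      + Rc (\<phi> p) (coords v) (frechet_derivative (rep ?W) (at (\<phi> p)) (coords u))"
    unfolding tangent_apply[OF p uvw(1) near] D rep_\<phi>[OF p] W1(5) W2(5) ..
  have nV: "nabla ?V p u \<in> tangent_space A p" and nW: "nabla ?W p u \<in> tangent_space A p"
    by (rule nabla_in[OF N(1,2) _ N(3) uvw(1)], rule V W)+
  show ?thesis
    unfolding covariant_derivative_2_def Let_def uf ricci_eq[OF p nV uvw(3)] ricci_eq[OF p uvw(2) nW]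
      coords_nabla[OF N(1,2) V N(3) uvw(1)] coords_nabla[OF N(1,2) W N(3) uvw(1)] W1(5) W2(5)
    by (simp add: Rc_add_left Rc_add_right)
qed

text \<open>The component \<open>Y\<^sub>1\<^sub>2\<^sub>j\<close>. The two terms with
  \<open>\<Gamma>\<^sup>c\<^sub>1\<^sub>2\<close> have cancelled by symmetry of the Christoffel
  symbols.\<close>

definition cotton :: "2 \<Rightarrow> real^2 \<Rightarrow> real" where
  "cotton j x = d\<rho> 1 2 j x - d\<rho> 2 1 j x - (\<Gamma> 1 j x $ 1 * \<rho> 2 1 x + \<Gamma> 1 j x $ 2 * \<rho> 2 2 x)
     + (\<Gamma> 2 j x $ 1 * \<rho> 1 1 x + \<Gamma> 2 j x $ 2 * \<rho> 1 2 x)"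

text \<open>Skew symmetry in the first two arguments leaves, in dimension two, only their
  determinant times the components \<open>cotton 1\<close> and \<open>cotton 2\<close>.\<close>

lemma cotton_york_eq:
  assumes p: "p \<in> U" and uvw: "u \<in> tangent_space A p" "v \<in> tangent_space A p" "w \<in> tangent_space A p"
  shows "cotton_york A nabla p u v w = (coords u $ 1 * coords v $ 2 - coords u $ 2 * coords v $ 1)
    * (coords w $ 1 * cotton 1 (\<phi> p) + coords w $ 2 * cotton 2 (\<phi> p))"
  unfolding cotton_york_def covariant_derivative_ricci[OF p uvw] covariant_derivative_ricci[OF p uvw(2,1,3)]
  using p by (simp add: Rc_expand G_def dRc_def cotton_def \<Gamma>_symmetric[of "\<phi> p" 2 1] algebra_simps)

lemma cotton_york_zero_iff:
  assumes p: "p \<in> U"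
  shows "(\<forall>u\<in>tangent_space A p. \<forall>v\<in>tangent_space A p. \<forall>w\<in>tangent_space A p. cotton_york A nabla p u v w = 0)
    \<longleftrightarrow> cotton 1 (\<phi> p) = 0 \<and> cotton 2 (\<phi> p) = 0"
proof
  assume *: "\<forall>u\<in>tangent_space A p. \<forall>v\<in>tangent_space A p. \<forall>w\<in>tangent_space A p. cotton_york A nabla p u v w = 0"
  have "cotton j (\<phi> p) = 0" for j
    using *[rule_format, OF frame_in[OF p, of 1] frame_in[OF p, of 2] frame_in[OF p, of j]] exhaust_2[of j]
    by (auto simp: cotton_york_eq[OF p frame_in[OF p] frame_in[OF p] frame_in[OF p]] coords_frame[OF p] axis_def)
  then show "cotton 1 (\<phi> p) = 0 \<and> cotton 2 (\<phi> p) = 0" by simp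
qed (simp add: cotton_york_eq[OF p])

lemma \<rho>_symmetric:
  assumes "ricci_symmetric A nabla" "x \<in> \<phi> ` U"
  shows "\<rho> i j x = \<rho> j i x"
proof -
  obtain p where p: "p \<in> U" "x = \<phi> p" using assms(2) by auto
  have "ricci A nabla p (frame i p) (frame j p) = ricci A nabla p (frame j p) (frame i p)"
    using assms(1) frame_in[OF p(1)] by (auto simp: ricci_symmetric_def)
  then show ?thesis
    by (simp add: ricci_eq[OF p(1) frame_in[OF p(1)] frame_in[OF p(1)]] coords_frame[OF p(1)] \<rho>_def p(2))
qed

end

section \<open>Geodesics in a chart\<close>

lemma smooth_on_has_vector_derivative:
  assumes "smooth_on I c" "t \<in> I"
  shows "(c has_vector_derivative frechet_derivative c (at t) 1) (at t)"
proof -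
  note d = smooth_on_has_derivative[OF assms]
  have "frechet_derivative c (at t) = (\<lambda>h. h *\<^sub>R frechet_derivative c (at t) 1)"
  proof
    show "frechet_derivative c (at t) h = h *\<^sub>R frechet_derivative c (at t) 1" for h
      using linear_scale[OF has_derivative_linear[OF d], of h 1] by simp
  qed
  then show ?thesis using d by (simp add: has_vector_derivative_def)
qed

context surface_chart
begin

text \<open>As for functions, smoothness in the atlas is moved to the single chart by transition
  maps on the open sets of times at which the curve lies in a given atlas chart.\<close>

lemma smooth_curve_iff:
  assumes I: "open I" and \<gamma>: "\<gamma> ` I \<subseteq> U" "continuous_on I \<gamma>"
  shows "smooth_curve A I \<gamma> \<longleftrightarrow> smooth_on I (\<lambda>t. \<phi> (\<gamma> t))"
proof
  have A: "coordinate_chart A c" if "c \<in> A" for c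
    using atlas that by (auto simp: smooth_atlas_def)
  have op: "open (I \<inter> \<gamma> -` fst c)" if "c \<in> A" for c
    using A[OF that] \<gamma>(2) I by (intro continuous_open_preimage) (auto simp: coordinate_chart_def)
  {
    assume sm: "smooth_curve A I \<gamma>"
    show "smooth_on I (\<lambda>t. \<phi> (\<gamma> t))"
    proof (rule smooth_on_locally)
      fix t assume t: "t \<in> I"
      obtain c where c: "c \<in> A" "\<gamma> t \<in> fst c" using atlas unfolding smooth_atlas_def by blast
      let ?J = "I \<inter> \<gamma> -` fst c"
      have "smooth_on ?J (\<lambda>t. (\<phi> \<circ> inv_into (fst c) (snd c)) ((snd c \<circ> \<gamma>) t))"
      proof (rule smooth_on_compose[where f = "snd c \<circ> \<gamma>" and g = "\<phi> \<circ> inv_into (fst c) (snd c)", OF op[OF c(1)]])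
        show "smooth_on ?J (snd c \<circ> \<gamma>)" using sm c by (simp add: smooth_curve_def)
        show "smooth_on (snd c ` (U \<inter> fst c)) (\<phi> \<circ> inv_into (fst c) (snd c))"
          using chart c by (auto simp: coordinate_chart_def smooth_compatible_def)
        show "(snd c \<circ> \<gamma>) ` ?J \<subseteq> snd c ` (U \<inter> fst c)" using \<gamma> by auto
      qed
      then have "smooth_on ?J (\<lambda>t. \<phi> (\<gamma> t))"
        by (rule iffD1[OF smooth_on_cong[OF op[OF c(1)]], rotated])
          (simp add: coordinate_chart_inv[OF A[OF c(1)]])
      then show "\<exists>T. open T \<and> t \<in> T \<and> smooth_on T (\<lambda>t. \<phi> (\<gamma> t))"
        using op[OF c(1)] t c(2) by (intro exI[of _ ?J]) auto
    qed
  next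
    assume sm: "smooth_on I (\<lambda>t. \<phi> (\<gamma> t))"
    have "smooth_on (I \<inter> \<gamma> -` fst c) (snd c \<circ> \<gamma>)" if c: "c \<in> A" for c
    proof -
      let ?J = "I \<inter> \<gamma> -` fst c"
      have "smooth_on ?J (\<lambda>t. (snd c \<circ> \<psi>) (\<phi> (\<gamma> t)))"
      proof (rule smooth_on_compose[where f = "\<lambda>t. \<phi> (\<gamma> t)" and g = "snd c \<circ> \<psi>", OF op[OF c]])
        show "smooth_on ?J (\<lambda>t. \<phi> (\<gamma> t))" using sm by (rule smooth_on_subset) auto
        show "smooth_on (\<phi> ` (U \<inter> fst c)) (snd c \<circ> \<psi>)"
          using chart c by (auto simp: coordinate_chart_def smooth_compatible_def \<psi>_def)
        show "(\<lambda>t. \<phi> (\<gamma> t)) ` ?J \<subseteq> \<phi> ` (U \<inter> fst c)" using \<gamma> by auto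
      qed
      then show ?thesis
        by (rule iffD1[OF smooth_on_cong[OF op[OF c]], rotated]) (use \<gamma> \<psi>_\<phi> in auto)
    qed
    then show "smooth_curve A I \<gamma>" using \<gamma>(2) by (simp add: smooth_curve_def)
  }
qed

lemma velocity_eq:
  assumes I: "open I" "t \<in> I" and \<gamma>: "\<gamma> ` I \<subseteq> U"
    and c: "((\<lambda>t. \<phi> (\<gamma> t)) has_vector_derivative c') (at t)"
  shows "velocity A \<gamma> t = tvec (\<gamma> t) c'"
proof
  have \<gamma>t: "\<gamma> t \<in> U" using I \<gamma> by auto
  fix f
  have "deriv (f \<circ> \<gamma>) t = frechet_derivative (\<lambda>x. f (\<psi> x)) (at (\<phi> (\<gamma> t))) c'" if f: "smooth_near A (\<gamma> t) f"
  proof (rule DERIV_imp_deriv)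
    note df = smooth_near_has_derivative[OF f \<gamma>t]
    have "((\<lambda>t. f (\<psi> (\<phi> (\<gamma> t)))) has_derivative
        (\<lambda>h. frechet_derivative (\<lambda>x. f (\<psi> x)) (at (\<phi> (\<gamma> t))) (h *\<^sub>R c'))) (at t)"
      using has_derivative_compose[OF c[unfolded has_vector_derivative_def] df] .
    then have "((\<lambda>t. f (\<psi> (\<phi> (\<gamma> t)))) has_real_derivative
        frechet_derivative (\<lambda>x. f (\<psi> x)) (at (\<phi> (\<gamma> t))) c') (at t)"
      by (simp add: has_field_derivative_def linear_scale[OF has_derivative_linear[OF df]] mult_commute_abs)
    then show "((f \<circ> \<gamma>) has_real_derivative frechet_derivative (\<lambda>x. f (\<psi> x)) (at (\<phi> (\<gamma> t))) c') (at t)"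
      by (rule has_field_derivative_transform_within_open[OF _ I]) (use \<gamma> \<psi>_\<phi> in auto)
  qed
  then show "velocity A \<gamma> t f = tvec (\<gamma> t) c' f" by (simp add: velocity_def tvec_def)
qed

end

context surface_connection
begin

text \<open>Along the curve the extension \<open>X\<close> has components \<open>c'\<close>, so by
  the chain rule the derivative of \<open>rep X\<close> in direction \<open>c'\<close> is
  \<open>c''\<close>. The choice of the extension therefore does not matter.\<close>

lemma acceleration_coords:
  assumes I: "open I" "t \<in> I" and \<gamma>: "\<gamma> ` I \<subseteq> U"
    and c: "\<And>t. t \<in> I \<Longrightarrow> ((\<lambda>t. \<phi> (\<gamma> t)) has_vector_derivative c' t) (at t)"
    and X: "open W" "W \<subseteq> U" "\<gamma> t \<in> W" "smooth_vector_field A W X"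
    and eq: "\<And>s. s \<in> I \<Longrightarrow> X (\<gamma> s) = velocity A \<gamma> s"
    and c': "(c' has_vector_derivative c'') (at t)"
  shows "coords (nabla X (\<gamma> t) (velocity A \<gamma> t)) = c'' + G (\<phi> (\<gamma> t)) (c' t) (c' t)"
proof -
  have \<gamma>t: "\<gamma> t \<in> U" using I \<gamma> by auto
  have vel: "velocity A \<gamma> s = tvec (\<gamma> s) (c' s)" if "s \<in> I" for s
    by (rule velocity_eq[OF I(1) that \<gamma> c[OF that]])
  have rep: "rep X (\<phi> (\<gamma> s)) = c' s" if s: "s \<in> I" for s
  proof -
    have "\<gamma> s \<in> U" using s \<gamma> by auto
    then show ?thesis by (simp add: rep_\<phi> eq[OF s] vel[OF s])
  qed
  note dX = rep_has_derivative[OF X(1,2,4,3)]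
  have "((\<lambda>t. rep X (\<phi> (\<gamma> t))) has_derivative
      (\<lambda>h. frechet_derivative (rep X) (at (\<phi> (\<gamma> t))) (h *\<^sub>R c' t))) (at t)"
    using has_derivative_compose[OF c[OF I(2), unfolded has_vector_derivative_def] dX] .
  then have "((\<lambda>t. rep X (\<phi> (\<gamma> t))) has_vector_derivative
      frechet_derivative (rep X) (at (\<phi> (\<gamma> t))) (c' t)) (at t)"
    by (simp add: has_vector_derivative_def linear_scale[OF has_derivative_linear[OF dX]])
  then have "(c' has_vector_derivative frechet_derivative (rep X) (at (\<phi> (\<gamma> t))) (c' t)) (at t)"
    by (rule has_vector_derivative_transform_within_open[OF _ I]) (rule rep)
  then have "frechet_derivative (rep X) (at (\<phi> (\<gamma> t))) (c' t) = c''"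
    using c' vector_derivative_unique_at by blast
  moreover have "coords (nabla X (\<gamma> t) (tvec (\<gamma> t) (c' t))) =
      frechet_derivative (rep X) (at (\<phi> (\<gamma> t))) (c' t) + G (\<phi> (\<gamma> t)) (c' t) (coords (X (\<gamma> t)))"
    using coords_nabla[OF X(1,2,4,3) tvec_in[OF \<gamma>t]] \<gamma>t by simp
  ultimately show ?thesis
    using rep[OF I(2)] by (simp add: vel[OF I(2)] rep_\<phi>[OF \<gamma>t])
qed

lemma geodesic_coords:
  assumes geo: "geodesic A nabla I \<gamma>" and \<gamma>: "\<gamma> ` I \<subseteq> U"
  obtains f c' c'' where "smooth_on I f"
    "\<And>t. t \<in> I \<Longrightarrow> ((\<lambda>t. \<phi> (\<gamma> t)) has_vector_derivative c' t) (at t)"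
    "\<And>t. t \<in> I \<Longrightarrow> (c' has_vector_derivative c'' t) (at t)"
    "\<And>t. t \<in> I \<Longrightarrow> c'' t = f t *\<^sub>R c' t - G (\<phi> (\<gamma> t)) (c' t) (c' t)"
proof -
  have I: "open I" and sm: "smooth_curve A I \<gamma>" using geo by (auto simp: geodesic_def)
  obtain f where f: "smooth_on I f"
    and acc: "\<And>t. t \<in> I \<Longrightarrow> has_acceleration A nabla \<gamma> t (f t *\<^sub>R velocity A \<gamma> t)"
    using geo by (auto simp: geodesic_def)
  have c: "smooth_on I (\<lambda>t. \<phi> (\<gamma> t))"
    using sm smooth_curve_iff[OF I \<gamma>] by (simp add: smooth_curve_def)
  define c' where "c' t = frechet_derivative (\<lambda>t. \<phi> (\<gamma> t)) (at t) 1" for t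
  have sc': "smooth_on I c'" unfolding c'_def[abs_def] by (rule smooth_on_frechet_derivative[OF c])
  define c'' where "c'' t = frechet_derivative c' (at t) 1" for t
  have dc: "((\<lambda>t. \<phi> (\<gamma> t)) has_vector_derivative c' t) (at t)" if "t \<in> I" for t
    unfolding c'_def by (rule smooth_on_has_vector_derivative[OF c that])
  have dc': "(c' has_vector_derivative c'' t) (at t)" if "t \<in> I" for t
    unfolding c''_def by (rule smooth_on_has_vector_derivative[OF sc' that])
  have "c'' t = f t *\<^sub>R c' t - G (\<phi> (\<gamma> t)) (c' t) (c' t)" if t: "t \<in> I" for t
  proof -
    have \<gamma>t: "\<gamma> t \<in> U" using t \<gamma> by auto
    obtain W X where X: "open W" "\<gamma> t \<in> W" "smooth_vector_field A W X"
      and ev: "\<forall>\<^sub>F s in nhds t. X (\<gamma> s) = velocity A \<gamma> s"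
      and a: "f t *\<^sub>R velocity A \<gamma> t = nabla X (\<gamma> t) (velocity A \<gamma> t)"
      using acc[OF t] unfolding has_acceleration_def by blast
    obtain J where J: "open J" "t \<in> J" "\<And>s. s \<in> J \<Longrightarrow> X (\<gamma> s) = velocity A \<gamma> s"
      using ev by (auto simp: eventually_nhds)
    have "coords (nabla X (\<gamma> t) (velocity A \<gamma> t)) = c'' t + G (\<phi> (\<gamma> t)) (c' t) (c' t)"
    \<comment> \<open>The extension agrees with the velocity only for times near \<open>t\<close>,
      and its domain may leave \<open>U\<close>; hence both are cut down.\<close>
    proof (rule acceleration_coords[of "I \<inter> J" _ _ _ "W \<inter> U"])
      show "smooth_vector_field A (W \<inter> U) X" using X(3) by (rule smooth_vector_field_subset) simp
    qed (use I J t \<gamma> dc dc' X open_U \<gamma>t in auto)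
    moreover have "coords (f t *\<^sub>R velocity A \<gamma> t) = f t *\<^sub>R c' t"
      by (simp add: coords_scaleR velocity_eq[OF I t \<gamma> dc[OF t]] \<gamma>t)
    ultimately show ?thesis using a by (simp add: algebra_simps)
  qed
  then show ?thesis using that f dc dc' by blast
qed

end

section \<open>Straight geodesics force the vanishing of the Cotton-York tensor\<close>

lemma smooth_on_Pair:
  assumes "open S" "smooth_on S f" "smooth_on S g"
  shows "smooth_on S (\<lambda>x. (f x, g x))"
proof -
  have "smooth_on S (\<lambda>x. (f x, 0) + (0, g x))"
    using assms
    by (intro smooth_on_add smooth_on_bounded_linear_compose[of "\<lambda>a. (a, 0)"]
        smooth_on_bounded_linear_compose[of "\<lambda>b. (0, b)"] bounded_linear_Pair
        bounded_linear_ident bounded_linear_zero)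
  then show ?thesis by simp
qed

text \<open>Bootstrapping: \<open>F\<close> composed with \<open>u\<close> is as differentiable as
  \<open>u\<close>, and it is the derivative of \<open>u\<close>.\<close>

lemma ode_solution_smooth:
  fixes F :: "'a::euclidean_space \<Rightarrow> 'a"
  assumes "open I" "smooth_on S F" "\<And>t. t \<in> I \<Longrightarrow> u t \<in> S"
    and u: "\<And>t. t \<in> I \<Longrightarrow> (u has_vector_derivative F (u t)) (at t)"
  shows "smooth_on I u"
proof -
  have "C_on k I u" for k
  proof (induction k)
    case 0
    then show ?case
      using u by (auto intro!: continuous_at_imp_continuous_on has_vector_derivative_continuous)
  next
    case (Suc k)
    show ?case
    proof (rule C_on_SucI[OF \<open>open I\<close> u[unfolded has_vector_derivative_def]])
      have "C_on k I (\<lambda>t. F (u t))"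
        by (rule C_on_compose[OF \<open>open I\<close> Suc smooth_onD[OF assms(2)]]) (use assms(3) in auto)
      then show "C_on k I (\<lambda>t. v *\<^sub>R F (u t))" for v
        by (rule C_on_bounded_linear_compose[OF bounded_linear_scaleR_right \<open>open I\<close>])
    qed
  qed
  then show ?thesis by (simp add: smooth_on_def)
qed

lemma smooth_on_vector2:
  fixes a b :: "'a::euclidean_space \<Rightarrow> real"
  shows "open S \<Longrightarrow> smooth_on S a \<Longrightarrow> smooth_on S b \<Longrightarrow> smooth_on S (\<lambda>x. vector [a x, b x] :: real^2)"
  by (simp add: smooth_on_vec_iff forall_2)

context surface_connection
begin

text \<open>Only geodesics that are graphs over the first axis are used. Their velocity extends to a vector field
  depending on the first coordinate alone, and the missing vertical direction does not matter because the
  condition obtained below is polynomial in the slope.\<close>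

lemma geodesic_graph_exists:
  assumes x0: "x0 \<in> \<phi> ` U"
  obtains r x z where "r > 0" "x 0 = x0" "z 0 = m"
    "\<And>t. t \<in> {-r<..<r} \<Longrightarrow> x t \<in> \<phi> ` U"
    "smooth_on {-r<..<r} x" "smooth_on {-r<..<r} z"
    "\<And>t. t \<in> {-r<..<r} \<Longrightarrow> (x has_vector_derivative vector [1, z t]) (at t)"
    "\<And>t. t \<in> {-r<..<r} \<Longrightarrow> (z has_real_derivative
      z t * G (x t) (vector [1, z t]) (vector [1, z t]) $ 1 - G (x t) (vector [1, z t]) (vector [1, z t]) $ 2) (at t)"
proof -
  define V where "V w = (vector [1, snd w] :: real^2)" for w :: "(real^2) \<times> real"
  \<comment> \<open>The geodesic equation for velocity \<open>V = (1, z)\<close>: the first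
    component of \<open>(0, z') + G(V, V) = f V\<close> gives \<open>f\<close> as the first
    component of \<open>G(V, V)\<close>, and the second then gives \<open>z'\<close>.\<close>
  define F where "F w = (V w, snd w * G (fst w) (V w) (V w) $ 1 - G (fst w) (V w) (V w) $ 2)" for w
  define S where "S = (\<phi> ` U) \<times> (UNIV :: real set)"
  have S: "open S" unfolding S_def by (intro open_Times open_\<phi>U open_UNIV)
  note snd = smooth_on_bounded_linear_compose[OF bounded_linear_snd S smooth_on_id[OF S]]
  note fst = smooth_on_bounded_linear_compose[OF bounded_linear_fst S smooth_on_id[OF S]]
  have V: "smooth_on S V"
    unfolding V_def[abs_def] by (intro smooth_on_vector2 S smooth_on_const snd)
  have \<Gamma>: "smooth_on S (\<lambda>w. \<Gamma> i j (fst w))" for i j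
    by (rule smooth_on_compose[OF S fst smooth_\<Gamma>]) (auto simp: S_def)
  have F: "smooth_on S F"
    unfolding F_def[abs_def] G_def by (intro smooth_on_Pair smooth_intros S V \<Gamma> snd)
  have "(x0, m) \<in> S" using x0 by (simp add: S_def)
  then obtain r u where r: "r > 0" and u0: "u 0 = (x0, m)" and uS: "\<And>t. t \<in> {-r<..<r} \<Longrightarrow> u t \<in> S"
    and u: "\<And>t. t \<in> {-r<..<r} \<Longrightarrow> (u has_vector_derivative F (u t)) (at t)"
    using ode_local_existence[OF S smooth_onD[OF F]] by blast
  have su: "smooth_on {-r<..<r} u"
    by (rule ode_solution_smooth[OF _ F uS u]) auto
  show ?thesis
  proof (rule that[of r "\<lambda>t. fst (u t)" "\<lambda>t. snd (u t)"])
    show "smooth_on {-r<..<r} (\<lambda>t. fst (u t))"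
      by (rule smooth_on_bounded_linear_compose[OF bounded_linear_fst _ su]) auto
    show "smooth_on {-r<..<r} (\<lambda>t. snd (u t))"
      by (rule smooth_on_bounded_linear_compose[OF bounded_linear_snd _ su]) auto
    fix t assume t: "t \<in> {-r<..<r}"
    show "fst (u t) \<in> \<phi> ` U" using uS[OF t] by (auto simp: S_def)
    show "((\<lambda>t. fst (u t)) has_vector_derivative vector [1, snd (u t)]) (at t)"
      using bounded_linear.has_vector_derivative[OF bounded_linear_fst u[OF t]] by (simp add: F_def V_def)
    show "((\<lambda>t. snd (u t)) has_real_derivative
       snd (u t) * G (fst (u t)) (vector [1, snd (u t)]) (vector [1, snd (u t)]) $ 1
        - G (fst (u t)) (vector [1, snd (u t)]) (vector [1, snd (u t)]) $ 2) (at t)"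
      using bounded_linear.has_vector_derivative[OF bounded_linear_snd u[OF t]]
      by (simp add: F_def V_def has_real_derivative_iff_has_vector_derivative)
  qed (use r u0 in auto)
qed

text \<open>The acceleration \<open>(0, z') + G(V, V)\<close> equals \<open>f V\<close> by the
  equation for \<open>z\<close>. Since the first coordinate along the curve is time up to a
  constant, the velocity can be read off from the point, which gives the required field.\<close>

lemma geodesic_graph_is_geodesic:
  assumes r: "r > 0" and xU: "\<And>t. t \<in> {-r<..<r} \<Longrightarrow> x t \<in> \<phi> ` U"
    and sx: "smooth_on {-r<..<r} x" and sz: "smooth_on {-r<..<r} z"
    and dx: "\<And>t. t \<in> {-r<..<r} \<Longrightarrow> (x has_vector_derivative vector [1, z t]) (at t)"
    and dz: "\<And>t. t \<in> {-r<..<r} \<Longrightarrow> (z has_real_derivative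
      z t * G (x t) (vector [1, z t]) (vector [1, z t]) $ 1 - G (x t) (vector [1, z t]) (vector [1, z t]) $ 2) (at t)"
  shows "geodesic A nabla {-r<..<r} (\<lambda>t. \<psi> (x t))"
proof -
  define I where "I = {-r<..<r}"
  define \<gamma> where "\<gamma> t = \<psi> (x t)" for t
  define V where "V t = (vector [1, z t] :: real^2)" for t
  define f where "f t = G (x t) (V t) (V t) $ 1" for t
  have I: "open I" "0 \<in> I" using r by (auto simp: I_def)
  have \<gamma>: "\<gamma> ` I \<subseteq> U" using xU \<psi>_in by (auto simp: \<gamma>_def I_def)
  have \<phi>\<gamma>: "\<phi> (\<gamma> t) = x t" if "t \<in> I" for t using xU that by (auto simp: \<gamma>_def I_def \<phi>_\<psi>)
  have d\<phi>\<gamma>: "((\<lambda>t. \<phi> (\<gamma> t)) has_vector_derivative V t) (at t)" if t: "t \<in> I" for t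
  proof (rule has_vector_derivative_transform_within_open[OF _ I(1) t])
    show "(x has_vector_derivative V t) (at t)" using dx[of t] t by (simp add: I_def V_def)
  qed (simp add: \<phi>\<gamma>)
  have vel: "velocity A \<gamma> t = tvec (\<gamma> t) (V t)" if "t \<in> I" for t
    by (rule velocity_eq[OF I(1) that \<gamma> d\<phi>\<gamma>[OF that]])
  have cont: "continuous_on I \<gamma>"
    unfolding \<gamma>_def[abs_def] using xU smooth_on_imp_continuous_on[OF sx]
    by (intro continuous_on_compose2[OF continuous_\<psi>]) (auto simp: I_def)
  have "smooth_on I x" using sx by (simp add: I_def)
  then have "smooth_on I (\<lambda>t. \<phi> (\<gamma> t))"
    by (subst smooth_on_cong[OF I(1) \<phi>\<gamma>])
  then have curve: "smooth_curve A I \<gamma>" using smooth_curve_iff[OF I(1) \<gamma> cont] by simp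
  have sV: "smooth_on I V" unfolding V_def[abs_def] using sz I(1)
    by (intro smooth_on_vector2 smooth_on_const) (auto simp: I_def)
  have s\<Gamma>: "smooth_on I (\<lambda>t. \<Gamma> i j (x t))" for i j
    using sx xU by (intro smooth_on_compose[OF I(1) _ smooth_\<Gamma>]) (auto simp: I_def)
  have sf: "smooth_on I f"
    unfolding f_def[abs_def] G_def by (intro smooth_intros I(1) sV s\<Gamma>)
  have x1: "x t $ 1 - x 0 $ 1 = t" if "t \<in> I" for t
  proof -
    have "x t $ 1 - t = x 0 $ 1 - 0"
    proof (rule DERIV_isconst3[of "-r" r t 0 "\<lambda>t. x t $ 1 - t"])
      fix s assume "s \<in> {-r<..<r}"
      from bounded_linear.has_vector_derivative[OF bounded_linear_vec_nth dx[OF this], of 1]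
      have "((\<lambda>s. x s $ 1) has_real_derivative 1) (at s)"
        by (simp add: has_real_derivative_iff_has_vector_derivative)
      from DERIV_diff[OF this DERIV_ident] show "((\<lambda>t. x t $ 1 - t) has_real_derivative 0) (at s)" by simp
    qed (use that r in \<open>auto simp: I_def\<close>)
    then show ?thesis by simp
  qed
  \<comment> \<open>The strip of points whose first coordinate is attained by the curve; there
    \<open>V\<close> is evaluated at times in \<open>I\<close> only, where it is smooth.\<close>
  define W where "W = U \<inter> \<phi> -` ((\<lambda>y. y $ 1 - x 0 $ 1) -` I)"
  have "open ((\<lambda>y :: real^2. y $ 1 - x 0 $ 1) -` I)"
    by (intro open_vimage I(1) continuous_intros)
  then have W: "open W" "W \<subseteq> U"
    using open_preimage by (auto simp: W_def)
  have \<gamma>W: "\<gamma> t \<in> W" if "t \<in> I" for t using that \<gamma> by (auto simp: W_def \<phi>\<gamma> x1)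
  define \<xi> where "\<xi> y = V (y $ 1 - x 0 $ 1)" for y :: "real^2"
  have "smooth_on (\<phi> ` W) \<xi>"
    unfolding \<xi>_def[abs_def]
    by (rule smooth_on_compose[OF open_image[OF W] _ sV])
      (auto simp: W_def intro!: smooth_intros open_image open_preimage open_vimage I(1) continuous_intros)
  note X = tvec_field(1)[OF W this]
  have X\<gamma>: "tvec (\<gamma> t) (\<xi> (\<phi> (\<gamma> t))) = velocity A \<gamma> t" if "t \<in> I" for t
    using that by (simp add: vel \<phi>\<gamma> \<xi>_def x1)
  have acc: "has_acceleration A nabla \<gamma> t (f t *\<^sub>R velocity A \<gamma> t)" if t: "t \<in> I" for t
    unfolding has_acceleration_def
  proof (intro exI conjI)
    have \<gamma>t: "\<gamma> t \<in> U" using t \<gamma> by auto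
    show "\<forall>\<^sub>F s in nhds t. tvec (\<gamma> s) (\<xi> (\<phi> (\<gamma> s))) = velocity A \<gamma> s"
      using I(1) t X\<gamma> unfolding eventually_nhds by blast
    have vt: "velocity A \<gamma> t \<in> tangent_space A (\<gamma> t)" by (simp add: vel t tvec_in \<gamma>t)
    let ?z' = "z t * G (x t) (V t) (V t) $ 1 - G (x t) (V t) (V t) $ 2"
    have dV: "(V has_vector_derivative ?z' *\<^sub>R axis 2 1) (at t)"
    proof -
      have "((\<lambda>t. axis 1 1 + z t *\<^sub>R axis 2 1 :: real^2) has_vector_derivative 0 + ?z' *\<^sub>R axis 2 1) (at t)"
        using dz t unfolding has_real_derivative_iff_has_vector_derivative
        by (intro has_vector_derivative_add has_vector_derivative_const
            bounded_linear.has_vector_derivative[OF bounded_linear_scaleR_left]) (auto simp: I_def V_def)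
      moreover have "V = (\<lambda>t. axis 1 1 + z t *\<^sub>R axis 2 1)"
        by (simp add: fun_eq_iff V_def vec_eq_iff forall_2 axis_def)
      ultimately show ?thesis by simp
    qed
    have "coords (nabla (\<lambda>q. tvec q (\<xi> (\<phi> q))) (\<gamma> t) (velocity A \<gamma> t))
        = ?z' *\<^sub>R axis 2 1 + G (\<phi> (\<gamma> t)) (V t) (V t)"
      by (rule acceleration_coords[OF I(1) t \<gamma> d\<phi>\<gamma> W \<gamma>W[OF t] X X\<gamma> dV])
    also have "\<dots> = f t *\<^sub>R V t"
      by (simp add: \<phi>\<gamma> t f_def V_def vec_eq_iff forall_2 axis_def)
    also have "\<dots> = coords (f t *\<^sub>R velocity A \<gamma> t)"
      by (simp add: vel t coords_scaleR \<gamma>t)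
    finally have "nabla (\<lambda>q. tvec q (\<xi> (\<phi> q))) (\<gamma> t) (velocity A \<gamma> t) = f t *\<^sub>R velocity A \<gamma> t"
      by (intro tangent_eqI[OF \<gamma>t] nabla_in[OF W X \<gamma>W[OF t] vt] tangent_space_scaleR[OF \<gamma>t vt])
    then show "f t *\<^sub>R velocity A \<gamma> t = nabla (\<lambda>q. tvec q (\<xi> (\<phi> q))) (\<gamma> t) (velocity A \<gamma> t)" by simp
  qed (rule W X \<gamma>W[OF t])+
  have "velocity A \<gamma> t \<noteq> 0" if t: "t \<in> I" for t
  proof
    have \<gamma>t: "\<gamma> t \<in> U" using t \<gamma> by auto
    assume "velocity A \<gamma> t = 0"
    then have "coords (velocity A \<gamma> t) $ 1 = 0" by (simp add: coords_def)
    then show False by (simp add: vel t \<gamma>t V_def)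
  qed
  then have "geodesic A nabla I \<gamma>"
    using I(1) curve sf acc by (auto simp: geodesic_def I_def is_interval_oo)
  then show ?thesis by (simp add: I_def \<gamma>_def[abs_def])
qed

text \<open>The geodesic graph through \<open>x0\<close> with slope \<open>m\<close> lies on a line,
  so its slope \<open>z\<close> is constant. The equation for \<open>z\<close> at time 0 then says
  that its right-hand side vanishes.\<close>

lemma straight_geodesics_slope:
  assumes straight: "straightens_geodesics A nabla (U, \<phi>)" and x0: "x0 \<in> \<phi> ` U"
  shows "m * G x0 (vector [1, m]) (vector [1, m]) $ 1 = G x0 (vector [1, m]) (vector [1, m]) $ 2"
proof -
  obtain r x z where r: "r > 0" "x 0 = x0" "z 0 = m"
    and xU: "\<And>t. t \<in> {-r<..<r} \<Longrightarrow> x t \<in> \<phi> ` U"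
    and sm: "smooth_on {-r<..<r} x" "smooth_on {-r<..<r} z"
    and dx: "\<And>t. t \<in> {-r<..<r} \<Longrightarrow> (x has_vector_derivative vector [1, z t]) (at t)"
    and dz: "\<And>t. t \<in> {-r<..<r} \<Longrightarrow> (z has_real_derivative
      z t * G (x t) (vector [1, z t]) (vector [1, z t]) $ 1 - G (x t) (vector [1, z t]) (vector [1, z t]) $ 2) (at t)"
    using geodesic_graph_exists[OF x0, of m] by blast
  let ?\<gamma> = "\<lambda>t. \<psi> (x t)"
  have geo: "geodesic A nabla {-r<..<r} ?\<gamma>"
    by (rule geodesic_graph_is_geodesic[OF r(1) xU sm dx dz])
  have "?\<gamma> ` {-r<..<r} \<subseteq> U" using xU \<psi>_in by auto
  note straight[unfolded straightens_geodesics_def fst_conv snd_conv, rule_format, OF conjI[OF geo this]]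
  then obtain L where L: "affine L" "aff_dim L = 1" "\<phi> ` ?\<gamma> ` {-r<..<r} \<subseteq> L" by auto
  have "\<exists>a b. a \<noteq> 0 \<and> affine hull L = {x. a \<bullet> x = b}"
    unfolding aff_dim_eq_hyperplane[symmetric] using L(2) by simp
  then obtain a b where ab: "a \<noteq> 0" "L = {x. a \<bullet> x = b}"
    using iffD2[OF affine_hull_eq L(1)] by auto
  have "x t \<in> L" if "t \<in> {-r<..<r}" for t
    using L(3) that \<phi>_\<psi>[OF xU[OF that]] by (metis imageI subsetD)
  then have line: "a \<bullet> x t = b" if "t \<in> {-r<..<r}" for t using that ab by auto
  have slope: "a $ 1 + a $ 2 * z t = 0" if t: "t \<in> {-r<..<r}" for t
  proof -
    have "((\<lambda>t. a \<bullet> x t) has_real_derivative a \<bullet> vector [1, z t]) (at t)"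
      using bounded_linear.has_vector_derivative[OF bounded_linear_inner_right dx[OF t]]
      by (simp add: has_real_derivative_iff_has_vector_derivative)
    then have "((\<lambda>t. b) has_real_derivative a \<bullet> vector [1, z t]) (at t)"
      by (rule has_field_derivative_transform_within_open[OF _ _ t]) (use line in auto)
    then have "a \<bullet> vector [1, z t] = 0" using DERIV_const DERIV_unique by blast
    then show ?thesis by (simp add: inner_vec_def sum_2)
  qed
  have 0: "0 \<in> {-r<..<r}" using r by simp
  let ?z' = "m * G x0 (vector [1, m]) (vector [1, m]) $ 1 - G x0 (vector [1, m]) (vector [1, m]) $ 2"
  have "((\<lambda>t. a $ 1 + a $ 2 * z t) has_real_derivative a $ 2 * ?z') (at 0)"
    using dz[OF 0] r by (auto intro!: derivative_eq_intros)
  then have "((\<lambda>t. 0) has_real_derivative a $ 2 * ?z') (at 0)"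
    by (rule has_field_derivative_transform_within_open[OF _ _ 0]) (use slope in auto)
  then have "a $ 2 * ?z' = 0" using DERIV_const DERIV_unique by blast
  \<comment> \<open>The line cannot be vertical, because the curve moves with unit speed in the
    first coordinate.\<close>
  moreover have "a $ 2 \<noteq> 0"
    using slope[OF 0] ab(1) by (auto simp: vec_eq_iff forall_2)
  ultimately show ?thesis by simp
qed

text \<open>The coefficients of the cubic polynomial in the slope vanish, so that
  \<open>\<Gamma>\<^sup>c\<^sub>a\<^sub>b = \<delta>\<^sup>c\<^sub>a \<omega>\<^sub>b + \<delta>\<^sup>c\<^sub>b \<omega>\<^sub>a\<close> with \<open>\<omega> = (\<Gamma>\<^sup>2\<^sub>1\<^sub>2, \<Gamma>\<^sup>1\<^sub>1\<^sub>2)\<close>.\<close>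

lemma straight_geodesics_christoffel:
  assumes straight: "straightens_geodesics A nabla (U, \<phi>)" and x: "x \<in> \<phi> ` U"
  shows "\<Gamma> 1 1 x $ 2 = 0" "\<Gamma> 2 2 x $ 1 = 0" "\<Gamma> 1 1 x $ 1 = 2 * \<Gamma> 1 2 x $ 2" "\<Gamma> 2 2 x $ 2 = 2 * \<Gamma> 1 2 x $ 1"
  \<comment> \<open>A cubic polynomial that vanishes at the four slopes 0, 1, -1 and 2 is zero; its
    coefficients are the four asserted combinations.\<close>
  using straight_geodesics_slope[OF assms, of 0] straight_geodesics_slope[OF assms, of 1]
    straight_geodesics_slope[OF assms, of "-1"] straight_geodesics_slope[OF assms, of 2]
  by (simp_all add: G_def \<Gamma>_symmetric[OF x, of 2 1])

text \<open>With \<open>\<omega> = (a, b)\<close> closed, the Ricci tensor is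
  \<open>\<omega> \<otimes> \<omega>\<close> minus the coordinate derivative of
  \<open>\<omega>\<close>. In \<open>cotton\<close> its second derivatives cancel because partial
  derivatives commute, and the remaining terms cancel because \<open>\<omega>\<close> is
  closed.\<close>

lemma straight_geodesics_cotton:
  assumes straight: "straightens_geodesics A nabla (U, \<phi>)" and sym: "ricci_symmetric A nabla"
    and x: "x \<in> \<phi> ` U"
  shows "cotton 1 x = 0" "cotton 2 x = 0"
proof -
  note ch = straight_geodesics_christoffel[OF straight]
  define a where "a y = \<Gamma> 1 2 y $ 2" for y
  define b where "b y = \<Gamma> 1 2 y $ 1" for y
  define D where "D k f y = frechet_derivative f (at y) (axis k 1)" for k :: 2 and f :: "real^2 \<Rightarrow> real" and y
  have sa: "smooth_on (\<phi> ` U) a" and sb: "smooth_on (\<phi> ` U) b"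
    unfolding a_def[abs_def] b_def[abs_def] by (intro smooth_on_nth open_\<phi>U smooth_\<Gamma>)+
  have sD: "smooth_on (\<phi> ` U) (D k f)" if "smooth_on (\<phi> ` U) f" for k f
    unfolding D_def[abs_def] by (rule smooth_on_frechet_derivative[OF that])
  have Dder: "(f has_derivative frechet_derivative f (at y)) (at y)" if "smooth_on (\<phi> ` U) f" "y \<in> \<phi> ` U"
    for f :: "real^2 \<Rightarrow> real" and y
    by (rule smooth_on_has_derivative[OF that])
  have Dcong: "D k f y = D k g y" if "y \<in> \<phi> ` U" "smooth_on (\<phi> ` U) f" "\<And>y. y \<in> \<phi> ` U \<Longrightarrow> f y = g y"
    for k f g y
    unfolding D_def
    by (subst frechet_derivative_cong[OF open_\<phi>U that(1,3)]) (use Dder[OF that(2,1)] in \<open>auto simp: differentiable_def\<close>)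
  have Dadd: "D k (\<lambda>y. f y + g y) y = D k f y + D k g y"
    and Dmult: "D k (\<lambda>y. f y * g y) y = f y * D k g y + D k f y * g y"
    and Dminus: "D k (\<lambda>y. - f y) y = - D k f y"
    and Dcmult: "D k (\<lambda>y. c * f y) y = c * D k f y"
    if "smooth_on (\<phi> ` U) f" "smooth_on (\<phi> ` U) g" "y \<in> \<phi> ` U" for k f g y c
    using frechet_derivative_at[OF has_derivative_add[OF Dder[OF that(1,3)] Dder[OF that(2,3)]], symmetric]
      frechet_derivative_at[OF has_derivative_mult[OF Dder[OF that(1,3)] Dder[OF that(2,3)]], symmetric]
      frechet_derivative_at[OF has_derivative_minus[OF Dder[OF that(1,3)]], symmetric]
      frechet_derivative_at[OF has_derivative_mult_right[OF Dder[OF that(1,3)]], symmetric, of c]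
    by (simp_all add: D_def)
  have d\<Gamma>: "d\<Gamma> k i j y $ l = D k (\<lambda>y. \<Gamma> i j y $ l) y" if "y \<in> \<phi> ` U" for k i j l y
    using \<Gamma>_has_derivative[OF that] unfolding d\<Gamma>_def D_def
    by (intro frechet_derivative_nth) (auto simp: differentiable_def)
  have s\<Gamma>: "smooth_on (\<phi> ` U) (\<lambda>y. \<Gamma> i j y $ l)" for i j l
    by (intro smooth_on_nth open_\<phi>U smooth_\<Gamma>)
  have zero: "D k (\<lambda>y. 0) y = 0" for k y
    by (simp add: D_def frechet_derivative_const)
  have d: "d\<Gamma> k 1 1 y $ 1 = 2 * D k a y" "d\<Gamma> k 1 1 y $ 2 = 0"
    "d\<Gamma> k 1 2 y $ 1 = D k b y" "d\<Gamma> k 1 2 y $ 2 = D k a y"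
    "d\<Gamma> k 2 1 y $ 1 = D k b y" "d\<Gamma> k 2 1 y $ 2 = D k a y"
    "d\<Gamma> k 2 2 y $ 1 = 0" "d\<Gamma> k 2 2 y $ 2 = 2 * D k b y" if y: "y \<in> \<phi> ` U" for k y
    using Dcong[OF y s\<Gamma>[of 1 1 1], of "\<lambda>y. 2 * a y" k] Dcong[OF y s\<Gamma>[of 1 1 2], of "\<lambda>y. 0" k]
      Dcong[OF y s\<Gamma>[of 2 2 1], of "\<lambda>y. 0" k] Dcong[OF y s\<Gamma>[of 2 2 2], of "\<lambda>y. 2 * b y" k]
      Dcong[OF y s\<Gamma>[of 2 1 1], of b k] Dcong[OF y s\<Gamma>[of 2 1 2], of a k]
      Dcmult[OF sa sa y, of k 2] Dcmult[OF sb sb y, of k 2] ch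
    by (simp_all add: d\<Gamma>[OF y] zero a_def[abs_def] b_def[abs_def] \<Gamma>_symmetric[of _ 2 1])
  have \<rho>s: "\<rho> 1 1 y = - D 1 a y + a y * a y" "\<rho> 2 2 y = - D 2 b y + b y * b y"
    "\<rho> 1 2 y = - 2 * D 1 b y + D 2 a y + a y * b y" "\<rho> 2 1 y = D 1 b y - 2 * D 2 a y + a y * b y"
    if y: "y \<in> \<phi> ` U" for y
    using ch[OF y] by (simp_all add: \<rho>_1 \<rho>_2 G_def d[OF y] axis_def \<Gamma>_symmetric[OF y, of 2 1] a_def b_def)
  \<comment> \<open>By the formulas above, \<open>\<rho> 1 2 - \<rho> 2 1\<close> is three times
    \<open>D 2 a - D 1 b\<close>.\<close>
  have closed: "D 1 b y = D 2 a y" if y: "y \<in> \<phi> ` U" for y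
    using \<rho>_symmetric[OF sym y, of 1 2] \<rho>s[OF y] by simp
  have \<rho>12: "\<rho> 1 2 y = - D 1 b y + a y * b y" and \<rho>21: "\<rho> 2 1 y = - D 2 a y + a y * b y"
    if "y \<in> \<phi> ` U" for y
    using \<rho>s(3,4)[OF that] closed[OF that] by auto
  have comm: "D k (D l f) x = D l (D k f) x" if "smooth_on (\<phi> ` U) f" for k l f
    unfolding D_def using frechet_derivative_commute_real[OF open_\<phi>U smooth_onD[OF that] x] by simp
  have prod: "D k (\<lambda>y. - D l f y + g y * h y) x = - D k (D l f) x + (g x * D k h x + D k g x * h x)"
    if "smooth_on (\<phi> ` U) f" "smooth_on (\<phi> ` U) g" "smooth_on (\<phi> ` U) h" for k l f g h
    using that
    by (subst Dadd) (auto simp: Dminus[OF sD[OF that(1)] sD[OF that(1)] x] Dmult[OF that(2,3) x]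
        intro!: smooth_intros sD open_\<phi>U x)
  have d\<rho>: "d\<rho> k i j x = D k (\<lambda>y. \<rho> i j y) x" for k i j by (simp add: d\<rho>_def D_def)
  have "d\<rho> 1 2 1 x = - D 1 (D 2 a) x + (a x * D 1 b x + D 1 a x * b x)"
    "d\<rho> 2 1 1 x = - D 2 (D 1 a) x + (a x * D 2 a x + D 2 a x * a x)"
    "d\<rho> 1 2 2 x = - D 1 (D 2 b) x + (b x * D 1 b x + D 1 b x * b x)"
    "d\<rho> 2 1 2 x = - D 2 (D 1 b) x + (a x * D 2 b x + D 2 a x * b x)"
    unfolding d\<rho>
    using Dcong[OF x smooth_\<rho>[of 2 1] \<rho>21, of 1] Dcong[OF x smooth_\<rho>[of 1 1] \<rho>s(1), of 2]
      Dcong[OF x smooth_\<rho>[of 2 2] \<rho>s(2), of 1] Dcong[OF x smooth_\<rho>[of 1 2] \<rho>12, of 2]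
      prod[OF sa sa sb, of 1 2] prod[OF sa sa sa, of 2 1] prod[OF sb sb sb, of 1 2] prod[OF sb sa sb, of 2 1]
    by simp_all
  moreover have "\<Gamma> 1 1 x $ 1 = 2 * a x" "\<Gamma> 1 1 x $ 2 = 0" "\<Gamma> 1 2 x $ 1 = b x" "\<Gamma> 1 2 x $ 2 = a x"
    "\<Gamma> 2 1 x $ 1 = b x" "\<Gamma> 2 1 x $ 2 = a x" "\<Gamma> 2 2 x $ 1 = 0" "\<Gamma> 2 2 x $ 2 = 2 * b x"
    using ch[OF x] by (simp_all add: a_def b_def \<Gamma>_symmetric[OF x, of 2 1])
  ultimately show "cotton 1 x = 0" "cotton 2 x = 0"
    using closed[OF x] comm[OF sa, of 1 2] comm[OF sb, of 1 2]
    by (simp_all add: cotton_def \<rho>12[OF x] \<rho>21[OF x] \<rho>s(1,2)[OF x] algebra_simps)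
qed

end

section \<open>Vanishing of the Cotton-York tensor yields straightening coordinates\<close>

context surface_chart
begin

text \<open>Transition maps of the new chart are those of the old one composed with \<open>h\<close>
  or with its smooth inverse \<open>g\<close>. This turns the diffeomorphism built from solutions
  into a chart compatible with the atlas.\<close>

lemma coordinate_chart_compose:
  assumes V: "open V" "V \<subseteq> \<phi> ` U" "open (h ` V)" and hom: "homeomorphism V (h ` V) h g"
    and h: "smooth_on V h" and g: "smooth_on (h ` V) g"
  shows "coordinate_chart A (U \<inter> \<phi> -` V, \<lambda>q. h (\<phi> q))"
proof -
  define N where "N = U \<inter> \<phi> -` V"
  define \<kappa> where "\<kappa> q = h (\<phi> q)" for q
  have N: "open N" "N \<subseteq> U" "\<phi> ` N = V"
    using open_preimage[OF V(1)] V(2) by (auto simp: N_def)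
  have \<kappa>N: "\<kappa> ` N = h ` V" using N(3) by (force simp: \<kappa>_def)
  have gh: "g (h y) = y" if "y \<in> V" for y using hom that by (simp add: homeomorphism_def)
  have inj: "inj_on \<kappa> N"
    by (rule inj_on_inverseI[of _ "\<lambda>y. \<psi> (g y)"]) (use gh \<psi>_\<phi> in \<open>auto simp: \<kappa>_def N_def\<close>)
  have inv: "inv_into N \<kappa> y = \<psi> (g y)" if y: "y \<in> h ` V" for y
  proof -
    obtain q where q: "q \<in> N" "y = \<kappa> q" using y \<kappa>N by auto
    have "inv_into N \<kappa> y = q" using inv_into_f_f[OF inj q(1)] q(2) by simp
    also have "q = \<psi> (g y)" using q gh \<psi>_\<phi> by (auto simp: \<kappa>_def N_def)
    finally show ?thesis .
  qed
  have homN: "homeomorphism N (h ` V) \<kappa> (inv_into N \<kappa>)"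
  proof (rule homeomorphismI)
    show "continuous_on N \<kappa>"
      unfolding \<kappa>_def[abs_def]
      by (rule continuous_on_compose2[OF smooth_on_imp_continuous_on[OF h]
            continuous_on_subset[OF continuous_\<phi> N(2)]]) (use N(3) in auto)
    have "g ` h ` V \<subseteq> \<phi> ` U" using gh V(2) by auto
    then have "continuous_on (h ` V) (\<lambda>y. \<psi> (g y))"
      by (rule continuous_on_compose2[OF continuous_\<psi> smooth_on_imp_continuous_on[OF g]])
    then show "continuous_on (h ` V) (inv_into N \<kappa>)"
      using inv by (simp cong: continuous_on_cong)
    show "\<kappa> ` N \<subseteq> h ` V" using \<kappa>N by simp
    show "inv_into N \<kappa> ` h ` V \<subseteq> N" using inv_into_into[of _ \<kappa> N] \<kappa>N by auto
    show "inv_into N \<kappa> (\<kappa> q) = q" if "q \<in> N" for q using inv_into_f_f[OF inj that] .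
    show "\<kappa> (inv_into N \<kappa> y) = y" if "y \<in> h ` V" for y using f_inv_into_f[of y \<kappa> N] that \<kappa>N by auto
  qed
  have comp: "smooth_compatible (N, \<kappa>) d" if d: "d \<in> A" for d
  proof -
    have dc: "coordinate_chart A d" using atlas d by (auto simp: smooth_atlas_def)
    have Nd: "open (N \<inter> fst d)" "N \<inter> fst d \<subseteq> U" using N dc by (auto simp: coordinate_chart_def)
    have sub: "\<phi> ` (N \<inter> fst d) \<subseteq> V" using N(3) by auto
    have trans: "smooth_on (\<phi> ` (U \<inter> fst d)) (snd d \<circ> \<psi>)"
      "smooth_on (snd d ` (U \<inter> fst d)) (\<phi> \<circ> inv_into (fst d) (snd d))"
      using chart d by (auto simp: coordinate_chart_def smooth_compatible_def \<psi>_def)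
    \<comment> \<open>Writing the image as a preimage under the continuous map \<open>g\<close>
      shows that it is open.\<close>
    have img: "\<kappa> ` (N \<inter> fst d) = h ` V \<inter> g -` (\<phi> ` (N \<inter> fst d))"
      using gh N(3) sub by (force simp: \<kappa>_def)
    have op: "open (\<kappa> ` (N \<inter> fst d))"
      unfolding img using open_image[OF Nd] smooth_on_imp_continuous_on[OF g] V(3)
      by (intro continuous_open_preimage)
    have "smooth_on (\<kappa> ` (N \<inter> fst d)) (\<lambda>y. (snd d \<circ> \<psi>) (g y))"
    proof (rule smooth_on_compose[where f = g and g = "snd d \<circ> \<psi>", OF op _ trans(1)])
      show "smooth_on (\<kappa> ` (N \<inter> fst d)) g" by (rule smooth_on_subset[OF g]) (use img in auto)
      show "g ` \<kappa> ` (N \<inter> fst d) \<subseteq> \<phi> ` (U \<inter> fst d)" using img N(2) by auto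
    qed
    moreover have "(snd d \<circ> inv_into N \<kappa>) y = (snd d \<circ> \<psi>) (g y)" if "y \<in> \<kappa> ` (N \<inter> fst d)" for y
      using inv[of y] that img by auto
    ultimately have 1: "smooth_on (\<kappa> ` (N \<inter> fst d)) (snd d \<circ> inv_into N \<kappa>)"
      by (subst smooth_on_cong[OF op])
    have op2: "open (snd d ` (N \<inter> fst d))"
      using coordinate_chart_open_image[OF dc Nd(1)] by auto
    have "smooth_on (snd d ` (N \<inter> fst d)) (\<lambda>y. h ((\<phi> \<circ> inv_into (fst d) (snd d)) y))"
    proof (rule smooth_on_compose[where g = h, OF op2 _ h])
      show "smooth_on (snd d ` (N \<inter> fst d)) (\<phi> \<circ> inv_into (fst d) (snd d))"
        by (rule smooth_on_subset[OF trans(2)]) (use N(2) in auto)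
      show "(\<phi> \<circ> inv_into (fst d) (snd d)) ` snd d ` (N \<inter> fst d) \<subseteq> V"
        using coordinate_chart_inv[OF dc] sub by auto
    qed
    then have 2: "smooth_on (snd d ` (N \<inter> fst d)) (\<kappa> \<circ> inv_into (fst d) (snd d))"
      by (simp add: \<kappa>_def[abs_def] o_def)
    show ?thesis using 1 2 by (simp add: smooth_compatible_def)
  qed
  have "coordinate_chart A (N, \<kappa>)"
    using N(1) V(3) homN comp by (simp add: coordinate_chart_def \<kappa>N)
  then show ?thesis by (simp add: N_def \<kappa>_def[abs_def])
qed

end

context surface_connection
begin

text \<open>The prolonged system \<open>\<partial>\<^sub>a \<sigma> = \<mu>\<^sub>a\<close>, \<open>\<partial>\<^sub>a \<mu>\<^sub>b = \<Gamma>\<^sup>c\<^sub>a\<^sub>b \<mu>\<^sub>c - R\<^sub>a\<^sub>b \<sigma>\<close> of the equation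
  \<open>\<nabla>\<^sub>a \<nabla>\<^sub>b \<sigma> + R\<^sub>a\<^sub>b \<sigma> = 0\<close>, for the vector \<open>(\<sigma>, \<mu>\<^sub>1, \<mu>\<^sub>2)\<close>. Its curvature is the Cotton-York tensor.\<close>

definition prolong :: "2 \<Rightarrow> real^2 \<Rightarrow> real^3^3" where
  "prolong k x = vector [vector [0, axis k 1 $ 1, axis k 1 $ 2],
     vector [- \<rho> k 1 x, \<Gamma> k 1 x $ 1, \<Gamma> k 1 x $ 2],
     vector [- \<rho> k 2 x, \<Gamma> k 2 x $ 1, \<Gamma> k 2 x $ 2]]"

lemma prolong_apply:
  "(prolong k x *v s) $ 1 = axis k 1 $ 1 * s $ 2 + axis k 1 $ 2 * s $ 3"
  "(prolong k x *v s) $ 2 = - \<rho> k 1 x * s $ 1 + \<Gamma> k 1 x $ 1 * s $ 2 + \<Gamma> k 1 x $ 2 * s $ 3"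
  "(prolong k x *v s) $ 3 = - \<rho> k 2 x * s $ 1 + \<Gamma> k 2 x $ 1 * s $ 2 + \<Gamma> k 2 x $ 2 * s $ 3"
  by (simp_all add: prolong_def matrix_vector_mult_def sum_3)

lemma smooth_prolong: "smooth_on (\<phi> ` U) (prolong k)"
  unfolding prolong_def[abs_def] smooth_on_vec_iff[OF open_\<phi>U] forall_3 vector_3
  by (intro conjI smooth_intros open_\<phi>U smooth_\<rho> smooth_\<Gamma>)

lemma prolong_derivative:
  fixes k l :: 2
  assumes x: "x \<in> \<phi> ` U"
  defines "D \<equiv> frechet_derivative (prolong k) (at x) (axis l 1)"
  shows "D $ 1 $ j = 0"
    "D $ 2 $ 1 = - d\<rho> l k 1 x" "D $ 2 $ 2 = d\<Gamma> l k 1 x $ 1" "D $ 2 $ 3 = d\<Gamma> l k 1 x $ 2"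
    "D $ 3 $ 1 = - d\<rho> l k 2 x" "D $ 3 $ 2 = d\<Gamma> l k 2 x $ 1" "D $ 3 $ 3 = d\<Gamma> l k 2 x $ 2"
proof -
  have diff: "prolong k differentiable (at x)" "(\<lambda>y. prolong k y $ i) differentiable (at x)" for i
    using smooth_on_has_derivative[OF smooth_prolong x]
      smooth_on_has_derivative[OF smooth_on_nth[OF open_\<phi>U smooth_prolong] x]
    by (auto simp: differentiable_def)
  have D: "D $ i $ j = frechet_derivative (\<lambda>y. prolong k y $ i $ j) (at x) (axis l 1)" for i j
    unfolding D_def by (simp add: frechet_derivative_nth[OF diff(1)] frechet_derivative_nth[OF diff(2)])
  have \<rho>: "frechet_derivative (\<lambda>y. - \<rho> k j y) (at x) (axis l 1) = - d\<rho> l k j x" for j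
    using frechet_derivative_at[OF has_derivative_minus[OF smooth_on_has_derivative[OF smooth_\<rho> x]], of k j]
    by (simp add: d\<rho>_def) metis
  have \<Gamma>: "frechet_derivative (\<lambda>y. \<Gamma> k j y $ m) (at x) (axis l 1) = d\<Gamma> l k j x $ m" for j m
    using smooth_on_has_derivative[OF smooth_\<Gamma> x] unfolding d\<Gamma>_def
    by (intro frechet_derivative_nth[symmetric]) (auto simp: differentiable_def)
  show "D $ 1 $ j = 0"
    using exhaust_3[of j] by (auto simp: D prolong_def frechet_derivative_const)
  show "D $ 2 $ 1 = - d\<rho> l k 1 x" "D $ 2 $ 2 = d\<Gamma> l k 1 x $ 1" "D $ 2 $ 3 = d\<Gamma> l k 1 x $ 2"
    "D $ 3 $ 1 = - d\<rho> l k 2 x" "D $ 3 $ 2 = d\<Gamma> l k 2 x $ 1" "D $ 3 $ 3 = d\<Gamma> l k 2 x $ 2"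
    by (simp_all add: D prolong_def \<rho> \<Gamma>)
qed

text \<open>Entry by entry: the first row holds by symmetry of \<open>\<Gamma>\<close> and of the
  Ricci tensor, the lower right block says that the curvature is determined by the Ricci tensor, and
  the rest of the first column is \<open>cotton = 0\<close>.\<close>

lemma prolong_flat:
  assumes sym: "ricci_symmetric A nabla" and x: "x \<in> \<phi> ` U"
    and cotton: "cotton 1 x = 0" "cotton 2 x = 0"
  shows "frechet_derivative (prolong 1) (at x) (axis 2 1) + prolong 1 x ** prolong 2 x
    = frechet_derivative (prolong 2) (at x) (axis 1 1) + prolong 2 x ** prolong 1 x"
proof -
  note G = \<Gamma>_symmetric[OF x, of 2 1] \<rho>_symmetric[OF sym x, of 2 1]
  have \<rho>1: "\<rho> 1 j x = d\<Gamma> 2 1 j x $ 2 - d\<Gamma> 1 2 j x $ 2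
      + \<Gamma> 1 j x $ 1 * \<Gamma> 2 1 x $ 2 + \<Gamma> 1 j x $ 2 * \<Gamma> 2 2 x $ 2
      - \<Gamma> 2 j x $ 1 * \<Gamma> 1 1 x $ 2 - \<Gamma> 2 j x $ 2 * \<Gamma> 1 2 x $ 2" for j
    by (simp add: \<rho>_1 G_def axis_def)
  have \<rho>2: "\<rho> 2 j x = d\<Gamma> 1 2 j x $ 1 - d\<Gamma> 2 1 j x $ 1
      + \<Gamma> 2 j x $ 1 * \<Gamma> 1 1 x $ 1 + \<Gamma> 2 j x $ 2 * \<Gamma> 1 2 x $ 1
      - \<Gamma> 1 j x $ 1 * \<Gamma> 2 1 x $ 1 - \<Gamma> 1 j x $ 2 * \<Gamma> 2 2 x $ 1" for j
    by (simp add: \<rho>_2 G_def axis_def)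
  have axis_2: "(axis 1 1 :: real^2) $ 1 = 1" "(axis 1 1 :: real^2) $ 2 = 0"
    "(axis 2 1 :: real^2) $ 1 = 0" "(axis 2 1 :: real^2) $ 2 = 1" by (simp_all add: axis_def)
  \<comment> \<open>Both trace formulas for the off-diagonal Ricci component are needed; symmetry
    brings the one for \<open>\<rho> 2 1\<close> to the same left-hand side, in the normal form used
    for the entries.\<close>
  have \<rho>12: "\<rho> 1 2 x = d\<Gamma> 1 2 1 x $ 1 - d\<Gamma> 2 1 1 x $ 1 + \<Gamma> 1 2 x $ 2 * \<Gamma> 1 2 x $ 1 - \<Gamma> 1 1 x $ 2 * \<Gamma> 2 2 x $ 1"
    "\<rho> 1 2 x = d\<Gamma> 2 1 2 x $ 2 - d\<Gamma> 1 2 2 x $ 2 + \<Gamma> 1 2 x $ 1 * \<Gamma> 1 2 x $ 2 - \<Gamma> 2 2 x $ 1 * \<Gamma> 1 1 x $ 2"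
    using \<rho>2[of 1] \<rho>1[of 2] by (simp_all add: G)
  note facts = cotton[unfolded cotton_def G] \<rho>1[of 1, unfolded G] \<rho>2[of 2, unfolded G] \<rho>12
  show ?thesis
    unfolding vec_eq_iff forall_3
    by (intro conjI; simp add: prolong_derivative[OF x] matrix_matrix_mult_def sum_3 prolong_def axis_2 G;
        (use facts in linarith)?)
qed

definition parallel_at :: "(real^2 \<Rightarrow> real^3) \<Rightarrow> real^2 \<Rightarrow> bool" where
  "parallel_at s x \<longleftrightarrow>
     (s has_derivative (\<lambda>v. (v $ 1) *\<^sub>R (prolong 1 x *v s x) + (v $ 2) *\<^sub>R (prolong 2 x *v s x))) (at x)"

lemma parallel_at_linear_combination:
  assumes "\<And>i. parallel_at (s i) x"
  shows "parallel_at (\<lambda>x. \<Sum>i\<in>(UNIV :: 3 set). \<alpha> $ i *\<^sub>R s i x) x"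
  unfolding parallel_at_def sum_3
proof (rule has_derivative_eq_rhs)
  show "((\<lambda>x. \<alpha> $ 1 *\<^sub>R s 1 x + \<alpha> $ 2 *\<^sub>R s 2 x + \<alpha> $ 3 *\<^sub>R s 3 x) has_derivative
     (\<lambda>v. \<alpha> $ 1 *\<^sub>R ((v $ 1) *\<^sub>R (prolong 1 x *v s 1 x) + (v $ 2) *\<^sub>R (prolong 2 x *v s 1 x))
        + \<alpha> $ 2 *\<^sub>R ((v $ 1) *\<^sub>R (prolong 1 x *v s 2 x) + (v $ 2) *\<^sub>R (prolong 2 x *v s 2 x))
        + \<alpha> $ 3 *\<^sub>R ((v $ 1) *\<^sub>R (prolong 1 x *v s 3 x) + (v $ 2) *\<^sub>R (prolong 2 x *v s 3 x)))) (at x)"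
    by (intro has_derivative_add has_derivative_scaleR_right assms[unfolded parallel_at_def])
qed (simp add: fun_eq_iff matrix_vector_right_distrib matrix_vector_mult_scaleR algebra_simps)

text \<open>Along a geodesic with \<open>c'' + \<Gamma>(c', c') = f c'\<close> one has \<open>\<sigma>'' = f \<sigma>' - R(c', c') \<sigma>\<close>.\<close>

lemma parallel_along_geodesic:
  assumes geo: "geodesic A nabla I \<gamma>" and \<gamma>: "\<gamma> ` I \<subseteq> U"
    and par: "\<And>t. t \<in> I \<Longrightarrow> parallel_at s (\<phi> (\<gamma> t))"
    and c': "\<And>t. t \<in> I \<Longrightarrow> ((\<lambda>t. \<phi> (\<gamma> t)) has_vector_derivative c' t) (at t)"
    and t0: "t0 \<in> I" "s (\<phi> (\<gamma> t0)) $ 1 = 0"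
      "c' t0 $ 1 * s (\<phi> (\<gamma> t0)) $ 2 + c' t0 $ 2 * s (\<phi> (\<gamma> t0)) $ 3 = 0"
    and t: "t \<in> I"
  shows "s (\<phi> (\<gamma> t)) $ 1 = 0"
proof -
  obtain f d' d'' where f: "smooth_on I f"
    and d: "\<And>t. t \<in> I \<Longrightarrow> ((\<lambda>t. \<phi> (\<gamma> t)) has_vector_derivative d' t) (at t)"
      "\<And>t. t \<in> I \<Longrightarrow> (d' has_vector_derivative d'' t) (at t)"
    and d'': "\<And>t. t \<in> I \<Longrightarrow> d'' t = f t *\<^sub>R d' t - G (\<phi> (\<gamma> t)) (d' t) (d' t)"
    using geodesic_coords[OF geo \<gamma>] by blast
  \<comment> \<open>The velocity in the hypotheses and the one that comes with the geodesic equation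
    are obtained separately; uniqueness of derivatives identifies them.\<close>
  have eq: "c' t = d' t" if "t \<in> I" for t
    by (rule vector_derivative_unique_at[OF c'[OF that] d(1)[OF that]])
  define x where "x t = \<phi> (\<gamma> t)" for t
  define S where "S t = s (x t)" for t
  have xU: "x t \<in> \<phi> ` U" if "t \<in> I" for t using that \<gamma> by (auto simp: x_def)
  have dx: "(x has_vector_derivative d' t) (at t)" if "t \<in> I" for t
    using d(1)[OF that] by (simp add: x_def[abs_def])
  have dS: "(S has_vector_derivative d' t $ 1 *\<^sub>R (prolong 1 (x t) *v S t) + d' t $ 2 *\<^sub>R (prolong 2 (x t) *v S t)) (at t)"
    if "t \<in> I" for t
  proof -
    have p: "(s has_derivative (\<lambda>v. (v $ 1) *\<^sub>R (prolong 1 (x t) *v S t) + (v $ 2) *\<^sub>R (prolong 2 (x t) *v S t))) (at (x t))"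
      using par[OF that] by (simp add: parallel_at_def x_def S_def)
    show ?thesis
      using has_derivative_compose[OF dx[OF that, unfolded has_vector_derivative_def] p]
      by (simp add: has_vector_derivative_def S_def[abs_def] scaleR_add_right)
  qed
  \<comment> \<open>The derivative of the first component of \<open>S\<close>: the first row of the
    prolonged system says that the other two components are its partial derivatives.\<close>
  define w' where "w' t = d' t $ 1 * S t $ 2 + d' t $ 2 * S t $ 3" for t
  have real: "((\<lambda>t. F t $ i) has_real_derivative F' $ i) (at t)" if "(F has_vector_derivative F') (at t)"
    for F :: "real \<Rightarrow> real^'k" and F' i t
    using bounded_linear.has_vector_derivative[OF bounded_linear_vec_nth that]
    by (simp add: has_real_derivative_iff_has_vector_derivative)
  have "S t $ 1 = 0"
  proof (rule linear_ode_zero[of I f "\<lambda>t. Rc (x t) (d' t) (d' t)" "\<lambda>t. S t $ 1" w' t0])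
    show "is_interval I" using geo by (simp add: geodesic_def)
    show "continuous_on I f" using f by (rule smooth_on_imp_continuous_on)
    have "continuous_on I d'" "continuous_on I x"
      using d(2) dx by (auto intro!: continuous_at_imp_continuous_on has_vector_derivative_continuous)
    moreover have "continuous_on I (\<lambda>t. \<rho> i j (x t))" for i j
      by (rule continuous_on_compose2[OF smooth_on_imp_continuous_on[OF smooth_\<rho>] \<open>continuous_on I x\<close>])
        (use xU in auto)
    ultimately show "continuous_on I (\<lambda>t. Rc (x t) (d' t) (d' t))"
      unfolding Rc_expand by (intro continuous_intros)
    fix t assume t: "t \<in> I"
    show "((\<lambda>t. S t $ 1) has_real_derivative w' t) (at t)"
      using real[OF dS[OF t], of 1] by (simp add: prolong_apply w'_def axis_def)
    have "(w' has_real_derivative (d' t $ 1 * (d' t $ 1 *\<^sub>R (prolong 1 (x t) *v S t) + d' t $ 2 *\<^sub>R (prolong 2 (x t) *v S t)) $ 2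
        + d'' t $ 1 * S t $ 2)
       + (d' t $ 2 * (d' t $ 1 *\<^sub>R (prolong 1 (x t) *v S t) + d' t $ 2 *\<^sub>R (prolong 2 (x t) *v S t)) $ 3
        + d'' t $ 2 * S t $ 3)) (at t)"
      unfolding w'_def[abs_def] by (intro DERIV_add DERIV_mult' real d(2)[OF t] dS[OF t])
    moreover have "(d' t $ 1 * (d' t $ 1 *\<^sub>R (prolong 1 (x t) *v S t) + d' t $ 2 *\<^sub>R (prolong 2 (x t) *v S t)) $ 2
        + d'' t $ 1 * S t $ 2)
       + (d' t $ 2 * (d' t $ 1 *\<^sub>R (prolong 1 (x t) *v S t) + d' t $ 2 *\<^sub>R (prolong 2 (x t) *v S t)) $ 3
        + d'' t $ 2 * S t $ 3) = f t * w' t - Rc (x t) (d' t) (d' t) * S t $ 1"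
      by (simp add: d''[OF t] x_def[symmetric] prolong_apply Rc_expand G_def w'_def algebra_simps)
    ultimately show "(w' has_real_derivative f t * w' t - Rc (x t) (d' t) (d' t) * S t $ 1) (at t)" by simp
  qed (use t0 t eq in \<open>auto simp: S_def x_def w'_def\<close>)
  then show ?thesis by (simp add: S_def x_def)
qed

text \<open>Three solutions restricted to a geodesic are linearly dependent, and the ratios of the
  solutions are the straightening coordinates.\<close>

lemma straightening_chart_exists:
  assumes sym: "ricci_symmetric A nabla" and cotton: "\<And>j x. x \<in> \<phi> ` U \<Longrightarrow> cotton j x = 0" and p: "p \<in> U"
  shows "\<exists>W \<kappa>. p \<in> W \<and> coordinate_chart A (W, \<kappa>) \<and> straightens_geodesics A nabla (W, \<kappa>)"
proof -
  have "\<exists>T s. open T \<and> \<phi> p \<in> T \<and> T \<subseteq> \<phi> ` U \<and> s (\<phi> p) = s0 \<and> smooth_on T s \<and> (\<forall>x\<in>T. parallel_at s x)" for s0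
  proof -
    have flat: "frechet_derivative (prolong 1) (at x) (axis 2 1) + prolong 1 x ** prolong 2 x
        = frechet_derivative (prolong 2) (at x) (axis 1 1) + prolong 2 x ** prolong 1 x" if "x \<in> \<phi> ` U" for x
      by (rule prolong_flat[OF sym that cotton[OF that] cotton[OF that]])
    show ?thesis
      by (rule flat_system_solution[OF open_\<phi>U imageI[OF p] smooth_prolong smooth_prolong flat, where ?s0.0 = s0])
        (auto simp: parallel_at_def)
  qed
  \<comment> \<open>The initial values at \<open>p\<close> are the three basis vectors, so there
    \<open>w 1\<close> is 1 with zero derivative, while \<open>w 2\<close> and \<open>w 3\<close>
    vanish and have the coordinate differentials as derivatives.\<close>
  then have "\<exists>T s. open T \<and> \<phi> p \<in> T \<and> T \<subseteq> \<phi> ` U \<and> s (\<phi> p) = axis i 1 \<and> smooth_on T s \<and> (\<forall>x\<in>T. parallel_at s x)"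
    for i :: 3 by blast
  then obtain T s where T: "\<And>i :: 3. open (T i)" "\<And>i. \<phi> p \<in> T i" "\<And>i. T i \<subseteq> \<phi> ` U"
    and s: "\<And>i. s i (\<phi> p) = axis i 1" "\<And>i. smooth_on (T i) (s i)" "\<And>i x. x \<in> T i \<Longrightarrow> parallel_at (s i) x"
    by metis
  define w where "w i x = s i x $ 1" for i x
  define S where "S = (T 1 \<inter> T 2 \<inter> T 3) \<inter> w 1 -` (- {0})"
  have T123: "open (T 1 \<inter> T 2 \<inter> T 3)" using T(1) by (intro open_Int)
  have in_T: "x \<in> T i" if "x \<in> T 1 \<inter> T 2 \<inter> T 3" for x i using that exhaust_3[of i] by auto
  have sw: "smooth_on (T 1 \<inter> T 2 \<inter> T 3) (w i)" for i
    unfolding w_def[abs_def]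
    by (intro smooth_on_nth T123 smooth_on_subset[OF s(2)[of i]]) (use in_T in blast)
  have "open S"
    unfolding S_def by (intro continuous_open_preimage T123 smooth_on_imp_continuous_on[OF sw]) auto
  moreover have pS: "\<phi> p \<in> S" using T(2) by (simp add: S_def w_def s(1))
  ultimately have S: "open S" "\<phi> p \<in> S" "S \<subseteq> \<phi> ` U" using T(3)[of 1] by (auto simp: S_def)
  have wS: "smooth_on S (w i)" "x \<in> S \<Longrightarrow> w 1 x \<noteq> 0" for i x
    using smooth_on_subset[OF sw[of i], of S] by (auto simp: S_def)
  define h where "h x = (w 2 x / w 1 x) *\<^sub>R axis 1 1 + (w 3 x / w 1 x) *\<^sub>R (axis 2 1 :: real^2)" for x
  have h: "smooth_on S h"
    unfolding h_def[abs_def] by (intro smooth_intros smooth_on_divide S(1) wS)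
  have dw: "(w i has_derivative (\<lambda>v. v $ 1 * s i x $ 2 + v $ 2 * s i x $ 3)) (at x)" if "x \<in> T i" for i x
    using bounded_linear.has_derivative[OF bounded_linear_vec_nth s(3)[OF that, unfolded parallel_at_def], of 1]
    by (simp add: w_def[abs_def] prolong_apply axis_def)
  have dwp: "(w i has_derivative (\<lambda>v. v $ 1 * axis i 1 $ 2 + v $ 2 * axis i 1 $ 3)) (at (\<phi> p))" for i
    using dw[OF T(2)[of i]] by (simp add: s(1))
  have wp: "w i (\<phi> p) = axis i 1 $ 1" for i by (simp add: w_def s(1))
  \<comment> \<open>Because of these initial values the quotient has the same derivative at
    \<open>p\<close> as its numerator. Hence the derivative of \<open>h\<close> there is the
    identity.\<close>
  have quotient: "((\<lambda>x. w i x / w 1 x) has_derivative (\<lambda>v. v $ 1 * axis i 1 $ 2 + v $ 2 * axis i 1 $ 3)) (at (\<phi> p))"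
    if "i \<noteq> 1" for i
    using has_derivative_divide'[OF dwp[of i] dwp[of 1]] that by (simp add: wp axis_def)
  have "(h has_derivative (\<lambda>v. v $ 1 *\<^sub>R axis 1 1 + v $ 2 *\<^sub>R axis 2 1)) (at (\<phi> p))"
    using has_derivative_add[OF
        bounded_linear.has_derivative[OF bounded_linear_scaleR_left[of "axis 1 1 :: real^2"] quotient[of 2]]
        bounded_linear.has_derivative[OF bounded_linear_scaleR_left[of "axis 2 1 :: real^2"] quotient[of 3]]]
    by (simp add: h_def[abs_def] axis_def)
  then have "(h has_derivative (\<lambda>v. v)) (at (\<phi> p))"
    using vec2_eq_axis_sum by (metis (no_types, lifting) has_derivative_eq_rhs ext)
  then have "frechet_derivative h (at (\<phi> p)) = (\<lambda>v. v)" by (metis frechet_derivative_at)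
  then have "inj (frechet_derivative h (at (\<phi> p)))" by (simp add: inj_on_def)
  then obtain V g where V: "open V" "\<phi> p \<in> V" "V \<subseteq> S" "open (h ` V)" "homeomorphism V (h ` V) h g"
    "smooth_on (h ` V) g"
    using smooth_inverse_function_2[OF S(1,2) h] by blast
  define N where "N = U \<inter> \<phi> -` V"
  have chart: "coordinate_chart A (N, \<lambda>q. h (\<phi> q))"
    unfolding N_def
    by (rule coordinate_chart_compose[OF V(1) _ V(4,5) smooth_on_subset[OF h V(3)] V(6)]) (use V(3) S(3) in auto)
  have "straightens_geodesics A nabla (N, \<lambda>q. h (\<phi> q))"
    unfolding straightens_geodesics_def fst_conv snd_conv
  proof (intro allI impI, elim conjE)
    fix I \<gamma> assume geo: "geodesic A nabla I \<gamma>" and \<gamma>N: "\<gamma> ` I \<subseteq> N"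
    have \<gamma>: "\<gamma> ` I \<subseteq> U" using \<gamma>N by (auto simp: N_def)
    have xS: "\<phi> (\<gamma> t) \<in> S" if "t \<in> I" for t using that \<gamma>N V(3) by (auto simp: N_def)
    have xT: "\<phi> (\<gamma> t) \<in> T i" if "t \<in> I" for t i
      by (rule in_T) (use xS[OF that] in \<open>simp add: S_def\<close>)
    have line: "affine {y :: real^2. a \<bullet> y = b} \<and> aff_dim {y. a \<bullet> y = b} = 1" if "a \<noteq> 0" for a b
      using that by (simp add: affine_hyperplane)
    show "\<exists>L. affine L \<and> aff_dim L = 1 \<and> (\<lambda>q. h (\<phi> q)) ` \<gamma> ` I \<subseteq> L"
    proof (cases "I = {}")
      case True
      have "axis 1 1 \<noteq> (0 :: real^2)" by (simp add: axis_eq_0_iff)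
      from line[OF this, of 0] show ?thesis
        unfolding True image_empty by (intro exI conjI empty_subsetI) (rule conjunct1 conjunct2, assumption)+
    next
      case False
      then obtain t0 where t0: "t0 \<in> I" by blast
      obtain c' where c': "\<And>t. t \<in> I \<Longrightarrow> ((\<lambda>t. \<phi> (\<gamma> t)) has_vector_derivative c' t) (at t)"
        by (rule geodesic_coords[OF geo \<gamma>], rule that)
      let ?x0 = "\<phi> (\<gamma> t0)"
      \<comment> \<open>Its rows are the values at \<open>t0\<close> of the three solutions and of
        their derivatives along the geodesic. Two equations in three unknowns have a nonzero
        solution \<alpha>, and that combination of solutions has zero initial data.\<close>
      define M :: "real^3^2" where "M = vector [\<chi> i. s i ?x0 $ 1, \<chi> i. c' t0 $ 1 * s i ?x0 $ 2 + c' t0 $ 2 * s i ?x0 $ 3]"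
      have "rank M \<noteq> CARD(3)" using rank_bound[of M] by simp
      then obtain \<alpha> where \<alpha>: "\<alpha> \<noteq> 0" "M *v \<alpha> = 0"
        unfolding matrix_nonfull_linear_equations_eq[symmetric] by blast
      define \<sigma> where "\<sigma> x = (\<Sum>i\<in>UNIV. \<alpha> $ i *\<^sub>R s i x)" for x
      have "\<sigma> (\<phi> (\<gamma> t)) $ 1 = 0" if t: "t \<in> I" for t
      proof (rule parallel_along_geodesic[OF geo \<gamma> _ c' t0 _ _ t])
        show "parallel_at \<sigma> (\<phi> (\<gamma> t))" if "t \<in> I" for t
          unfolding \<sigma>_def[abs_def] by (rule parallel_at_linear_combination) (rule s(3)[OF xT[OF that]])
        have "(M *v \<alpha>) $ 1 = 0" "(M *v \<alpha>) $ 2 = 0" using \<alpha>(2) by simp_all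
        then show "\<sigma> ?x0 $ 1 = 0" "c' t0 $ 1 * \<sigma> ?x0 $ 2 + c' t0 $ 2 * \<sigma> ?x0 $ 3 = 0"
          by (simp_all add: M_def matrix_vector_mult_def \<sigma>_def sum_3 algebra_simps)
      qed
      then have dep: "\<alpha> $ 1 * w 1 (\<phi> (\<gamma> t)) + \<alpha> $ 2 * w 2 (\<phi> (\<gamma> t)) + \<alpha> $ 3 * w 3 (\<phi> (\<gamma> t)) = 0" if "t \<in> I" for t
        using that by (simp add: \<sigma>_def sum_3 w_def)
      \<comment> \<open>Dividing the linear relation by \<open>w 1\<close> gives the line with
        normal vector \<open>a\<close>. If \<open>a\<close> were zero, the relation would reduce to
        \<open>\<alpha> $ 1 * w 1 = 0\<close> and force \<alpha> to vanish.\<close>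
      define a where "a = \<alpha> $ 2 *\<^sub>R axis 1 1 + \<alpha> $ 3 *\<^sub>R (axis 2 1 :: real^2)"
      have a12: "a $ 1 = \<alpha> $ 2" "a $ 2 = \<alpha> $ 3" by (simp_all add: a_def axis_def)
      have "a \<noteq> 0"
      proof
        assume "a = 0"
        then have "\<alpha> $ 2 = 0" "\<alpha> $ 3 = 0" using a12 by simp_all
        moreover from this have "\<alpha> $ 1 = 0" using dep[OF t0] wS(2)[OF xS[OF t0]] by simp
        ultimately show False using \<alpha>(1) by (simp add: vec_eq_iff forall_3)
      qed
      moreover have "a \<bullet> h (\<phi> (\<gamma> t)) = - \<alpha> $ 1" if t: "t \<in> I" for t
      proof -
        have h12: "h y $ 1 = w 2 y / w 1 y" "h y $ 2 = w 3 y / w 1 y" for y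
          by (simp_all add: h_def axis_def)
        show ?thesis
          using dep[OF t] wS(2)[OF xS[OF t]]
          by (simp add: inner_vec_def sum_2 a12 h12 field_simps)
      qed
      ultimately show ?thesis
        using line[of a "- \<alpha> $ 1"] by (intro exI[of _ "{y. a \<bullet> y = - \<alpha> $ 1}"]) auto
    qed
  qed
  moreover have "p \<in> N" using p V(2) by (simp add: N_def)
  ultimately show ?thesis using chart by blast
qed

end

theorem mainTheorem1:
  fixes A :: "('m::{t2_space, second_countable_topology} set \<times> ('m \<Rightarrow> real^2)) set"
    and nabla :: "'m nabla"
  assumes "smooth_atlas A"
    and "connection A nabla"
    and "torsion_free A nabla"
    and "ricci_symmetric A nabla"
  shows "(\<forall>p. \<forall>u\<in>tangent_space A p. \<forall>v\<in>tangent_space A p. \<forall>w\<in>tangent_space A p.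
            cotton_york A nabla p u v w = 0) \<longleftrightarrow>
         (\<forall>p. \<exists>W \<phi>. p \<in> W \<and> coordinate_chart A (W, \<phi>) \<and> straightens_geodesics A nabla (W, \<phi>))"
proof
  assume flat: "\<forall>p. \<forall>u\<in>tangent_space A p. \<forall>v\<in>tangent_space A p. \<forall>w\<in>tangent_space A p.
    cotton_york A nabla p u v w = 0"
  show "\<forall>p. \<exists>W \<phi>. p \<in> W \<and> coordinate_chart A (W, \<phi>) \<and> straightens_geodesics A nabla (W, \<phi>)"
  proof
    fix p
    obtain U \<phi> where c: "(U, \<phi>) \<in> A" and p: "p \<in> U"
      using assms(1) unfolding smooth_atlas_def by (metis UNIV_I UN_E prod.collapse)
    interpret surface_connection A U \<phi> nabla
      using assms c by unfold_locales (auto simp: smooth_atlas_def)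
    have "cotton j x = 0" if "x \<in> \<phi> ` U" for j x
    proof -
      from that obtain q where q: "q \<in> U" "x = \<phi> q" by (rule imageE)
      then show ?thesis
        using cotton_york_zero_iff[OF q(1)] flat exhaust_2[of j] by auto
    qed
    then show "\<exists>W \<phi>. p \<in> W \<and> coordinate_chart A (W, \<phi>) \<and> straightens_geodesics A nabla (W, \<phi>)"
      by (rule straightening_chart_exists[OF assms(4) _ p])
  qed
next
  assume straight: "\<forall>p. \<exists>W \<phi>. p \<in> W \<and> coordinate_chart A (W, \<phi>) \<and> straightens_geodesics A nabla (W, \<phi>)"
  show "\<forall>p. \<forall>u\<in>tangent_space A p. \<forall>v\<in>tangent_space A p. \<forall>w\<in>tangent_space A p.
    cotton_york A nabla p u v w = 0"
  proof
    fix p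
    obtain U \<phi> where p: "p \<in> U" and c: "coordinate_chart A (U, \<phi>)"
      and s: "straightens_geodesics A nabla (U, \<phi>)"
      using straight by blast
    \<comment> \<open>The components are computed in the straightening chart itself; vanishing of
      the Cotton-York tensor is a statement about tangent vectors and does not depend on this
      choice.\<close>
    interpret surface_connection A U \<phi> nabla
      using assms c by unfold_locales auto
    show "\<forall>u\<in>tangent_space A p. \<forall>v\<in>tangent_space A p. \<forall>w\<in>tangent_space A p.
        cotton_york A nabla p u v w = 0"
      unfolding cotton_york_zero_iff[OF p]
      using straight_geodesics_cotton[OF s assms(4)] p by blast
  qed
qed

end
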